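(* Assume that the mortar conditions hold: there is a constant $C_*>0$, independent of $h,H,\Delta t,\Delta T$, such that for all $\mu\in\Lambda_H$ and all $i,j$, $\|\mu\|_{\Gamma_{ij}}\le C_*\big(\|\mathcal Q_{h,i}\mu\|_{\Gamma_{ij}}+\|\mathcal Q_{h,j}\mu\|_{\Gamma_{ij}}\big)$, and, for all $i,j$, $\Lambda_{ij}^{\Delta T}\subset W_i^{\Delta t}\cap W_j^{\Delta t}$. Then the space-time Steklov–Poincaré operator $S:\Lambda_H^{\Delta T}\to\Lambda_H^{\Delta T}$ is positive definite, i.e. $\langle S\mu,\mu\rangle_{\Gamma^T}>0$ for all $0\ne\mu\in\Lambda_H^{\Delta T}$.
   Context: **Domain and data.** $\Omega\subset\mathbb R^d$, $d\in\{2,3\}$, is a bounded polytopal domain with Lipschitz boundary, $T>0$; the diameter of $\Omega$ and $T$ are of order one. $K=K(x)$ is a symmetric tensor with $k_{\min}\zeta^T\zeta\le\zeta^TK(x)\zeta\le k_{\max}\zeta^T\zeta$ for all $\zeta\in\mathbb R^d$ and a.e. $x$, $0<k_{\min}\le k_{\max}<\infty$. $\overline\Omega=\cup_i\overline{\Omega_i}$ is a union of finitely many non-overlapping polytopal Lipschitz subdomains $\Omega_i$ with outward unit normals $\mathbf n_i$; $\Gamma_i=\partial\Omega_i\setminus\partial\Omega$, $\Gamma_{ij}=\Gamma_i\cap\Gamma_j$ (adjacent subdomains), $\Gamma=\cup\Gamma_{ij}$. For a set $\mathcal O$, $\mathcal O^T=\mathcal O\times(0,T)$. $(\cdot,\cdot)_{\mathcal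 O}$, $\langle\cdot,\cdot\rangle_S$ are $L^2$ inner products and $\|\cdot\|_{\mathcal O}$, $\|\cdot\|_{\mathcal O^T}$ denote $L^2$ norms. **Spaces and forms.** $\mathbf V_i=\mathbf H({\rm div};\Omega_i)$, $W_i=L^2(\Omega_i)$. $a_i(\mathbf u,\mathbf v)=(K^{-1}\mathbf u,\mathbf v)_{\Omega_i}$, $b_i(\mathbf v,w)=-(\nabla\cdot\mathbf v,w)_{\Omega_i}$; for a spatial form $s$, $s^T(\cdot,\cdot)=\int_0^Ts(\cdot,\cdot)\,dt$. **Discretization.** $\mathcal T_{h,i}$ is a shape-regular partition of $\Omega_i$ into simplices or parallelepipeds (not necessarily matching across interfaces), $h$ the maximal element diameter over all $i$. $\mathcal T_i^{\Delta t}:0=t_i^0<\dots<t_i^{N_i}=T$ is a partition of $(0,T)$ for $\Omega_i$, with $\Delta t$ the maximal step over all $i$. $\mathbf V_{h,i}\times W_{h,i}\subset\mathbf V_i\times W_i$ is a standard inf–sup stable mixed finite element pair on $\mathcal T_{h,i}$ (e.g. Raviart–Thomas or Brezzi–Douglas–Marini), with $\nabla\cdot\mathbf V_{h,i}=W_{h,i}$. $W_i^{\Delta t}$ is the space of discontinuous piecewise polynomials in time of fixed degree on $\mathcal T_i^{\Delta t}$. $\mathbf V_{h,i}^{\Delta t}=\mathbf V_{h,i}\times W_i^{\Delta t}$ and $W_{h,i}^{\Delta t}=W_{h,i}\times W_i^{\Delta t}$ (tensor products in space and time). $\mathcal T_{H,ij}$ is a shape-regular partition of $\Gamma_{ij}$,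 $H$ the maximal diameter over all $i,j$; $\mathcal T_{ij}^{\Delta T}$ is a partition of $(0,T)$ for $\Gamma_{ij}$, $\Delta T$ the maximal step over all $i,j$. $\Lambda_{H,ij}$, $\Lambda_{ij}^{\Delta T}$ are spaces of continuous or discontinuous piecewise polynomials on $\mathcal T_{H,ij}$ and $\mathcal T_{ij}^{\Delta T}$; $\Lambda_{H,ij}^{\Delta T}=\Lambda_{H,ij}\times\Lambda_{ij}^{\Delta T}$ (tensor product). $\Lambda_H=\bigoplus\Lambda_{H,ij}$, $\mathbf V_h^{\Delta t}=\bigoplus\mathbf V_{h,i}^{\Delta t}$, $W_h^{\Delta t}=\bigoplus W_{h,i}^{\Delta t}$, $\Lambda_H^{\Delta T}=\bigoplus\Lambda_{H,ij}^{\Delta T}$. $\mathcal Q_{h,i}:L^2(\partial\Omega_i)\to\mathbf V_{h,i}\cdot\mathbf n_i$ is the $L^2$-orthogonal projection (mortar functions are extended by zero to $\partial\Omega$). **DG time derivative.** For $\varphi$ piecewise polynomial in time on $\mathcal T_i^{\Delta t}$, $\varphi_k^\pm$ denote the one-sided limits at $t_i^k$ from the right/left, $[\varphi]_k=\varphi_k^+-\varphi_k^-$, with $\varphi_0^-$ a prescribed initial value; $\int_0^T\tilde\partial_t\varphi\,\phi=\sum_{k=1}^{N_i}\int_{t_i^{k-1}}^{t_i^k}\partial_t\varphi\,\phi+\sum_{k=1}^{N_i}[\varphi]_{k-1}\phi_{k-1}^+$. **Steklov–Poincaré operator.** For $\mu\in\Lambda_H^{\Delta T}$, let $\mathbf u_h^{\Delta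 t,*}(\mu)\in\mathbf V_h^{\Delta t}$, $p_h^{\Delta t,*}(\mu)\in W_h^{\Delta t}$ be such that on each $\Omega_i^T$ their restrictions in $\mathbf V_{h,i}^{\Delta t}\times W_{h,i}^{\Delta t}$ solve, with zero initial value $(p_h^{\Delta t,*}(\mu))_0^-=0$, $a_i^T(\mathbf u_h^{\Delta t,*}(\mu),\mathbf v)+b_i^T(\mathbf v,p_h^{\Delta t,*}(\mu))=-\langle\mathbf v\cdot\mathbf n_i,\mu\rangle_{\Gamma_i^T}$ for all $\mathbf v\in\mathbf V_{h,i}^{\Delta t}$, and $(\tilde\partial_tp_h^{\Delta t,*}(\mu),w)_{\Omega_i^T}-b_i^T(\mathbf u_h^{\Delta t,*}(\mu),w)=0$ for all $w\in W_{h,i}^{\Delta t}$. Then $S:\Lambda_H^{\Delta T}\to\Lambda_H^{\Delta T}$ is defined by $\langle S\lambda,\mu\rangle_{\Gamma^T}=-\sum_i\langle\mathbf u_h^{\Delta t,*}(\lambda)\cdot\mathbf n_i,\mu\rangle_{\Gamma_i^T}$ for all $\lambda,\mu\in\Lambda_H^{\Delta T}$. ($S$ is not claimed to be symmetric.) *)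

theory Defs
  imports "HOL-Analysis.Analysis"
begin

section \<open>Square-integrable functions\<close>

text \<open>Functions represent their almost-everywhere classes; all forms below are insensitive to the
  choice of the representative.\<close>

definition L2 :: "'a measure \<Rightarrow> ('a \<Rightarrow> 'b::euclidean_space) set" where
  "L2 M = {f \<in> borel_measurable M. integrable M (\<lambda>x. (norm (f x))\<^sup>2)}"

definition l2_inner :: "'a measure \<Rightarrow> ('a \<Rightarrow> 'b::euclidean_space) \<Rightarrow> ('a \<Rightarrow> 'b) \<Rightarrow> real" where
  "l2_inner M f g = (LINT x|M. f x \<bullet> g x)"

definition l2_norm :: "'a measure \<Rightarrow> ('a \<Rightarrow> 'b::euclidean_space) \<Rightarrow> real" where
  "l2_norm M f = sqrt (l2_inner M f f)"

text \<open>For a spatial form \<open>s\<close>, this is the space-time form \<open>s\<^sup>T(u,v)\<close>, the integral of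
  \<open>s(u(t),v(t))\<close> over \<open>(0,T)\<close>.  Space-time functions are curried, with time as first argument.\<close>

definition time_form :: "real \<Rightarrow> ('u \<Rightarrow> 'v \<Rightarrow> real) \<Rightarrow> (real \<Rightarrow> 'u) \<Rightarrow> (real \<Rightarrow> 'v) \<Rightarrow> real" where
  "time_form T s u v = (LINT t|lebesgue_on {0<..<T}. s (u t) (v t))"

definition fun_span :: "('x \<Rightarrow> 'v::real_vector) set \<Rightarrow> ('x \<Rightarrow> 'v) set" where
  "fun_span B = {\<lambda>x. \<Sum>b\<in>F. c b *\<^sub>R b x | F c. finite F \<and> F \<subseteq> B}"

definition finite_dim_space :: "('x \<Rightarrow> 'v::real_vector) set \<Rightarrow> bool" where
  "finite_dim_space V \<longleftrightarrow> (\<exists>B. finite B \<and> V = fun_span B)"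

definition tensor_space ::
  "('x \<Rightarrow> 'v::real_vector) set \<Rightarrow> (real \<Rightarrow> real) set \<Rightarrow> (real \<Rightarrow> 'x \<Rightarrow> 'v) set" where
  "tensor_space V \<Psi> =
     {\<lambda>t x. \<Sum>k<m. \<psi> k t *\<^sub>R v k x | (m::nat) \<psi> v. \<forall>k<m. \<psi> k \<in> \<Psi> \<and> v k \<in> V}"


section \<open>Surface measure\<close>

text \<open>Hausdorff outer measure of dimension \<open>k \<ge> 1\<close>, normalised to agree with \<open>k\<close>-dimensional
  Lebesgue measure.\<close>

definition hausdorff_outer :: "nat \<Rightarrow> 'a::metric_space set \<Rightarrow> ennreal" where
  "hausdorff_outer k A =
     (SUP \<delta>\<in>{0::real<..}.
        INF U\<in>{U :: nat \<Rightarrow> 'a set. A \<subseteq> (\<Union>n. U n) \<and> (\<forall>n. bounded (U n) \<and> diameter (U n) \<le> \<delta>)}.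
          \<Sum>n. ennreal (unit_ball_vol (real k) * (diameter (U n) / 2) ^ k))"

text \<open>The \<open>(d-1)\<close>-dimensional Hausdorff measure on \<open>\<real>\<^sup>d\<close>.  The outer measure is metric, hence
  countably additive on Borel sets by Caratheodory's criterion, so that \<open>measure_of\<close> yields
  the intended measure.\<close>

definition surface_measure :: "(real^'n) measure" where
  "surface_measure =
     completion (measure_of UNIV (sets borel) (hausdorff_outer (CARD('n) - 1)))"

definition surface_on :: "(real^'n) set \<Rightarrow> (real^'n) measure" where
  "surface_on S = restrict_space surface_measure S"


section \<open>Polytopal Lipschitz domains\<close>

text \<open>Near each boundary point the set is the subgraph, in direction \<open>e\<close>, of a Lipschitz function
  of the component orthogonal to \<open>e\<close>.\<close>

definition lipschitz_boundary :: "'a::euclidean_space set \<Rightarrow> bool" where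
  "lipschitz_boundary S \<longleftrightarrow>
     (\<forall>x\<in>frontier S. \<exists>r>0. \<exists>e. norm e = 1 \<and> (\<exists>(g::'a \<Rightarrow> real) L. L-lipschitz_on UNIV g \<and>
        S \<inter> ball x r = {y \<in> ball x r. y \<bullet> e < g (y - (y \<bullet> e) *\<^sub>R e)}))"

definition polytopal_lipschitz_domain :: "'a::euclidean_space set \<Rightarrow> bool" where
  "polytopal_lipschitz_domain S \<longleftrightarrow>
     open S \<and> connected S \<and> S \<noteq> {} \<and> bounded S \<and>
     (\<exists>\<P>. finite \<P> \<and> (\<forall>P\<in>\<P>. polytope P) \<and> closure S = \<Union>\<P>) \<and>
     lipschitz_boundary S"

text \<open>The boundary of a polytopal domain is flat near all its points except those of a set of
  vanishing surface measure (corners and edges), where the normal is set to \<open>0\<close>.\<close>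

definition is_outward_normal :: "'a::euclidean_space set \<Rightarrow> 'a \<Rightarrow> 'a \<Rightarrow> bool" where
  "is_outward_normal S x n \<longleftrightarrow>
     norm n = 1 \<and> (\<exists>r>0. S \<inter> ball x r = {y \<in> ball x r. (y - x) \<bullet> n < 0})"

definition outward_normal :: "'a::euclidean_space set \<Rightarrow> 'a \<Rightarrow> 'a" where
  "outward_normal S x =
     (if \<exists>n. is_outward_normal S x n then THE n. is_outward_normal S x n else 0)"


section \<open>The space H(div)\<close>

text \<open>\<open>G\<close> is the gradient of \<open>\<phi>\<close>.  Continuously differentiable test functions define the
  same weak divergence as smooth ones.\<close>

definition test_function ::
  "'a::euclidean_space set \<Rightarrow> ('a \<Rightarrow> real) \<Rightarrow> ('a \<Rightarrow> 'a) \<Rightarrow> bool" where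
  "test_function S \<phi> G \<longleftrightarrow>
     (\<forall>x. (\<phi> has_derivative (\<lambda>h. G x \<bullet> h)) (at x)) \<and> continuous_on UNIV G \<and>
     compact (closure {x. \<phi> x \<noteq> 0}) \<and> closure {x. \<phi> x \<noteq> 0} \<subseteq> S"

definition has_weak_div ::
  "'a::euclidean_space set \<Rightarrow> ('a \<Rightarrow> 'a) \<Rightarrow> ('a \<Rightarrow> real) \<Rightarrow> bool" where
  "has_weak_div S v g \<longleftrightarrow>
     g \<in> L2 (lebesgue_on S) \<and>
     (\<forall>\<phi> G. test_function S \<phi> G \<longrightarrow>
        l2_inner (lebesgue_on S) v G = - l2_inner (lebesgue_on S) g \<phi>)"

definition Hdiv :: "'a::euclidean_space set \<Rightarrow> ('a \<Rightarrow> 'a) set" where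
  "Hdiv S = {v \<in> L2 (lebesgue_on S). \<exists>g. has_weak_div S v g}"

definition weak_div :: "'a::euclidean_space set \<Rightarrow> ('a \<Rightarrow> 'a) \<Rightarrow> 'a \<Rightarrow> real" where
  "weak_div S v = (SOME g. has_weak_div S v g)"

definition Hdiv_norm :: "'a::euclidean_space set \<Rightarrow> ('a \<Rightarrow> 'a) \<Rightarrow> real" where
  "Hdiv_norm S v =
     sqrt ((l2_norm (lebesgue_on S) v)\<^sup>2 + (l2_norm (lebesgue_on S) (weak_div S v))\<^sup>2)"


section \<open>The continuous problem\<close>

text \<open>Subdomains are indexed by \<open>i < num_sub\<close>.  \<open>time_degree i\<close> is the fixed polynomial degree in time
  on the \<open>i\<close>-th subdomain.\<close>

record 'n problem =
  dom :: "(real^'n) set"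
  num_sub :: nat
  sub :: "nat \<Rightarrow> (real^'n) set"
  perm :: "real^'n \<Rightarrow> real^'n^'n"
  final_time :: real
  time_degree :: "nat \<Rightarrow> nat"

definition valid_perm :: "(real^'n) set \<Rightarrow> (real^'n \<Rightarrow> real^'n^'n) \<Rightarrow> bool" where
  "valid_perm S K \<longleftrightarrow>
     K \<in> borel_measurable (lebesgue_on S) \<and>
     (AE x in lebesgue_on S. transpose (K x) = K x) \<and>
     (\<exists>kmin kmax. 0 < kmin \<and> kmin \<le> kmax \<and>
        (AE x in lebesgue_on S. \<forall>\<zeta>.
           kmin * (\<zeta> \<bullet> \<zeta>) \<le> \<zeta> \<bullet> (K x *v \<zeta>) \<and> \<zeta> \<bullet> (K x *v \<zeta>) \<le> kmax * (\<zeta> \<bullet> \<zeta>)))"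

definition valid_problem :: "'n::finite problem \<Rightarrow> bool" where
  "valid_problem P \<longleftrightarrow>
     polytopal_lipschitz_domain (dom P) \<and>
     0 < final_time P \<and>
     valid_perm (dom P) (perm P) \<and>
     (\<forall>i<num_sub P. polytopal_lipschitz_domain (sub P i)) \<and>
     (\<forall>i<num_sub P. \<forall>j<num_sub P. i \<noteq> j \<longrightarrow> sub P i \<inter> sub P j = {}) \<and>
     closure (dom P) = (\<Union>i<num_sub P. closure (sub P i))"

definition bdry :: "'n::finite problem \<Rightarrow> nat \<Rightarrow> (real^'n) set" where
  "bdry P i = frontier (sub P i) - frontier (dom P)"

definition iface :: "'n::finite problem \<Rightarrow> nat \<times> nat \<Rightarrow> (real^'n) set" where
  "iface P e = bdry P (fst e) \<inter> bdry P (snd e)"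

text \<open>Pairs of adjacent subdomains, each unordered pair being listed once.\<close>

definition interfaces :: "'n::finite problem \<Rightarrow> (nat \<times> nat) set" where
  "interfaces P =
     {(i, j). i < j \<and> j < num_sub P \<and> 0 < emeasure surface_measure (iface P (i, j))}"

definition a_form ::
  "'n::finite problem \<Rightarrow> nat \<Rightarrow> (real^'n \<Rightarrow> real^'n) \<Rightarrow> (real^'n \<Rightarrow> real^'n) \<Rightarrow> real" where
  "a_form P i u v = l2_inner (lebesgue_on (sub P i)) (\<lambda>x. matrix_inv (perm P x) *v u x) v"

definition b_form ::
  "'n::finite problem \<Rightarrow> nat \<Rightarrow> (real^'n \<Rightarrow> real^'n) \<Rightarrow> (real^'n \<Rightarrow> real) \<Rightarrow> real" where
  "b_form P i v w = - l2_inner (lebesgue_on (sub P i)) (weak_div (sub P i) v) w"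


section \<open>Discretizations\<close>

text \<open>Time partitions consist of a number \<open>N\<close> of steps and of nodes \<open>t 0, \<dots>, t N\<close>.  The fields
  indexed by pairs are used for \<open>(i, j) \<in> interfaces P\<close> only.\<close>

record 'n discretization =
  mesh :: "nat \<Rightarrow> (real^'n) set set"
  vel_space :: "nat \<Rightarrow> (real^'n \<Rightarrow> real^'n) set"
  pres_space :: "nat \<Rightarrow> (real^'n \<Rightarrow> real) set"
  steps :: "nat \<Rightarrow> nat"
  node :: "nat \<Rightarrow> nat \<Rightarrow> real"
  mortar_mesh :: "nat \<times> nat \<Rightarrow> (real^'n) set set"
  mortar_space :: "nat \<times> nat \<Rightarrow> (real^'n \<Rightarrow> real) set"
  mortar_steps :: "nat \<times> nat \<Rightarrow> nat"
  mortar_node :: "nat \<times> nat \<Rightarrow> nat \<Rightarrow> real"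
  mortar_time_space :: "nat \<times> nat \<Rightarrow> (real \<Rightarrow> real) set"

definition parallelepiped :: "(real^'n) set \<Rightarrow> bool" where
  "parallelepiped E \<longleftrightarrow> (\<exists>a (f::real^'n \<Rightarrow> real^'n). linear f \<and> inj f \<and> E = (\<lambda>x. a + f x) ` cbox 0 1)"

definition spatial_partition :: "(real^'n) set \<Rightarrow> (real^'n) set set \<Rightarrow> bool" where
  "spatial_partition S \<T> \<longleftrightarrow>
     finite \<T> \<and>
     (\<forall>E\<in>\<T>. int CARD('n) simplex E \<or> parallelepiped E) \<and>
     \<Union>\<T> = closure S \<and>
     pairwise (\<lambda>E F. interior E \<inter> interior F = {}) \<T>"

text \<open>\<open>\<Gamma>\<close> is covered only up to a null set because two subdomains that share a facet may in addition
  touch at a lower-dimensional set.\<close>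

definition surface_partition :: "(real^'n) set \<Rightarrow> (real^'n) set set \<Rightarrow> bool" where
  "surface_partition \<Gamma> \<T> \<longleftrightarrow>
     finite \<T> \<and>
     (\<forall>E\<in>\<T>. polytope E \<and> aff_dim E = int CARD('n) - 1) \<and>
     \<Union>\<T> \<subseteq> closure \<Gamma> \<and> emeasure surface_measure (\<Gamma> - \<Union>\<T>) = 0 \<and>
     pairwise (\<lambda>E F. rel_interior E \<inter> rel_interior F = {}) \<T>"

definition time_partition :: "real \<Rightarrow> nat \<Rightarrow> (nat \<Rightarrow> real) \<Rightarrow> bool" where
  "time_partition T N t \<longleftrightarrow> t 0 = 0 \<and> t N = T \<and> (\<forall>k<N. t k < t (Suc k))"

definition piecewise_polynomial ::
  "(real^'n) set set \<Rightarrow> (real^'n \<Rightarrow> 'b::real_normed_vector) \<Rightarrow> bool" where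
  "piecewise_polynomial \<T> f \<longleftrightarrow>
     (\<forall>E\<in>\<T>. \<exists>p. polynomial_function p \<and> (\<forall>x\<in>rel_interior E. f x = p x))"

text \<open>All discontinuous piecewise polynomials of degree at most \<open>q\<close>; values at the nodes and
  outside the interval are immaterial and left free.\<close>

definition dg_space :: "nat \<Rightarrow> nat \<Rightarrow> (nat \<Rightarrow> real) \<Rightarrow> (real \<Rightarrow> real) set" where
  "dg_space q N t =
     {\<psi>. \<forall>k<N. \<exists>p::real poly. degree p \<le> q \<and> (\<forall>s\<in>{t k<..<t (Suc k)}. \<psi> s = poly p s)}"

definition sub_time_space :: "'n::finite problem \<Rightarrow> 'n discretization \<Rightarrow> nat \<Rightarrow> (real \<Rightarrow> real) set" where
  "sub_time_space P D i = dg_space (time_degree P i) (steps D i) (node D i)"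

text \<open>Mixed pairs with \<open>div V\<^sub>h = W\<^sub>h\<close>, as identity of almost-everywhere classes; discrete inf-sup
  stability is a property of families and stated in \<open>inf_sup_stable\<close>.\<close>

definition mixed_pair ::
  "(real^'n) set \<Rightarrow> (real^'n) set set \<Rightarrow> (real^'n \<Rightarrow> real^'n) set \<Rightarrow> (real^'n \<Rightarrow> real) set \<Rightarrow> bool" where
  "mixed_pair S \<T> V W \<longleftrightarrow>
     finite_dim_space V \<and> V \<subseteq> Hdiv S \<and> (\<forall>v\<in>V. piecewise_polynomial \<T> v) \<and>
     finite_dim_space W \<and> W \<subseteq> L2 (lebesgue_on S) \<and> (\<forall>w\<in>W. piecewise_polynomial \<T> w) \<and>
     (\<forall>v\<in>V. \<exists>w\<in>W. has_weak_div S v w) \<and> (\<forall>w\<in>W. \<exists>v\<in>V. has_weak_div S v w)"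

text \<open>The mortar spaces are arbitrary finite-dimensional spaces of piecewise polynomials, with or
  without continuity between elements.\<close>

definition valid_discretization :: "'n::finite problem \<Rightarrow> 'n discretization \<Rightarrow> bool" where
  "valid_discretization P D \<longleftrightarrow>
     (\<forall>i<num_sub P.
        spatial_partition (sub P i) (mesh D i) \<and>
        mixed_pair (sub P i) (mesh D i) (vel_space D i) (pres_space D i) \<and>
        time_partition (final_time P) (steps D i) (node D i)) \<and>
     (\<forall>e\<in>interfaces P.
        surface_partition (iface P e) (mortar_mesh D e) \<and>
        finite_dim_space (mortar_space D e) \<and>
        mortar_space D e \<subseteq> L2 (surface_on (iface P e)) \<and>
        (\<forall>\<mu>\<in>mortar_space D e. piecewise_polynomial (mortar_mesh D e) \<mu>) \<and>
        time_partition (final_time P) (mortar_steps D e) (mortar_node D e) \<and>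
        finite_dim_space (mortar_time_space D e) \<and>
        (\<exists>q. mortar_time_space D e \<subseteq> dg_space q (mortar_steps D e) (mortar_node D e)))"

definition shape_regular :: "'n::finite problem \<Rightarrow> 'n discretization set \<Rightarrow> bool" where
  "shape_regular P \<D> \<longleftrightarrow>
     (\<exists>\<rho>>0. \<forall>D\<in>\<D>.
        (\<forall>i<num_sub P. \<forall>E\<in>mesh D i. \<exists>x. cball x (\<rho> * diameter E) \<subseteq> E) \<and>
        (\<forall>e\<in>interfaces P. \<forall>E\<in>mortar_mesh D e.
           \<exists>x\<in>E. cball x (\<rho> * diameter E) \<inter> affine hull E \<subseteq> E))"

definition inf_sup_stable :: "'n::finite problem \<Rightarrow> 'n discretization set \<Rightarrow> bool" where
  "inf_sup_stable P \<D> \<longleftrightarrow>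
     (\<exists>\<beta>>0. \<forall>D\<in>\<D>. \<forall>i<num_sub P. \<forall>w\<in>pres_space D i.
        \<beta> * l2_norm (lebesgue_on (sub P i)) w
          \<le> (SUP v\<in>{v \<in> vel_space D i. Hdiv_norm (sub P i) v \<noteq> 0}.
                b_form P i v w / Hdiv_norm (sub P i) v))"

definition vel_st :: "'n::finite problem \<Rightarrow> 'n discretization \<Rightarrow> nat \<Rightarrow> (real \<Rightarrow> real^'n \<Rightarrow> real^'n) set" where
  "vel_st P D i = tensor_space (vel_space D i) (sub_time_space P D i)"

definition pres_st :: "'n::finite problem \<Rightarrow> 'n discretization \<Rightarrow> nat \<Rightarrow> (real \<Rightarrow> real^'n \<Rightarrow> real) set" where
  "pres_st P D i = tensor_space (pres_space D i) (sub_time_space P D i)"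


section \<open>Mortar functions and normal traces\<close>

text \<open>Elements of the direct sums over the interfaces are families indexed by \<open>interfaces P\<close>.\<close>

definition mortar_sum ::
  "'n::finite problem \<Rightarrow> 'n discretization \<Rightarrow> (nat \<times> nat \<Rightarrow> real^'n \<Rightarrow> real) set" where
  "mortar_sum P D = {\<mu>. \<forall>e\<in>interfaces P. \<mu> e \<in> mortar_space D e}"

definition mortar_st ::
  "'n::finite problem \<Rightarrow> 'n discretization \<Rightarrow> (nat \<times> nat \<Rightarrow> real \<Rightarrow> real^'n \<Rightarrow> real) set" where
  "mortar_st P D =
     {\<mu>. \<forall>e\<in>interfaces P. \<mu> e \<in> tensor_space (mortar_space D e) (mortar_time_space D e)}"

text \<open>The mortar function seen from the \<open>i\<close>-th subdomain: a function on the boundary of the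
  subdomain, zero outside the interfaces.\<close>

definition mortar_on ::
  "'n::finite problem \<Rightarrow> nat \<Rightarrow> (nat \<times> nat \<Rightarrow> real^'n \<Rightarrow> real) \<Rightarrow> real^'n \<Rightarrow> real" where
  "mortar_on P i \<mu> x =
     (\<Sum>e \<in> {e \<in> interfaces P. i = fst e \<or> i = snd e}. indicator (iface P e) x * \<mu> e x)"

text \<open>The inner product of \<open>L\<^sup>2(\<Gamma>)\<close>; distinct interfaces overlap in null sets only.\<close>

definition mortar_inner ::
  "'n::finite problem \<Rightarrow> (nat \<times> nat \<Rightarrow> real^'n \<Rightarrow> real) \<Rightarrow> (nat \<times> nat \<Rightarrow> real^'n \<Rightarrow> real) \<Rightarrow> real" where
  "mortar_inner P \<nu> \<mu> = (\<Sum>e\<in>interfaces P. l2_inner (surface_on (iface P e)) (\<nu> e) (\<mu> e))"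

definition mortar_inner_st ::
  "'n::finite problem \<Rightarrow> (nat \<times> nat \<Rightarrow> real \<Rightarrow> real^'n \<Rightarrow> real) \<Rightarrow>
     (nat \<times> nat \<Rightarrow> real \<Rightarrow> real^'n \<Rightarrow> real) \<Rightarrow> real" where
  "mortar_inner_st P \<nu> \<mu> =
     time_form (final_time P) (mortar_inner P) (\<lambda>t e. \<nu> e t) (\<lambda>t e. \<mu> e t)"

definition mortar_zero ::
  "'n::finite problem \<Rightarrow> (nat \<times> nat \<Rightarrow> real \<Rightarrow> real^'n \<Rightarrow> real) \<Rightarrow> bool" where
  "mortar_zero P \<mu> \<longleftrightarrow>
     (\<forall>e\<in>interfaces P. AE t in lebesgue_on {0<..<final_time P}.
        AE x in surface_on (iface P e). \<mu> e t x = 0)"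

text \<open>The normal trace \<open>v \<cdot> n\<^sub>i\<close> of a piecewise polynomial field: its one-sided limit from the element
  at the boundary point.  Points belonging to several elements form a null set.\<close>

definition normal_trace ::
  "'n::finite problem \<Rightarrow> 'n discretization \<Rightarrow> nat \<Rightarrow> (real^'n \<Rightarrow> real^'n) \<Rightarrow> real^'n \<Rightarrow> real" where
  "normal_trace P D i v x =
     (if \<exists>!E. E \<in> mesh D i \<and> x \<in> E
      then Lim (at x within interior (THE E. E \<in> mesh D i \<and> x \<in> E)) v \<bullet> outward_normal (sub P i) x
      else 0)"

text \<open>The orthogonal projection \<open>\<Q>\<^bsub>h,i\<^esub>\<close> of \<open>L\<^sup>2(\<partial>\<Omega>\<^sub>i)\<close> onto the normal traces.\<close>

definition trace_proj ::
  "'n::finite problem \<Rightarrow> 'n discretization \<Rightarrow> nat \<Rightarrow> (real^'n \<Rightarrow> real) \<Rightarrow> real^'n \<Rightarrow> real" where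
  "trace_proj P D i f =
     (SOME g. g \<in> normal_trace P D i ` vel_space D i \<and>
        (\<forall>v\<in>vel_space D i.
           l2_inner (surface_on (frontier (sub P i))) (\<lambda>x. f x - g x) (normal_trace P D i v) = 0))"

definition flux_pairing ::
  "'n::finite problem \<Rightarrow> 'n discretization \<Rightarrow> nat \<Rightarrow> (real^'n \<Rightarrow> real^'n) \<Rightarrow>
     (nat \<times> nat \<Rightarrow> real^'n \<Rightarrow> real) \<Rightarrow> real" where
  "flux_pairing P D i v \<mu> =
     l2_inner (surface_on (bdry P i)) (normal_trace P D i v) (mortar_on P i \<mu>)"

definition flux_pairing_st ::
  "'n::finite problem \<Rightarrow> 'n discretization \<Rightarrow> nat \<Rightarrow> (real \<Rightarrow> real^'n \<Rightarrow> real^'n) \<Rightarrow>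
     (nat \<times> nat \<Rightarrow> real \<Rightarrow> real^'n \<Rightarrow> real) \<Rightarrow> real" where
  "flux_pairing_st P D i v \<mu> =
     time_form (final_time P) (flux_pairing P D i) v (\<lambda>t e. \<mu> e t)"


section \<open>The Steklov-Poincare operator\<close>

text \<open>The left limit at \<open>t k\<close>, where \<open>\<phi>0\<close> is the prescribed initial value.\<close>

definition left_val :: "(nat \<Rightarrow> real) \<Rightarrow> ('x \<Rightarrow> real) \<Rightarrow> (real \<Rightarrow> 'x \<Rightarrow> real) \<Rightarrow> nat \<Rightarrow> 'x \<Rightarrow> real" where
  "left_val t \<phi>0 \<phi> k x = (if k = 0 then \<phi>0 x else Lim (at_left (t k)) (\<lambda>s. \<phi> s x))"

definition right_val :: "(nat \<Rightarrow> real) \<Rightarrow> (real \<Rightarrow> 'x \<Rightarrow> real) \<Rightarrow> nat \<Rightarrow> 'x \<Rightarrow> real" where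
  "right_val t \<phi> k x = Lim (at_right (t k)) (\<lambda>s. \<phi> s x)"

definition dg_time_form ::
  "'x measure \<Rightarrow> nat \<Rightarrow> (nat \<Rightarrow> real) \<Rightarrow> ('x \<Rightarrow> real) \<Rightarrow>
     (real \<Rightarrow> 'x \<Rightarrow> real) \<Rightarrow> (real \<Rightarrow> 'x \<Rightarrow> real) \<Rightarrow> real" where
  "dg_time_form M N t \<phi>0 \<phi> w =
     (\<Sum>k=1..N. LINT s|lebesgue_on {t (k - 1)<..<t k}.
        l2_inner M (\<lambda>x. deriv (\<lambda>\<tau>. \<phi> \<tau> x) s) (w s)) +
     (\<Sum>k=1..N. l2_inner M
        (\<lambda>x. right_val t \<phi> (k - 1) x - left_val t \<phi>0 \<phi> (k - 1) x) (right_val t w (k - 1)))"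

definition is_subdomain_solution ::
  "'n::finite problem \<Rightarrow> 'n discretization \<Rightarrow> nat \<Rightarrow> (nat \<times> nat \<Rightarrow> real \<Rightarrow> real^'n \<Rightarrow> real) \<Rightarrow>
     (real \<Rightarrow> real^'n \<Rightarrow> real^'n) \<Rightarrow> (real \<Rightarrow> real^'n \<Rightarrow> real) \<Rightarrow> bool" where
  "is_subdomain_solution P D i \<mu> u p \<longleftrightarrow>
     u \<in> vel_st P D i \<and> p \<in> pres_st P D i \<and>
     (\<forall>v\<in>vel_st P D i.
        time_form (final_time P) (a_form P i) u v + time_form (final_time P) (b_form P i) v p
          = - flux_pairing_st P D i v \<mu>) \<and>
     (\<forall>w\<in>pres_st P D i.
        dg_time_form (lebesgue_on (sub P i)) (steps D i) (node D i) (\<lambda>x. 0) p w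
          - time_form (final_time P) (b_form P i) u w = 0)"

definition star_velocity ::
  "'n::finite problem \<Rightarrow> 'n discretization \<Rightarrow> (nat \<times> nat \<Rightarrow> real \<Rightarrow> real^'n \<Rightarrow> real) \<Rightarrow>
     nat \<Rightarrow> real \<Rightarrow> real^'n \<Rightarrow> real^'n" where
  "star_velocity P D \<mu> i = (SOME u. \<exists>p. is_subdomain_solution P D i \<mu> u p)"

definition steklov_poincare ::
  "'n::finite problem \<Rightarrow> 'n discretization \<Rightarrow> (nat \<times> nat \<Rightarrow> real \<Rightarrow> real^'n \<Rightarrow> real) \<Rightarrow>
     nat \<times> nat \<Rightarrow> real \<Rightarrow> real^'n \<Rightarrow> real" where
  "steklov_poincare P D \<nu> =
     (SOME \<sigma>. \<sigma> \<in> mortar_st P D \<and>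
        (\<forall>\<mu>\<in>mortar_st P D.
           mortar_inner_st P \<sigma> \<mu>
             = - (\<Sum>i<num_sub P. flux_pairing_st P D i (star_velocity P D \<nu> i) \<mu>)))"

end

theory Submission
  imports Defs
begin

text \<open>
  Why the operator is positive definite.  Fix a mortar function \<open>\<mu>\<close> and, on each subdomain, the
  solution \<open>(u, p)\<close> with data \<open>\<mu>\<close>.  Testing its two equations with \<open>u\<close> and \<open>p\<close> cancels the coupling
  terms and leaves
  \<open>- \<langle>u \<sqdot> n, \<mu>\<rangle> = (K\<inverse> u, u) + (\<partial>\<^sub>t p, p)\<close>, integrated in time.  The first term is nonnegative
  by ellipticity.  The second one is half the sum of the squared jumps of \<open>p\<close> at the nodes and of the
  squared final value, because the initial value is zero (\<open>scalar_dg_form_energy\<close>).  Summation over the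
  subdomains gives \<open>0 \<le> \<langle>S \<mu>, \<mu>\<rangle>\<close>.

  If \<open>\<langle>S \<mu>, \<mu>\<rangle> = 0\<close>, then \<open>u = 0\<close> on every subdomain.  The second equation then says that the
  discontinuous Galerkin derivative of \<open>p\<close> annihilates all test functions, whence \<open>p = 0\<close>
  (\<open>scalar_dg_form_nondegenerate\<close>), and by the first equation \<open>\<mu>\<close> is orthogonal to the normal traces
  of all space-time velocities (\<open>solution_zero_energy\<close>).  Thanks to the temporal mortar condition,
  \<open>t \<mapsto> \<langle>v \<sqdot> n, \<mu>(t)\<rangle>\<close> is itself an admissible temporal test function for each \<open>v\<close> in the spatial
  velocity space; testing with its product with \<open>v\<close> shows that it vanishes for almost all times
  (\<open>flux_vanishes\<close>).  So the projections of \<open>\<mu>(t)\<close> onto the normal traces vanish from both sides of each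
  interface (\<open>trace_proj_vanishes\<close>), and the spatial mortar condition gives \<open>\<mu>(t) = 0\<close>.

  The solution, the image under \<open>S\<close>, the projection and the weak divergence are chosen objects, so
  they have to be shown to exist or to be unique.  The solution exists because the discrete problem is a
  square linear system, and the energy argument above is also its uniqueness proof
  (\<open>saddle_point_system_solvable\<close>, \<open>dg_saddle_point_solution_exists\<close>).  The image \<open>S \<mu>\<close> is the negative
  \<open>L\<^sup>2\<close> projection of the summed normal traces (\<open>steklov_poincare_image_exists\<close>).  All forms are integrals,
  which are bilinear only where the integrands are integrable.  This rests on three facts: weak
  divergences are unique almost everywhere (\<open>has_weak_div_unique\<close>); \<open>K\<inverse>\<close> is measurable and bounded
  (\<open>perm_inv_L2\<close>); and normal traces are measurable, bounded and live on a set of finite surface measure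
  (\<open>normal_trace_L2\<close>, \<open>surface_frontier_finite\<close>).

  Discrete functions represent almost-everywhere classes.  Throughout, they are expanded in families
  that are orthonormal and complete up to null sets (\<open>l2_basis\<close>), which turns the problem on a subdomain
  into one for vectors of functions of time.
\<close>

section \<open>Linear algebra\<close>

text \<open>Gaussian elimination: a nonzero coefficient of one equation serves as pivot to remove one unknown
  from the others.\<close>

lemma homogeneous_system_nontrivial_solution:
  fixes M :: "'i \<Rightarrow> 'j \<Rightarrow> real"
  assumes "finite I" "finite J" "card I < card J"
  shows "\<exists>c. (\<exists>j\<in>J. c j \<noteq> 0) \<and> (\<forall>i\<in>I. (\<Sum>j\<in>J. M i j * c j) = 0)"
  using assms
proof (induction I arbitrary: M J rule: finite_induct)
  case empty
  then have "J \<noteq> {}" by auto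
  then show ?case by (intro exI[of _ "\<lambda>_. 1"]) auto
next
  case (insert i0 I)
  show ?case
  proof (cases "\<forall>j\<in>J. M i0 j = 0")
    case True
    have "card I < card J" using insert.hyps insert.prems by simp
    from insert.IH[OF \<open>finite J\<close> this, of M] obtain c
      where "\<exists>j\<in>J. c j \<noteq> 0" "\<forall>i\<in>I. (\<Sum>j\<in>J. M i j * c j) = 0" by blast
    with True show ?thesis by (intro exI[of _ c]) auto
  next
    case False
    then obtain j0 where j0: "j0 \<in> J" "M i0 j0 \<noteq> 0" by blast
    define J' where "J' = J - {j0}"
    have J': "finite J'" "card I < card J'" "J = insert j0 J'" "j0 \<notin> J'"
      using insert.prems insert.hyps j0 by (auto simp: J'_def)
    define M' where "M' = (\<lambda>i j. M i j - M i j0 * M i0 j / M i0 j0)"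
    from insert.IH[OF J'(1,2), of M'] obtain c
      where c: "\<exists>j\<in>J'. c j \<noteq> 0" "\<forall>i\<in>I. (\<Sum>j\<in>J'. M' i j * c j) = 0" by blast
    define s where "s = (\<Sum>j\<in>J'. M i0 j * c j)"
    define c' where "c' = c(j0 := - s / M i0 j0)"
    have sum_c': "(\<Sum>j\<in>J. M i j * c' j) = M i j0 * (- s / M i0 j0) + (\<Sum>j\<in>J'. M i j * c j)" for i
    proof -
      have "(\<Sum>j\<in>J'. M i j * c' j) = (\<Sum>j\<in>J'. M i j * c j)"
        using J'(4) by (intro sum.cong) (auto simp: c'_def)
      then show ?thesis using J' by (simp add: c'_def)
    qed
    have "(\<Sum>j\<in>J'. M' i j * c j) = (\<Sum>j\<in>J'. M i j * c j) - M i j0 / M i0 j0 * s" for i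
      by (simp add: M'_def s_def left_diff_distrib sum_subtractf sum_distrib_left mult.assoc)
    then have "\<forall>i\<in>I. (\<Sum>j\<in>J'. M i j * c j) - M i j0 / M i0 j0 * s = 0"
      using c(2) by metis
    then have "\<forall>i\<in>I. (\<Sum>j\<in>J. M i j * c' j) = 0"
      by (simp add: sum_c')
    moreover have "(\<Sum>j\<in>J. M i0 j * c' j) = 0"
      using j0(2) by (simp add: sum_c' s_def)
    moreover have "\<exists>j\<in>J. c' j \<noteq> 0"
      using c(1) J'(3,4) by (auto simp: c'_def)
    ultimately show ?thesis by (intro exI[of _ c']) auto
  qed
qed

text \<open>With the right-hand side as an additional column the system is homogeneous and has more unknowns
  than equations.  By injectivity, the new unknown does not vanish in a nontrivial solution, which can
  therefore be normalised.\<close>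

lemma injective_square_system_solvable:
  fixes M :: "'i \<Rightarrow> 'i \<Rightarrow> real"
  assumes fin: "finite I"
    and inj: "\<And>c. (\<And>i. i \<in> I \<Longrightarrow> (\<Sum>j\<in>I. M i j * c j) = 0) \<Longrightarrow> (\<forall>j\<in>I. c j = 0)"
  shows "\<exists>c. \<forall>i\<in>I. (\<Sum>j\<in>I. M i j * c j) = F i"
proof -
  \<comment> \<open>The column \<open>None\<close> carries the negative right-hand side.\<close>
  define J where "J = insert None (Some ` I)"
  define M' where "M' = (\<lambda>i j. case j of None \<Rightarrow> - F i | Some j \<Rightarrow> M i j)"
  have "card I < card J" "finite J" using fin by (auto simp: J_def card_image)
  from homogeneous_system_nontrivial_solution[OF fin this(2,1), of M'] obtain c
    where c: "\<exists>j\<in>J. c j \<noteq> 0" "\<forall>i\<in>I. (\<Sum>j\<in>J. M' i j * c j) = 0" by blast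
  have s: "(\<Sum>j\<in>J. M' i j * c j) = (\<Sum>j\<in>I. M i j * c (Some j)) - F i * c None" for i
    using fin by (simp add: J_def M'_def sum.reindex image_iff)
  have "c None \<noteq> 0"
  proof
    assume "c None = 0"
    then have "\<forall>j\<in>I. c (Some j) = 0" using c(2) by (intro inj) (simp add: s)
    with c(1) \<open>c None = 0\<close> show False by (auto simp: J_def)
  qed
  moreover have "\<forall>i\<in>I. (\<Sum>j\<in>I. M i j * c (Some j)) = F i * c None"
    using c(2) unfolding s by simp
  ultimately have "\<forall>i\<in>I. (\<Sum>j\<in>I. M i j * (c (Some j) / c None)) = F i"
    by (simp add: sum_divide_distrib[symmetric])
  then show ?thesis by (intro exI[of _ "\<lambda>j. c (Some j) / c None"])
qed

section \<open>Square-integrable functions\<close>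

lemma L2_measurable [measurable_dest]: "f \<in> L2 M \<Longrightarrow> f \<in> borel_measurable M"
  by (simp add: L2_def)

lemma mult_le_sum_squares:
  fixes a b :: real
  assumes "0 \<le> a" "0 \<le> b"
  shows "a * b \<le> a\<^sup>2 + b\<^sup>2"
proof -
  have "2 * (a * b) \<le> a\<^sup>2 + b\<^sup>2" using sum_squares_bound[of a b] by simp
  moreover have "0 \<le> a * b" using assms by simp
  ultimately show ?thesis by linarith
qed

lemma L2_inner_integrable:
  fixes f g :: "'a \<Rightarrow> 'b::euclidean_space"
  assumes f: "f \<in> L2 M" and g: "g \<in> L2 M"
  shows "integrable M (\<lambda>x. f x \<bullet> g x)"
proof (rule Bochner_Integration.integrable_bound)
  show "integrable M (\<lambda>x. (norm (f x))\<^sup>2 + (norm (g x))\<^sup>2)"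
    using f g by (auto simp: L2_def)
  show "(\<lambda>x. f x \<bullet> g x) \<in> borel_measurable M" using f g by measurable
  show "AE x in M. norm (f x \<bullet> g x) \<le> norm ((norm (f x))\<^sup>2 + (norm (g x))\<^sup>2)"
  proof (rule AE_I2)
    fix x
    have "\<bar>f x \<bullet> g x\<bar> \<le> norm (f x) * norm (g x)" by (rule Cauchy_Schwarz_ineq2)
    also have "\<dots> \<le> (norm (f x))\<^sup>2 + (norm (g x))\<^sup>2"
      by (rule mult_le_sum_squares) auto
    finally show "norm (f x \<bullet> g x) \<le> norm ((norm (f x))\<^sup>2 + (norm (g x))\<^sup>2)" by simp
  qed
qed

lemma L2_mult_integrable:
  fixes f g :: "'a \<Rightarrow> real"
  assumes "f \<in> L2 M" "g \<in> L2 M"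
  shows "integrable M (\<lambda>x. f x * g x)"
  using L2_inner_integrable[OF assms] by simp

lemma L2_scaleR:
  fixes f :: "'a \<Rightarrow> 'b::euclidean_space"
  assumes "f \<in> L2 M" shows "(\<lambda>x. c *\<^sub>R f x) \<in> L2 M"
  using assms by (auto simp: L2_def power_mult_distrib)

lemma L2_add:
  fixes f g :: "'a \<Rightarrow> 'b::euclidean_space"
  assumes f: "f \<in> L2 M" and g: "g \<in> L2 M"
  shows "(\<lambda>x. f x + g x) \<in> L2 M"
proof -
  have "integrable M (\<lambda>x. (norm (f x))\<^sup>2 + (norm (g x))\<^sup>2 + 2 * (f x \<bullet> g x))"
    using f g L2_inner_integrable[OF f g] by (auto simp: L2_def)
  also have "(\<lambda>x. (norm (f x))\<^sup>2 + (norm (g x))\<^sup>2 + 2 * (f x \<bullet> g x)) = (\<lambda>x. (norm (f x + g x))\<^sup>2)"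
    by (auto simp: power2_norm_eq_inner algebra_simps inner_commute)
  finally show ?thesis using f g by (auto simp: L2_def)
qed

lemma L2_zero [simp]: "(\<lambda>x. 0) \<in> L2 M"
  by (simp add: L2_def)

lemma L2_sum:
  fixes f :: "'i \<Rightarrow> 'a \<Rightarrow> 'b::euclidean_space"
  assumes "\<And>i. i \<in> I \<Longrightarrow> f i \<in> L2 M"
  shows "(\<lambda>x. \<Sum>i\<in>I. f i x) \<in> L2 M"
  using assms by (induction I rule: infinite_finite_induct) (auto intro: L2_add)

lemma L2_cong_AE:
  assumes "f \<in> L2 M" "g \<in> borel_measurable M" "AE x in M. f x = g x"
  shows "g \<in> L2 M"
proof -
  have "integrable M (\<lambda>x. (norm (f x))\<^sup>2)" using assms(1) by (simp add: L2_def)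
  moreover have "(\<lambda>x. (norm (g x))\<^sup>2) \<in> borel_measurable M" using assms(2) by measurable
  moreover have "AE x in M. (norm (f x))\<^sup>2 = (norm (g x))\<^sup>2"
    using assms(3) by eventually_elim simp
  ultimately have "integrable M (\<lambda>x. (norm (g x))\<^sup>2)"
    by (rule integrable_cong_AE_imp)
  with assms show ?thesis by (auto simp: L2_def)
qed

lemma l2_inner_commute: "l2_inner M f g = l2_inner M g f"
  by (simp add: l2_inner_def inner_commute)

lemma l2_inner_add_left:
  fixes f g :: "'a \<Rightarrow> 'b::euclidean_space"
  assumes "f \<in> L2 M" "g \<in> L2 M" "h \<in> L2 M"
  shows "l2_inner M (\<lambda>x. f x + g x) h = l2_inner M f h + l2_inner M g h"
  using assms by (simp add: l2_inner_def inner_add_left L2_inner_integrable)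

lemma l2_inner_scaleR_left:
  "l2_inner M (\<lambda>x. c *\<^sub>R f x) h = c * l2_inner M f h"
  by (simp add: l2_inner_def)

lemma l2_inner_sum_left:
  fixes f :: "'i \<Rightarrow> 'a \<Rightarrow> 'b::euclidean_space"
  assumes "\<And>i. i \<in> I \<Longrightarrow> f i \<in> L2 M" "h \<in> L2 M"
  shows "l2_inner M (\<lambda>x. \<Sum>i\<in>I. f i x) h = (\<Sum>i\<in>I. l2_inner M (f i) h)"
  using assms by (simp add: l2_inner_def inner_sum_left L2_inner_integrable Bochner_Integration.integral_sum)

lemma l2_inner_lincomb_left:
  fixes f :: "'i \<Rightarrow> 'a \<Rightarrow> 'b::euclidean_space"
  assumes "\<And>i. i \<in> I \<Longrightarrow> f i \<in> L2 M" "h \<in> L2 M"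
  shows "l2_inner M (\<lambda>x. \<Sum>i\<in>I. c i *\<^sub>R f i x) h = (\<Sum>i\<in>I. c i * l2_inner M (f i) h)"
  using assms by (subst l2_inner_sum_left) (auto simp: l2_inner_scaleR_left intro: L2_scaleR)

lemma l2_inner_lincomb_right:
  fixes f :: "'i \<Rightarrow> 'a \<Rightarrow> 'b::euclidean_space"
  assumes "\<And>i. i \<in> I \<Longrightarrow> f i \<in> L2 M" "h \<in> L2 M"
  shows "l2_inner M h (\<lambda>x. \<Sum>i\<in>I. c i *\<^sub>R f i x) = (\<Sum>i\<in>I. c i * l2_inner M h (f i))"
  using l2_inner_lincomb_left[OF assms] by (simp add: l2_inner_commute)

lemma l2_inner_cong_AE:
  assumes "f \<in> borel_measurable M" "f' \<in> borel_measurable M" "g \<in> borel_measurable M" "g' \<in> borel_measurable M"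
    and "AE x in M. f x = f' x" "AE x in M. g x = g' x"
  shows "l2_inner M f g = l2_inner M f' g'"
proof -
  have "AE x in M. f x \<bullet> g x = f' x \<bullet> g' x" using assms(5,6) by eventually_elim simp
  with assms(1-4) show ?thesis
    unfolding l2_inner_def by (intro integral_cong_AE borel_measurable_inner)
qed

lemma l2_inner_self_nonneg: "0 \<le> l2_inner M f f"
  by (simp add: l2_inner_def)

lemma l2_inner_self_eq_0_iff:
  fixes f :: "'a \<Rightarrow> 'b::euclidean_space"
  assumes "f \<in> L2 M"
  shows "l2_inner M f f = 0 \<longleftrightarrow> (AE x in M. f x = 0)"
  unfolding l2_inner_def using L2_inner_integrable[OF assms assms]
  by (subst integral_nonneg_eq_0_iff_AE) auto

lemma fun_span_finite:
  assumes "finite B"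
  shows "fun_span B = {\<lambda>x. \<Sum>b\<in>B. c b *\<^sub>R b x | c. True}"
proof -
  have "\<exists>c'. (\<lambda>x. \<Sum>b\<in>F. c b *\<^sub>R b x) = (\<lambda>x. \<Sum>b\<in>B. c' b *\<^sub>R b x)" if "F \<subseteq> B"
    for F and c :: "('a \<Rightarrow> 'b) \<Rightarrow> real"
  proof (intro exI[of _ "\<lambda>b. if b \<in> F then c b else 0"] ext)
    fix x
    show "(\<Sum>b\<in>F. c b *\<^sub>R b x) = (\<Sum>b\<in>B. (if b \<in> F then c b else 0) *\<^sub>R b x)"
      using that assms by (intro sum.mono_neutral_cong_left) auto
  qed
  note extend = this
  show ?thesis
  proof (intro set_eqI iffI)
    fix f assume "f \<in> fun_span B"
    then obtain F c where "F \<subseteq> B" "f = (\<lambda>x. \<Sum>b\<in>F. c b *\<^sub>R b x)"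
      by (auto simp: fun_span_def)
    then show "f \<in> {\<lambda>x. \<Sum>b\<in>B. c b *\<^sub>R b x | c. True}" using extend[of F c] by simp
  next
    fix f assume "f \<in> {\<lambda>x. \<Sum>b\<in>B. c b *\<^sub>R b x | c. True}"
    then obtain c where "f = (\<lambda>x. \<Sum>b\<in>B. c b *\<^sub>R b x)" by auto
    with assms show "f \<in> fun_span B" unfolding fun_span_def
      by (intro CollectI exI[of _ B] exI[of _ c]) auto
  qed
qed

lemma fun_span_superset: "B \<subseteq> fun_span B"
proof
  fix b assume "b \<in> B"
  then have "b = (\<lambda>x. \<Sum>b\<in>{b}. (\<lambda>_. 1) b *\<^sub>R b x) \<and> finite {b} \<and> {b} \<subseteq> B" by simp
  then show "b \<in> fun_span B" using \<open>b \<in> B\<close> unfolding fun_span_def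
    by (intro CollectI exI[of _ "{b}"] exI[of _ "\<lambda>_. 1"]) auto
qed

lemma finite_dim_space_add:
  assumes "finite_dim_space V" "f \<in> V" "g \<in> V"
  shows "(\<lambda>x. f x + g x) \<in> V"
proof -
  obtain B where B: "finite B" "V = fun_span B" using assms by (auto simp: finite_dim_space_def)
  then obtain c d where "f = (\<lambda>x. \<Sum>b\<in>B. c b *\<^sub>R b x)" "g = (\<lambda>x. \<Sum>b\<in>B. d b *\<^sub>R b x)"
    using assms by (auto simp: fun_span_finite)
  then have "(\<lambda>x. f x + g x) = (\<lambda>x. \<Sum>b\<in>B. (c b + d b) *\<^sub>R b x)"
    by (simp add: scaleR_add_left sum.distrib)
  then show ?thesis using B by (auto simp: fun_span_finite)
qed

lemma finite_dim_space_scaleR: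
  assumes "finite_dim_space V" "f \<in> V"
  shows "(\<lambda>x. a *\<^sub>R f x) \<in> V"
proof -
  obtain B where B: "finite B" "V = fun_span B" using assms by (auto simp: finite_dim_space_def)
  then obtain c where "f = (\<lambda>x. \<Sum>b\<in>B. c b *\<^sub>R b x)"
    using assms by (auto simp: fun_span_finite)
  then have "(\<lambda>x. a *\<^sub>R f x) = (\<lambda>x. \<Sum>b\<in>B. (a * c b) *\<^sub>R b x)"
    by (simp add: scaleR_sum_right)
  then show ?thesis using B by (auto simp: fun_span_finite)
qed

lemma finite_dim_space_zero:
  assumes "finite_dim_space V"
  shows "(\<lambda>x. 0) \<in> V"
proof -
  obtain B where B: "finite B" "V = fun_span B" using assms by (auto simp: finite_dim_space_def)
  have "(\<lambda>x. 0) = (\<lambda>x. \<Sum>b\<in>B. 0 *\<^sub>R b x)" by simp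
  then show ?thesis unfolding B(2) fun_span_finite[OF B(1)] by (auto intro: exI[of _ "\<lambda>_. 0"])
qed

lemma finite_dim_space_lincomb:
  assumes "finite_dim_space V" "\<And>i. i \<in> I \<Longrightarrow> f i \<in> V"
  shows "(\<lambda>x. \<Sum>i\<in>I. c i *\<^sub>R f i x) \<in> V"
  using assms(2)
proof (induction I rule: infinite_finite_induct)
  case (insert i I)
  then show ?case
    using finite_dim_space_add[OF assms(1) finite_dim_space_scaleR[OF assms(1), of "f i" "c i"]]
    by simp
qed (auto simp: finite_dim_space_zero[OF assms(1)])

text \<open>An orthonormal basis of the almost-everywhere classes of \<open>V\<close>.  A basis of \<open>V\<close> itself would be of no
  use: its elements may be dependent as classes, and the piecewise polynomials in time with free
  values at the nodes have infinite dimension as functions.\<close>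

definition l2_basis ::
  "'a measure \<Rightarrow> ('a \<Rightarrow> 'b::euclidean_space) set \<Rightarrow> nat \<Rightarrow> (nat \<Rightarrow> 'a \<Rightarrow> 'b) \<Rightarrow> bool" where
  "l2_basis M V n e \<longleftrightarrow>
     (\<forall>j<n. e j \<in> V) \<and>
     (\<forall>i<n. \<forall>j<n. l2_inner M (e i) (e j) = (if i = j then 1 else 0)) \<and>
     (\<forall>f\<in>V. AE x in M. f x = (\<Sum>j<n. l2_inner M f (e j) *\<^sub>R e j x))"

text \<open>Gram-Schmidt orthogonalisation.  A generator whose residual \<open>r\<close> has norm zero lies in the previous
  span up to a null set and is dropped.\<close>

lemma l2_basis_fun_span_exists:
  fixes B :: "('a \<Rightarrow> 'b::euclidean_space) set"
  assumes "finite B" "B \<subseteq> L2 M"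
  shows "\<exists>n e. l2_basis M (fun_span B) n e"
  using assms
proof (induction B rule: finite_induct)
  case empty
  have "AE x in M. f x = 0" if "f \<in> fun_span {}" for f :: "'a \<Rightarrow> 'b"
    using that by (auto simp: fun_span_def)
  then have "l2_basis M (fun_span {}) 0 (\<lambda>_ _. (0::'b))"
    by (simp add: l2_basis_def)
  then show ?case by blast
next
  case (insert b B)
  obtain n e where e: "l2_basis M (fun_span B) n e" using insert.IH insert.prems by blast
  have sub: "fun_span B \<subseteq> L2 M"
    unfolding fun_span_finite[OF insert.hyps(1)] using insert.prems by (auto intro!: L2_sum L2_scaleR)
  have eL2: "e j \<in> L2 M" if "j < n" for j using e that sub by (auto simp: l2_basis_def)
  have bL2: "b \<in> L2 M" using insert.hyps insert.prems by simp
  have ins: "f \<in> fun_span (insert b B) \<longleftrightarrow> (\<exists>g\<in>fun_span B. \<exists>c. f = (\<lambda>x. g x + c *\<^sub>R b x))" for f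
  proof
    assume "f \<in> fun_span (insert b B)"
    then obtain c where "f = (\<lambda>x. \<Sum>b\<in>insert b B. c b *\<^sub>R b x)"
      using insert.hyps insert.prems by (auto simp: fun_span_finite)
    then have "f = (\<lambda>x. (\<Sum>b\<in>B. c b *\<^sub>R b x) + c b *\<^sub>R b x)"
      using insert.hyps insert.prems by (simp add: add.commute)
    moreover have "(\<lambda>x. \<Sum>b\<in>B. c b *\<^sub>R b x) \<in> fun_span B" using insert.hyps insert.prems by (auto simp: fun_span_finite)
    ultimately show "\<exists>g\<in>fun_span B. \<exists>c. f = (\<lambda>x. g x + c *\<^sub>R b x)"
      by (intro bexI[of _ "\<lambda>x. \<Sum>b\<in>B. c b *\<^sub>R b x"] exI[of _ "c b"])
  next
    assume "\<exists>g\<in>fun_span B. \<exists>c. f = (\<lambda>x. g x + c *\<^sub>R b x)"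
    then obtain c d where "f = (\<lambda>x. (\<Sum>b\<in>B. d b *\<^sub>R b x) + c *\<^sub>R b x)"
      using insert.hyps insert.prems by (auto simp: fun_span_finite)
    moreover have "(\<Sum>b\<in>B. d b *\<^sub>R b x) = (\<Sum>b'\<in>B. (d(b := c)) b' *\<^sub>R b' x)" for x
      using insert.hyps insert.prems by (intro sum.cong) auto
    ultimately have "f = (\<lambda>x. \<Sum>b'\<in>insert b B. (d(b := c)) b' *\<^sub>R b' x)"
      using insert.hyps insert.prems by (auto simp: add.commute)
    moreover have fin_ins: "finite (insert b B)" using insert.hyps by simp
    ultimately show "f \<in> fun_span (insert b B)" unfolding fun_span_finite[OF fin_ins]
      by (intro CollectI exI[of _ "d(b := c)"] conjI TrueI)
  qed
  define r where "r = (\<lambda>x. b x - (\<Sum>j<n. l2_inner M b (e j) *\<^sub>R e j x))"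
  define \<beta> where "\<beta> j = - l2_inner M b (e j)" for j
  have r_alt: "r = (\<lambda>x. (\<Sum>j<n. \<beta> j *\<^sub>R e j x) + 1 *\<^sub>R b x)"
    by (simp add: r_def \<beta>_def sum_negf fun_eq_iff)
  have fd: "finite_dim_space (fun_span B)" using insert.hyps insert.prems by (auto simp: finite_dim_space_def)
  have combB: "(\<lambda>x. \<Sum>j<n. c j *\<^sub>R e j x) \<in> fun_span B" for c
    using e by (intro finite_dim_space_lincomb[OF fd]) (auto simp: l2_basis_def)
  have r_in: "r \<in> fun_span (insert b B)"
    unfolding ins r_alt by (intro bexI[OF _ combB[of \<beta>]] exI[of _ 1] refl)
  have rL2: "r \<in> L2 M" unfolding r_alt using eL2 bL2 by (intro L2_add L2_sum L2_scaleR) auto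
  have r_orth: "l2_inner M r (e j) = 0" if "j < n" for j
  proof -
    have "l2_inner M r (e j) = (\<Sum>i<n. \<beta> i * l2_inner M (e i) (e j)) + l2_inner M b (e j)"
    proof -
      have "l2_inner M (\<lambda>x. \<Sum>i<n. \<beta> i *\<^sub>R e i x) (e j) = (\<Sum>i<n. \<beta> i * l2_inner M (e i) (e j))"
        using eL2 that by (intro l2_inner_lincomb_left) auto
      moreover have "(\<lambda>x. \<Sum>i<n. \<beta> i *\<^sub>R e i x) \<in> L2 M"
        using eL2 by (intro L2_sum L2_scaleR) auto
      ultimately show ?thesis
        unfolding r_alt using bL2 eL2[OF that] l2_inner_add_left[of _ M "\<lambda>x. 1 *\<^sub>R b x" "e j"]
        by simp
    qed
    moreover have "(\<Sum>i<n. \<beta> i * l2_inner M (e i) (e j)) = (\<Sum>i<n. if i = j then \<beta> j else 0)"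
      using e that by (intro sum.cong) (auto simp: l2_basis_def)
    ultimately show ?thesis using that by (simp add: \<beta>_def)
  qed
  have expB: "AE x in M. g x = (\<Sum>j<n. l2_inner M g (e j) *\<^sub>R e j x)" if "g \<in> fun_span B" for g
    using e that by (auto simp: l2_basis_def)
  have lin: "l2_inner M (\<lambda>x. g x + c *\<^sub>R b x) h = l2_inner M g h + c * l2_inner M b h"
    if "g \<in> fun_span B" "h \<in> L2 M" for g h c
    using that sub bL2 by (subst l2_inner_add_left) (auto simp: l2_inner_scaleR_left intro: L2_scaleR)
  define \<rho> where "\<rho> = l2_inner M r r"
  show ?case
  proof (cases "\<rho> = 0")
    case True
    then have r0: "AE x in M. r x = 0" using rL2 by (simp add: \<rho>_def l2_inner_self_eq_0_iff)
    have "l2_basis M (fun_span (insert b B)) n e"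
      unfolding l2_basis_def
    proof (intro conjI allI impI ballI)
      fix f assume "f \<in> fun_span (insert b B)"
      then obtain g c where g: "g \<in> fun_span B" "f = (\<lambda>x. g x + c *\<^sub>R b x)" unfolding ins by blast
      show "AE x in M. f x = (\<Sum>j<n. l2_inner M f (e j) *\<^sub>R e j x)"
        using expB[OF g(1)] r0
      proof eventually_elim
        case (elim x)
        have "(\<Sum>j<n. l2_inner M f (e j) *\<^sub>R e j x)
           = (\<Sum>j<n. l2_inner M g (e j) *\<^sub>R e j x) + c *\<^sub>R (\<Sum>j<n. l2_inner M b (e j) *\<^sub>R e j x)"
          using eL2 g(1) unfolding g(2)
          by (simp add: lin scaleR_add_left sum.distrib scaleR_sum_right)
        then show ?case using elim by (simp add: r_def g(2))
      qed
    next
      fix j assume "j < n"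
      then have "e j \<in> fun_span B" using e by (auto simp: l2_basis_def)
      moreover have "e j = (\<lambda>x. e j x + 0 *\<^sub>R b x)" by simp
      ultimately show "e j \<in> fun_span (insert b B)" unfolding ins by blast
    qed (use e in \<open>auto simp: l2_basis_def\<close>)
    then show ?thesis by blast
  next
    case False
    then have \<rho>: "\<rho> > 0" using l2_inner_self_nonneg[of M r] by (simp add: \<rho>_def)
    define e' where "e' = e(n := (\<lambda>x. (1 / sqrt \<rho>) *\<^sub>R r x))"
    have fd': "finite_dim_space (fun_span (insert b B))"
      using insert.hyps insert.prems by (auto simp: finite_dim_space_def)
    have e'n: "e' n = (\<lambda>x. (1 / sqrt \<rho>) *\<^sub>R r x)" by (simp add: e'_def)
    have e'j: "e' j = e j" if "j < n" for j using that by (simp add: e'_def)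
    have inner_n: "l2_inner M (e' n) h = l2_inner M r h / sqrt \<rho>" "l2_inner M h (e' n) = l2_inner M h r / sqrt \<rho>" for h
      unfolding e'n by (simp_all add: l2_inner_scaleR_left l2_inner_commute[of M h])
    have "l2_basis M (fun_span (insert b B)) (Suc n) e'"
      unfolding l2_basis_def
    proof (intro conjI allI impI ballI)
      fix j assume "j < Suc n"
      show "e' j \<in> fun_span (insert b B)"
      proof (cases "j = n")
        case True
        then show ?thesis using finite_dim_space_scaleR[OF fd' r_in] by (simp add: e'n)
      next
        case False
        then have "e' j \<in> fun_span B" using e \<open>j < Suc n\<close> by (auto simp: l2_basis_def e'j)
        moreover have "e' j = (\<lambda>x. e' j x + 0 *\<^sub>R b x)" by simp
        ultimately show ?thesis unfolding ins by blast
      qed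
    next
      fix i j assume "i < Suc n" "j < Suc n"
      have orth_n: "l2_inner M (e' n) (e' k) = 0" "l2_inner M (e' k) (e' n) = 0" if "k < n" for k
        using r_orth[OF that] inner_n[of "e k"] by (simp_all add: e'j[OF that] l2_inner_commute[of M "e k" r])
      have norm_n: "l2_inner M (e' n) (e' n) = 1"
        using \<rho> inner_n(1)[of "e' n"] inner_n(2)[of r] by (simp add: \<rho>_def[symmetric])
      show "l2_inner M (e' i) (e' j) = (if i = j then 1 else 0)"
      proof (cases "i = n \<or> j = n")
        case True
        then show ?thesis using orth_n norm_n \<open>i < Suc n\<close> \<open>j < Suc n\<close> by (auto simp: less_Suc_eq)
      next
        case False
        then show ?thesis using e e'j \<open>i < Suc n\<close> \<open>j < Suc n\<close> by (simp add: l2_basis_def less_Suc_eq)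
      qed
    next
      fix f assume "f \<in> fun_span (insert b B)"
      then obtain g c where g: "g \<in> fun_span B" "f = (\<lambda>x. g x + c *\<^sub>R b x)" unfolding ins by blast
      have gr: "l2_inner M g r = 0"
      proof -
        have "l2_inner M g r = l2_inner M (\<lambda>x. \<Sum>j<n. l2_inner M g (e j) *\<^sub>R e j x) r"
          using expB[OF g(1)] g(1) rL2 sub combB[of "\<lambda>j. l2_inner M g (e j)"]
          by (intro l2_inner_cong_AE) (auto intro: L2_measurable)
        also have "\<dots> = (\<Sum>j<n. l2_inner M g (e j) * l2_inner M (e j) r)"
          using eL2 rL2 by (intro l2_inner_lincomb_left) auto
        also have "\<dots> = 0" using r_orth by (simp add: l2_inner_commute[of M _ r])
        finally show ?thesis .
      qed
      have br: "l2_inner M b r = \<rho>"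
      proof -
        have "b = (\<lambda>x. (\<Sum>j<n. l2_inner M b (e j) *\<^sub>R e j x) + r x)" by (simp add: r_def)
        then have "l2_inner M b r = l2_inner M (\<lambda>x. (\<Sum>j<n. l2_inner M b (e j) *\<^sub>R e j x) + r x) r"
          by (rule arg_cong)
        also have "\<dots> = (\<Sum>j<n. l2_inner M b (e j) * l2_inner M (e j) r) + \<rho>"
        proof -
          have "l2_inner M (\<lambda>x. \<Sum>i<n. l2_inner M b (e i) *\<^sub>R e i x) r = (\<Sum>i<n. l2_inner M b (e i) * l2_inner M (e i) r)"
            using eL2 rL2 by (intro l2_inner_lincomb_left) auto
          moreover have "(\<lambda>x. \<Sum>i<n. l2_inner M b (e i) *\<^sub>R e i x) \<in> L2 M"
            using eL2 by (intro L2_sum L2_scaleR) auto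
          ultimately show ?thesis using rL2 by (simp add: l2_inner_add_left \<rho>_def)
        qed
        finally show ?thesis using r_orth by (simp add: l2_inner_commute[of M _ r])
      qed
      have fn: "l2_inner M f (e' n) *\<^sub>R e' n x = c *\<^sub>R r x" for x
        unfolding inner_n g(2) using \<rho> by (simp add: lin[OF g(1) rL2] gr br e'n)
      show "AE x in M. f x = (\<Sum>j<Suc n. l2_inner M f (e' j) *\<^sub>R e' j x)"
        using expB[OF g(1)]
      proof eventually_elim
        case (elim x)
        have "(\<Sum>j<n. l2_inner M f (e j) *\<^sub>R e j x)
           = (\<Sum>j<n. l2_inner M g (e j) *\<^sub>R e j x) + c *\<^sub>R (\<Sum>j<n. l2_inner M b (e j) *\<^sub>R e j x)"
          using eL2 g(1) unfolding g(2)
          by (simp add: lin scaleR_add_left sum.distrib scaleR_sum_right)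
        moreover have "(\<Sum>j<Suc n. l2_inner M f (e' j) *\<^sub>R e' j x)
           = (\<Sum>j<n. l2_inner M f (e j) *\<^sub>R e j x) + c *\<^sub>R r x"
          by (simp add: fn e'j)
        moreover have "f x = g x + c *\<^sub>R b x" by (simp add: g(2))
        ultimately show ?case using elim by (simp add: r_def scaleR_diff_right)
      qed
    qed
    then show ?thesis by blast
  qed
qed

section \<open>Uniqueness of the weak divergence\<close>

lemma test_function_continuous:
  assumes "test_function S \<phi> G"
  shows "continuous_on UNIV \<phi>" "continuous_on UNIV G"
proof -
  have "(\<phi> has_derivative (\<lambda>h. G x \<bullet> h)) (at x)" for x using assms by (auto simp: test_function_def)
  then show "continuous_on UNIV \<phi>"
    by (meson continuous_at_imp_continuous_on has_derivative_continuous)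
  show "continuous_on UNIV G" using assms by (auto simp: test_function_def)
qed

text \<open>The gradient vanishes as well because the function is zero in a neighbourhood.\<close>

lemma test_function_outside_support:
  assumes "test_function S \<phi> G" "x \<notin> closure {x. \<phi> x \<noteq> 0}"
  shows "\<phi> x = 0" "G x = 0"
proof -
  show "\<phi> x = 0" using assms(2) closure_subset[of "{x. \<phi> x \<noteq> 0}"] by auto
  have U: "open (- closure {x. \<phi> x \<noteq> 0})" "x \<in> - closure {x. \<phi> x \<noteq> 0}" using assms by auto
  have z: "\<And>y. y \<in> - closure {x. \<phi> x \<noteq> 0} \<Longrightarrow> \<phi> y = 0"
    using closure_subset[of "{x. \<phi> x \<noteq> 0}"] by auto
  have "((\<lambda>y. 0) has_derivative (\<lambda>h. 0)) (at x)" by simp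
  then have "(\<phi> has_derivative (\<lambda>h. 0)) (at x)"
    by (rule has_derivative_transform_within_open[OF _ U]) (rule z[symmetric])
  moreover have "(\<phi> has_derivative (\<lambda>h. G x \<bullet> h)) (at x)" using assms by (auto simp: test_function_def)
  ultimately have "(\<lambda>h. 0) = (\<lambda>h. G x \<bullet> h)" by (rule has_derivative_unique)
  then have "G x \<bullet> G x = 0" by metis
  then show "G x = 0" by simp
qed

lemma continuous_compact_support_L2:
  fixes f :: "'a::euclidean_space \<Rightarrow> 'b::euclidean_space"
  assumes f: "continuous_on UNIV f" and K: "compact K" "\<And>x. x \<notin> K \<Longrightarrow> f x = 0"
    and S: "S \<in> sets lebesgue"
  shows "f \<in> L2 (lebesgue_on S)"
proof -
  have fb: "f \<in> borel_measurable borel" using f by (rule borel_measurable_continuous_onI)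
  have "integrable lborel (\<lambda>x. indicator K x *\<^sub>R ((norm (f x))\<^sup>2))"
    using f K(1) by (intro borel_integrable_compact continuous_intros) (auto intro: continuous_on_subset)
  also have "(\<lambda>x. indicator K x *\<^sub>R ((norm (f x))\<^sup>2)) = (\<lambda>x. (norm (f x))\<^sup>2)"
    using K(2) by (auto simp: indicator_def fun_eq_iff)
  finally have "integrable lebesgue (\<lambda>x. (norm (f x))\<^sup>2)"
    by (rule integrable_completion[THEN iffD2, rotated]) (use fb in measurable)
  then have "integrable lebesgue (\<lambda>x. indicat_real S x *\<^sub>R (norm (f x))\<^sup>2)"
    using S by (rule integrable_mult_indicator[rotated])
  then have "integrable (lebesgue_on S) (\<lambda>x. (norm (f x))\<^sup>2)"
    using S by (simp add: integrable_restrict_space)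
  moreover have "f \<in> borel_measurable (lebesgue_on S)"
    using fb by (intro measurable_restrict_space1 measurable_completion) simp
  ultimately show ?thesis by (simp add: L2_def)
qed

lemma test_function_L2:
  assumes "test_function S \<phi> G" "S \<in> sets lebesgue"
  shows "\<phi> \<in> L2 (lebesgue_on S)" "G \<in> L2 (lebesgue_on S)"
proof -
  have K: "compact (closure {x. \<phi> x \<noteq> 0})" using assms by (auto simp: test_function_def)
  show "\<phi> \<in> L2 (lebesgue_on S)"
    by (rule continuous_compact_support_L2[OF test_function_continuous(1)[OF assms(1)] K
          test_function_outside_support(1)[OF assms(1)] assms(2)])
  show "G \<in> L2 (lebesgue_on S)"
    by (rule continuous_compact_support_L2[OF test_function_continuous(2)[OF assms(1)] K
          test_function_outside_support(2)[OF assms(1)] assms(2)])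
qed

lemma indicator_L2:
  assumes A: "A \<in> sets lebesgue" "bounded A" and S: "S \<in> sets lebesgue"
  shows "indicat_real A \<in> L2 (lebesgue_on S)"
proof -
  obtain a b where ab: "A \<subseteq> cbox a b" using bounded_subset_cbox_symmetric[OF A(2)] by blast
  have "emeasure lebesgue A \<le> emeasure lebesgue (cbox a b)"
    using ab by (intro emeasure_mono) auto
  also have "\<dots> < \<infinity>" using emeasure_compact_finite[OF compact_cbox] by simp
  finally have "integrable lebesgue (indicat_real A)"
    by (intro integrable_real_indicator A)
  then have "integrable lebesgue (\<lambda>x. indicat_real S x *\<^sub>R indicat_real A x)"
    using S by (rule integrable_mult_indicator[rotated])
  then have "integrable (lebesgue_on S) (indicat_real A)"
    using S by (simp add: integrable_restrict_space)
  moreover have "(\<lambda>x. (norm (indicat_real A x))\<^sup>2) = indicat_real A"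
    by (auto simp: indicator_def)
  ultimately show ?thesis by (auto simp: L2_def)
qed

text \<open>The profile of the bump functions: it is continuously differentiable and positive exactly for positive
  arguments.\<close>

lemma max_0_square_has_derivative:
  fixes s :: real
  shows "((\<lambda>s. (max 0 s)\<^sup>2) has_real_derivative 2 * max 0 s) (at s)"
proof -
  consider "s > 0" | "s < 0" | "s = 0" by linarith
  then show ?thesis
  proof cases
    case 1
    have "((\<lambda>s. s\<^sup>2) has_real_derivative 2 * s) (at s)"
      by (auto intro!: derivative_eq_intros)
    then have "((\<lambda>s. (max 0 s)\<^sup>2) has_real_derivative 2 * s) (at s)"
      by (rule has_field_derivative_transform_within_open[where S = "{0<..}"]) (use 1 in auto)
    with 1 show ?thesis by (simp add: max_def)
  next
    case 2
    have "((\<lambda>s. 0) has_real_derivative 0) (at s)" by simp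
    then have "((\<lambda>s. (max 0 s)\<^sup>2) has_real_derivative 0) (at s)"
      by (rule has_field_derivative_transform_within_open[where S = "{..<0}"]) (use 2 in auto)
    with 2 show ?thesis by (simp add: max_def)
  next
    case 3
    have "((\<lambda>h::real. (max 0 h)\<^sup>2 / h) \<longlongrightarrow> 0) (at 0)"
    proof (rule Lim_null_comparison)
      show "((\<lambda>h::real. \<bar>h\<bar>) \<longlongrightarrow> 0) (at 0)" by (intro tendsto_eq_intros) auto
      show "\<forall>\<^sub>F h in at (0::real). norm ((max 0 h)\<^sup>2 / h) \<le> \<bar>h\<bar>"
        by (auto simp: eventually_at_filter max_def power2_eq_square)
    qed
    then show ?thesis using 3 by (simp add: DERIV_def)
  qed
qed

text \<open>These functions need not have compact support.  Their positivity sets include all balls and are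
  closed under intersection, by taking products, so that they form an intersection-stable generator of
  the Borel sets.\<close>

definition C1_nonneg :: "('a::euclidean_space \<Rightarrow> real) \<Rightarrow> ('a \<Rightarrow> 'a) \<Rightarrow> bool" where
  "C1_nonneg \<phi> G \<longleftrightarrow>
     (\<forall>x. (\<phi> has_derivative (\<lambda>h. G x \<bullet> h)) (at x)) \<and> continuous_on UNIV G \<and> (\<forall>x. 0 \<le> \<phi> x)"

lemma C1_nonneg_continuous: "C1_nonneg \<phi> G \<Longrightarrow> continuous_on UNIV \<phi>"
  unfolding C1_nonneg_def by (meson continuous_at_imp_continuous_on has_derivative_continuous)

lemma C1_nonneg_ball:
  fixes c :: "'a::euclidean_space"
  assumes "0 < r"
  shows "\<exists>\<phi> G. C1_nonneg \<phi> G \<and> {x. \<phi> x \<noteq> 0} = ball c r"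
proof (intro exI conjI)
  let ?q = "\<lambda>x. r\<^sup>2 - (x - c) \<bullet> (x - c)"
  let ?\<phi> = "\<lambda>x. (max 0 (?q x))\<^sup>2"
  let ?G = "\<lambda>x. (- 4 * max 0 (?q x)) *\<^sub>R (x - c)"
  show "C1_nonneg ?\<phi> ?G"
    unfolding C1_nonneg_def
  proof (intro conjI allI)
    fix x
    have q: "(?q has_derivative (\<lambda>h. - 2 * ((x - c) \<bullet> h))) (at x)"
      by (auto intro!: derivative_eq_intros simp: inner_commute)
    have "((\<lambda>s. (max 0 s)\<^sup>2) has_derivative (\<lambda>h. 2 * max 0 (?q x) * h)) (at (?q x))"
      using max_0_square_has_derivative[of "?q x"] by (simp add: has_field_derivative_def)
    from has_derivative_compose[OF q this]
    show "(?\<phi> has_derivative (\<lambda>h. ?G x \<bullet> h)) (at x)"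
      by (simp add: mult_ac)
  qed (auto intro!: continuous_intros)
  show "{x. ?\<phi> x \<noteq> 0} = ball c r"
  proof -
    have "?\<phi> x \<noteq> 0 \<longleftrightarrow> norm (x - c) < r" for x
    proof -
      have "?\<phi> x \<noteq> 0 \<longleftrightarrow> (norm (x - c))\<^sup>2 < r\<^sup>2"
        by (auto simp: power2_norm_eq_inner max_def)
      also have "\<dots> \<longleftrightarrow> norm (x - c) < r" using assms
        by (meson norm_ge_zero less_imp_le power2_less_imp_less power_strict_mono zero_less_numeral)
      finally show ?thesis .
    qed
    then show ?thesis by (simp only: ball_def dist_norm norm_minus_commute[of c])
  qed
qed

lemma C1_nonneg_mult:
  assumes "C1_nonneg \<phi> G" "C1_nonneg \<phi>' G'"
  shows "C1_nonneg (\<lambda>x. \<phi> x * \<phi>' x) (\<lambda>x. \<phi> x *\<^sub>R G' x + \<phi>' x *\<^sub>R G x)"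
  unfolding C1_nonneg_def
proof (intro conjI allI)
  fix x
  have "(\<phi> has_derivative (\<lambda>h. G x \<bullet> h)) (at x)" "(\<phi>' has_derivative (\<lambda>h. G' x \<bullet> h)) (at x)"
    using assms by (auto simp: C1_nonneg_def)
  from has_derivative_mult[OF this]
  show "((\<lambda>x. \<phi> x * \<phi>' x) has_derivative (\<lambda>h. (\<phi> x *\<^sub>R G' x + \<phi>' x *\<^sub>R G x) \<bullet> h)) (at x)"
    by (simp add: inner_add_left mult_ac)
qed (use assms in \<open>auto intro!: continuous_intros C1_nonneg_continuous simp: C1_nonneg_def\<close>)

text \<open>The functions \<open>1 - exp (- n \<phi>)\<close> are again admissible and increase to the indicator of the
  positivity set of \<open>\<phi>\<close>, which therefore can be used in place of test functions.\<close>

lemma C1_nonneg_test_set: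
  assumes f: "f \<in> L2 (lebesgue_on S)" and S: "S \<in> sets lebesgue"
    and zero: "\<And>\<phi> G. test_function S \<phi> G \<Longrightarrow> l2_inner (lebesgue_on S) f \<phi> = 0"
    and \<phi>: "C1_nonneg \<phi> G" and K: "compact K" "{x. \<phi> x \<noteq> 0} \<subseteq> K" "K \<subseteq> S"
  shows "(LINT x|lebesgue_on S. f x * indicator {x. \<phi> x \<noteq> 0} x) = 0"
proof -
  have cl: "closure {x. \<phi> x \<noteq> 0} \<subseteq> K" using K by (meson closure_minimal compact_imp_closed)
  define \<psi> where "\<psi> n x = 1 - exp (- (real n * \<phi> x))" for n x
  have supp: "\<psi> n x = 0" if "\<phi> x = 0" for n x using that by (simp add: \<psi>_def)
  have supp': "closure {x. \<psi> n x \<noteq> 0} \<subseteq> closure {x. \<phi> x \<noteq> 0}" for n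
    by (rule closure_mono) (auto simp: supp)
  have "test_function S (\<psi> n) (\<lambda>x. (real n * exp (- (real n * \<phi> x))) *\<^sub>R G x)" for n
    unfolding test_function_def
  proof (intro conjI allI)
    fix x
    have "(\<phi> has_derivative (\<lambda>h. G x \<bullet> h)) (at x)" using \<phi> by (auto simp: C1_nonneg_def)
    then show "(\<psi> n has_derivative (\<lambda>h. ((real n * exp (- (real n * \<phi> x))) *\<^sub>R G x) \<bullet> h)) (at x)"
      unfolding \<psi>_def by (auto intro!: derivative_eq_intros)
  next
    show "continuous_on UNIV (\<lambda>x. (real n * exp (- (real n * \<phi> x))) *\<^sub>R G x)"
      using \<phi> C1_nonneg_continuous[OF \<phi>] by (intro continuous_intros) (auto simp: C1_nonneg_def)
    have sub: "closure {x. \<psi> n x \<noteq> 0} \<subseteq> K" using supp' cl by blast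
    then show "compact (closure {x. \<psi> n x \<noteq> 0})"
      using K(1) compact_Int_closed[OF K(1) closed_closure, of "{x. \<psi> n x \<noteq> 0}"]
      by (simp add: Int_absorb1)
    show "closure {x. \<psi> n x \<noteq> 0} \<subseteq> S" using sub K(3) by blast
  qed
  from zero[OF this] have z: "(LINT x|lebesgue_on S. f x * \<psi> n x) = 0" for n
    by (simp add: l2_inner_def)
  have Kb: "K \<in> sets lebesgue" using K(1) by (simp add: borel_compact)
  have \<phi>m: "\<phi> \<in> borel_measurable (lebesgue_on S)"
    using C1_nonneg_continuous[OF \<phi>] by (intro measurable_restrict_space1 measurable_completion)
      (simp add: borel_measurable_continuous_onI)
  have fm: "f \<in> borel_measurable (lebesgue_on S)" using f by (rule L2_measurable)
  have "indicat_real K \<in> L2 (lebesgue_on S)"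
    using Kb compact_imp_bounded[OF K(1)] S by (rule indicator_L2)
  from L2_mult_integrable[OF f this] have intK: "integrable (lebesgue_on S) (\<lambda>x. norm (f x * indicator K x))"
    by simp
  have setm: "{x. \<phi> x \<noteq> 0} \<inter> S \<in> sets (lebesgue_on S)"
  proof -
    have "open {x. \<phi> x \<noteq> 0}"
      using open_Collect_neq[OF C1_nonneg_continuous[OF \<phi>], of "\<lambda>_. 0"] by simp
    then have "{x. \<phi> x \<noteq> 0} \<in> sets lebesgue" by simp
    then show ?thesis using S by (simp add: sets_restrict_space_iff)
  qed
  have "(\<lambda>n. LINT x|lebesgue_on S. f x * \<psi> n x) \<longlonglongrightarrow> (LINT x|lebesgue_on S. f x * indicator {x. \<phi> x \<noteq> 0} x)"
  proof (rule integral_dominated_convergence[OF _ _ intK])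
    show "(\<lambda>x. f x * indicator {x. \<phi> x \<noteq> 0} x) \<in> borel_measurable (lebesgue_on S)"
    proof -
      have "(\<lambda>x. indicat_real {x. \<phi> x \<noteq> 0} x) \<in> borel_measurable (lebesgue_on S)"
        using setm by (subst borel_measurable_indicator_iff) (simp add: Int_commute)
      with fm show ?thesis by (rule borel_measurable_times)
    qed
    show "(\<lambda>x. f x * \<psi> n x) \<in> borel_measurable (lebesgue_on S)" for n
      unfolding \<psi>_def using fm \<phi>m by measurable
    show "AE x in lebesgue_on S. (\<lambda>n. f x * \<psi> n x) \<longlonglongrightarrow> f x * indicator {x. \<phi> x \<noteq> 0} x"
    proof (rule AE_I2)
      fix x
      have "(\<lambda>n. \<psi> n x) \<longlonglongrightarrow> indicator {x. \<phi> x \<noteq> 0} x"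
      proof (cases "\<phi> x = 0")
        case True then show ?thesis by (simp add: supp)
      next
        case False
        then have "0 < \<phi> x" using \<phi> by (auto simp: C1_nonneg_def less_le)
        then have "filterlim (\<lambda>n. real n * \<phi> x) at_top sequentially"
          by (intro filterlim_at_top_mult_tendsto_pos[where c = "\<phi> x"]
              filterlim_tendsto_pos_mult_at_top filterlim_real_sequentially tendsto_const
              | simp add: mult.commute)+
        then have "(\<lambda>n. exp (- (real n * \<phi> x))) \<longlonglongrightarrow> 0"
          by (intro filterlim_compose[OF exp_at_bot] filterlim_compose[OF filterlim_uminus_at_bot_at_top])
        then have "(\<lambda>n. 1 - exp (- (real n * \<phi> x))) \<longlonglongrightarrow> 1 - 0" by (intro tendsto_intros)
        with False show ?thesis by (simp add: \<psi>_def)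
      qed
      then show "(\<lambda>n. f x * \<psi> n x) \<longlonglongrightarrow> f x * indicator {x. \<phi> x \<noteq> 0} x" by (intro tendsto_intros)
    qed
    show "AE x in lebesgue_on S. norm (f x * \<psi> n x) \<le> norm (f x * indicator K x)" for n
    proof (rule AE_I2)
      fix x
      have "0 \<le> \<phi> x" using \<phi> by (auto simp: C1_nonneg_def)
      then have "\<bar>\<psi> n x\<bar> \<le> 1" by (simp add: \<psi>_def)
      moreover have "\<psi> n x = 0" if "x \<notin> K" using that K(2) supp by blast
      ultimately have "\<bar>\<psi> n x\<bar> \<le> indicator K x" by (auto simp: indicator_def)
      then show "norm (f x * \<psi> n x) \<le> norm (f x * indicator K x)"
        by (simp add: abs_mult mult_left_mono)
    qed
  qed
  with z show ?thesis by (simp add: LIMSEQ_const_iff)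
qed

text \<open>The Borel sets over which the integral of the function restricted to the ball vanishes form a Dynkin
  system.  It contains the intersection-stable generator of positivity sets, hence all Borel sets.  The
  ball is a positivity set itself: multiplication by its function \<open>\<phi>0\<close> moves supports into \<open>S\<close>, and
  the total integral vanishes.\<close>

lemma fundamental_lemma_ball:
  fixes S :: "'a::euclidean_space set"
  assumes f: "f \<in> L2 (lebesgue_on S)" and S: "S \<in> sets lebesgue"
    and zero: "\<And>\<phi> G. test_function S \<phi> G \<Longrightarrow> l2_inner (lebesgue_on S) f \<phi> = 0"
    and r: "0 < r" "cball c r \<subseteq> S"
  shows "AE x in lebesgue. x \<in> ball c r \<longrightarrow> f x = 0"
proof -
  obtain \<phi>0 G0 where \<phi>0: "C1_nonneg \<phi>0 G0" "{x. \<phi>0 x \<noteq> 0} = ball c r"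
    using C1_nonneg_ball[OF r(1)] by blast
  define \<U> :: "'a set set" where "\<U> = {{x. \<phi> x \<noteq> 0} | \<phi> G. C1_nonneg \<phi> G}"
  define F where "F = (\<lambda>x. indicator (ball c r) x * f x)"
  have bS: "ball c r \<subseteq> S" using r(2) by auto
  have "integrable (lebesgue_on S) F"
  proof -
    have "indicat_real (ball c r) \<in> L2 (lebesgue_on S)"
      using S by (intro indicator_L2) auto
    from L2_mult_integrable[OF this f] show ?thesis by (simp add: F_def)
  qed
  then have "integrable lebesgue (\<lambda>x. indicat_real S x *\<^sub>R F x)"
    using S by (simp add: integrable_restrict_space)
  also have "(\<lambda>x. indicat_real S x *\<^sub>R F x) = F"
    using bS by (auto simp: F_def indicator_def fun_eq_iff simp del: mem_ball)
  finally have Fint: "integrable lebesgue F" .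
  have FU: "(LINT x|lebesgue. indicator U x * F x) = 0" if UU: "U \<in> \<U>" for U
  proof -
    obtain \<phi> G where U: "U = {x. \<phi> x \<noteq> 0}" "C1_nonneg \<phi> G" using UU unfolding \<U>_def by blast
    have eq: "{x. \<phi>0 x * \<phi> x \<noteq> 0} = ball c r \<inter> U" using \<phi>0(2) U(1) by auto
    have "(LINT x|lebesgue_on S. f x * indicator {x. \<phi>0 x * \<phi> x \<noteq> 0} x) = 0"
    proof (rule C1_nonneg_test_set[OF f S zero C1_nonneg_mult[OF \<phi>0(1) U(2)]])
      show "compact (cball c r)" "cball c r \<subseteq> S" using r by auto
      show "{x. \<phi>0 x * \<phi> x \<noteq> 0} \<subseteq> cball c r" unfolding eq by auto
    qed
    then have "(LINT x|lebesgue. indicator S x *\<^sub>R (f x * indicator {x. \<phi>0 x * \<phi> x \<noteq> 0} x)) = 0"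
      using S by (simp add: integral_restrict_space)
    also have "(\<lambda>x. indicator S x *\<^sub>R (f x * indicator {x. \<phi>0 x * \<phi> x \<noteq> 0} x)) = (\<lambda>x. indicator U x * F x)"
      unfolding eq using bS by (auto simp: F_def indicator_def fun_eq_iff)
    finally show ?thesis .
  qed
  have "F \<in> borel_measurable (completion lborel)" using Fint by simp
  from completion_ex_borel_measurable_real[OF this]
  obtain g where g: "g \<in> borel_measurable lborel" "AE x in lborel. F x = g x" by blast
  have gint: "integrable lborel g"
  proof -
    have "integrable lebesgue g"
      using Fint by (rule integrable_cong_AE_imp) (use g in \<open>auto intro: measurable_completion simp: AE_completion_iff AE_symmetric\<close>)
    then show ?thesis using g(1) by (simp add: integrable_completion)
  qed
  have eqint: "(LINT x|lborel. indicator A x *\<^sub>R g x) = (LINT x|lebesgue. indicator A x * F x)"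
    if A: "A \<in> sets borel" for A
  proof -
    have [measurable]: "A \<in> sets borel" "g \<in> borel_measurable borel" using A g(1) by simp_all
    have "(LINT x|lborel. indicator A x *\<^sub>R g x) = (LINT x|lebesgue. indicator A x *\<^sub>R g x)"
      by (intro integral_completion[symmetric]) measurable
    also have "\<dots> = (LINT x|lebesgue. indicator A x * F x)"
    proof (rule integral_cong_AE)
      show "(\<lambda>x. indicat_real A x *\<^sub>R g x) \<in> borel_measurable lebesgue"
        by (intro measurable_completion) measurable
      show "(\<lambda>x. indicat_real A x * F x) \<in> borel_measurable lebesgue"
        using that Fint by (intro borel_measurable_times borel_measurable_indicator) auto
      show "AE x in lebesgue. indicat_real A x *\<^sub>R g x = indicat_real A x * F x"
        using AE_completion[OF g(2)] by eventually_elim simp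
    qed
    finally show ?thesis .
  qed
  have open_U: "open U" if "U \<in> \<U>" for U
    using that open_Collect_neq[OF C1_nonneg_continuous, of _ _ "\<lambda>_. 0"] by (auto simp: \<U>_def)
  have stable: "Int_stable \<U>"
  proof (rule Int_stableI)
    fix a b assume "a \<in> \<U>" "b \<in> \<U>"
    then obtain \<phi> G \<phi>' G' where a: "a = {x. \<phi> x \<noteq> 0}" "C1_nonneg \<phi> G"
        and b: "b = {x. \<phi>' x \<noteq> 0}" "C1_nonneg \<phi>' G'"
      unfolding \<U>_def by blast
    have ab: "a \<inter> b = {x. \<phi> x * \<phi>' x \<noteq> 0}" unfolding a(1) b(1) by auto
    show "a \<inter> b \<in> \<U>" unfolding \<U>_def
      by (intro CollectI exI conjI, rule ab, rule C1_nonneg_mult[OF a(2) b(2)])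
  qed
  have ballU: "ball a d \<in> \<U>" if "0 < d" for a d
    using C1_nonneg_ball[OF that, of a] unfolding \<U>_def
    by (elim exE conjE) (intro CollectI exI conjI, auto)
  have gen: "sets borel = sigma_sets UNIV \<U>"
  proof (rule antisym)
    show "sigma_sets UNIV \<U> \<subseteq> sets (borel :: 'a measure)"
      using open_U sets.sigma_sets_subset[of \<U> "borel :: 'a measure"] by (simp add: subset_iff)
    have "W \<in> sigma_sets UNIV \<U>" if W: "open W" for W :: "'a set"
    proof -
      define \<B> where "\<B> = {ball a d | a d. 0 < d \<and> ball a d \<subseteq> W}"
      have "W = \<Union>\<B>"
      proof
        show "W \<subseteq> \<Union>\<B>"
        proof
          fix x assume "x \<in> W"
          then obtain d where "0 < d" "ball x d \<subseteq> W" using W open_contains_ball by blast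
          then have "ball x d \<in> \<B>" "x \<in> ball x d" by (auto simp: \<B>_def)
          then show "x \<in> \<Union>\<B>" by blast
        qed
      qed (auto simp: \<B>_def)
      moreover obtain \<B>' where "\<B>' \<subseteq> \<B>" "countable \<B>'" "\<Union>\<B>' = \<Union>\<B>"
        using Lindelof[of \<B>] by (auto simp: \<B>_def)
      moreover have "\<B> \<subseteq> \<U>" using ballU by (auto simp: \<B>_def)
      ultimately show ?thesis
        by (metis sigma_sets.Basic sigma_sets_UNION subset_iff)
    qed
    then show "sets (borel :: 'a measure) \<subseteq> sigma_sets UNIV \<U>"
      using sigma_sets_mono[of "{W. open W}" UNIV \<U>] by (auto simp: borel_def)
  qed
  have Bint: "integrable lborel (\<lambda>x. indicator A x *\<^sub>R g x)" if "A \<in> sets borel" for A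
    using that gint by (intro integrable_mult_indicator) auto
  have tot: "(LINT x|lborel. g x) = 0"
  proof -
    have "(LINT x|lborel. g x) = (LINT x|lebesgue. F x)" using eqint[of UNIV] by simp
    also have "\<dots> = (LINT x|lebesgue. indicator (ball c r) x * F x)"
      by (intro Bochner_Integration.integral_cong) (auto simp: F_def indicator_def)
    also have "\<dots> = 0" using FU[OF ballU[OF r(1)]] .
    finally show ?thesis .
  qed
  have "(LINT x|lborel. indicator A x *\<^sub>R g x) = 0" if A: "A \<in> sets borel" for A
  proof -
    have gen_A: "A \<in> sigma_sets UNIV \<U>" using A equalityD1[OF gen] by (rule rev_subsetD)
    then show ?thesis
    proof (induction rule: sigma_sets_induct_disjoint[OF stable, of UNIV, consumes 0, case_names sub A basic empty compl union])
      case A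
      show ?case by (fact gen_A)
    next
      case (basic U)
      then show ?case using FU eqint open_U by auto
    next
      case (compl B)
      then have B: "B \<in> sets borel" using gen by simp
      have "(\<lambda>x. indicator (UNIV - B) x *\<^sub>R g x) = (\<lambda>x. g x - indicator B x *\<^sub>R g x)"
        by (auto simp: indicator_def)
      then show ?case using compl tot gint Bint[OF B] by simp
    next
      case (union X)
      have X: "range X \<subseteq> sets borel" using union gen by auto
      have "set_lebesgue_integral lborel (\<Union>i. X i) g = (\<Sum>i. set_lebesgue_integral lborel (X i) g)"
      proof (rule lebesgue_integral_countable_add)
        show "\<And>i. X i \<in> sets lborel" using X by auto
        show "\<And>i j. i \<noteq> j \<Longrightarrow> X i \<inter> X j = {}" using union by (auto simp: disjoint_family_on_def)
        show "set_integrable lborel (\<Union>i. X i) g"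
          unfolding set_integrable_def using X by (intro Bint) auto
      qed
      moreover have "(LINT x|lborel. indicator (X i) x *\<^sub>R g x) = 0" for i
        using union by blast
      ultimately show ?case by (simp add: set_lebesgue_integral_def)
    qed auto
  qed
  then have "AE x in lborel. g x = 0"
    using sigma_finite_measure.density_zero[OF lborel.sigma_finite_measure_axioms gint] by (simp add: set_lebesgue_integral_def)
  with g(2) have "AE x in lborel. F x = 0" by eventually_elim simp
  then have "AE x in lebesgue. F x = 0" by (rule AE_completion)
  then show ?thesis by eventually_elim (auto simp: F_def)
qed

text \<open>Countably many balls cover the open set.\<close>

lemma fundamental_lemma:
  fixes S :: "'a::euclidean_space set"
  assumes f: "f \<in> L2 (lebesgue_on S)" and S: "open S"
    and zero: "\<And>\<phi> G. test_function S \<phi> G \<Longrightarrow> l2_inner (lebesgue_on S) f \<phi> = 0"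
  shows "AE x in lebesgue_on S. f x = 0"
proof -
  have Sm: "S \<in> sets lebesgue" using S by simp
  define \<B> where "\<B> = {ball a d | a d. 0 < d \<and> cball a d \<subseteq> S}"
  obtain \<B>' where \<B>': "\<B>' \<subseteq> \<B>" "countable \<B>'" "\<Union>\<B>' = \<Union>\<B>"
    using Lindelof[of \<B>] by (auto simp: \<B>_def)
  have cover: "S \<subseteq> \<Union>\<B>'"
  proof
    fix x assume "x \<in> S"
    then obtain d where "0 < d" "cball x d \<subseteq> S" using S open_contains_cball by blast
    then have "ball x d \<in> \<B>" "x \<in> ball x d" by (auto simp: \<B>_def)
    then show "x \<in> \<Union>\<B>'" using \<B>' by blast
  qed
  have "\<And>W. W \<in> \<B>' \<Longrightarrow> AE x in lebesgue. x \<in> W \<longrightarrow> f x = 0"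
    using \<B>'(1) fundamental_lemma_ball[OF f Sm zero] by (auto simp: \<B>_def)
  then have "AE x in lebesgue. \<forall>W\<in>\<B>'. x \<in> W \<longrightarrow> f x = 0"
    by (intro AE_ball_countable' \<B>'(2))
  then have "AE x in lebesgue. x \<in> S \<longrightarrow> f x = 0"
    by eventually_elim (use cover in blast)
  then show ?thesis using Sm by (simp add: AE_restrict_space_iff)
qed

lemma weak_div_lincomb:
  assumes S: "open S" and v: "\<And>i. i \<in> I \<Longrightarrow> v i \<in> L2 (lebesgue_on S)"
    and g: "\<And>i. i \<in> I \<Longrightarrow> has_weak_div S (v i) (g i)"
  shows "has_weak_div S (\<lambda>x. \<Sum>i\<in>I. c i *\<^sub>R v i x) (\<lambda>x. \<Sum>i\<in>I. c i *\<^sub>R g i x)"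
  unfolding has_weak_div_def
proof (intro conjI allI impI)
  have gL2: "g i \<in> L2 (lebesgue_on S)" if "i \<in> I" for i using g[OF that] by (simp add: has_weak_div_def)
  show "(\<lambda>x. \<Sum>i\<in>I. c i *\<^sub>R g i x) \<in> L2 (lebesgue_on S)"
    using gL2 by (intro L2_sum L2_scaleR)
  fix \<phi> G assume t: "test_function S \<phi> G"
  have "l2_inner (lebesgue_on S) (v i) G = - l2_inner (lebesgue_on S) (g i) \<phi>" if "i \<in> I" for i
    using g[OF that] t by (simp add: has_weak_div_def)
  then show "l2_inner (lebesgue_on S) (\<lambda>x. \<Sum>i\<in>I. c i *\<^sub>R v i x) G
      = - l2_inner (lebesgue_on S) (\<lambda>x. \<Sum>i\<in>I. c i *\<^sub>R g i x) \<phi>"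
    using v gL2 test_function_L2[OF t] S
      l2_inner_lincomb_left[of I v "lebesgue_on S" G c] l2_inner_lincomb_left[of I g "lebesgue_on S" \<phi> c]
    by (simp add: sum_negf)
qed

text \<open>Uniqueness is what makes \<open>weak_div\<close>, which selects some weak divergence, linear up to null sets.\<close>

lemma has_weak_div_unique:
  assumes S: "open S" and g: "has_weak_div S v g" "has_weak_div S v' g'"
    and v: "v \<in> borel_measurable (lebesgue_on S)" "v' \<in> borel_measurable (lebesgue_on S)"
      "AE x in lebesgue_on S. v x = v' x"
  shows "AE x in lebesgue_on S. g x = g' x"
proof -
  have gL2: "g \<in> L2 (lebesgue_on S)" "g' \<in> L2 (lebesgue_on S)" using g by (auto simp: has_weak_div_def)
  have "AE x in lebesgue_on S. g x + (-1) *\<^sub>R g' x = 0"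
  proof (rule fundamental_lemma[OF _ S])
    show "(\<lambda>x. g x + (-1) *\<^sub>R g' x) \<in> L2 (lebesgue_on S)" using gL2 by (intro L2_add L2_scaleR)
    fix \<phi> G assume t: "test_function S \<phi> G"
    have "G \<in> L2 (lebesgue_on S)" using test_function_L2[OF t] S by simp
    then have "l2_inner (lebesgue_on S) v G = l2_inner (lebesgue_on S) v' G"
      using v by (intro l2_inner_cong_AE) (auto dest: L2_measurable)
    then have "l2_inner (lebesgue_on S) g \<phi> = l2_inner (lebesgue_on S) g' \<phi>"
      using g t by (simp add: has_weak_div_def)
    then show "l2_inner (lebesgue_on S) (\<lambda>x. g x + (-1) *\<^sub>R g' x) \<phi> = 0"
      using l2_inner_add_left[OF gL2(1) L2_scaleR[OF gL2(2), of "-1"], of \<phi>] test_function_L2[OF t] S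
      by (simp only: l2_inner_scaleR_left) simp
  qed
  then show ?thesis by eventually_elim simp
qed

lemma Hdiv_weak_div:
  assumes "v \<in> Hdiv S"
  shows "has_weak_div S v (weak_div S v)" "v \<in> L2 (lebesgue_on S)" "weak_div S v \<in> L2 (lebesgue_on S)"
proof -
  obtain g where "has_weak_div S v g" using assms by (auto simp: Hdiv_def)
  then show "has_weak_div S v (weak_div S v)" unfolding weak_div_def by (rule someI[of "has_weak_div S v"])
  then show "weak_div S v \<in> L2 (lebesgue_on S)" by (simp add: has_weak_div_def)
  show "v \<in> L2 (lebesgue_on S)" using assms by (simp add: Hdiv_def)
qed

lemma weak_div_lincomb_AE:
  assumes S: "open S" and v: "\<And>i. i \<in> I \<Longrightarrow> v i \<in> Hdiv S" and w: "w \<in> Hdiv S"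
    and eq: "AE x in lebesgue_on S. w x = (\<Sum>i\<in>I. c i *\<^sub>R v i x)"
  shows "AE x in lebesgue_on S. weak_div S w x = (\<Sum>i\<in>I. c i *\<^sub>R weak_div S (v i) x)"
proof (rule has_weak_div_unique[OF S])
  show "has_weak_div S w (weak_div S w)" using Hdiv_weak_div[OF w] by simp
  show "has_weak_div S (\<lambda>x. \<Sum>i\<in>I. c i *\<^sub>R v i x) (\<lambda>x. \<Sum>i\<in>I. c i *\<^sub>R weak_div S (v i) x)"
    using Hdiv_weak_div[OF v] by (intro weak_div_lincomb[OF S])
  show "w \<in> borel_measurable (lebesgue_on S)" using Hdiv_weak_div[OF w] by (auto dest: L2_measurable)
  show "(\<lambda>x. \<Sum>i\<in>I. c i *\<^sub>R v i x) \<in> borel_measurable (lebesgue_on S)"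
    using Hdiv_weak_div[OF v] by (intro L2_measurable L2_sum L2_scaleR)
qed (fact eq)

section \<open>Domains with Lipschitz boundary\<close>

text \<open>Such a set has no slits: from a boundary point, a small step in the direction \<open>e\<close> leads to a point
  strictly above the graph and so out of the closure.  This places the subdomains inside the domain
  and the interiors of the mesh elements inside their subdomain.\<close>

lemma lipschitz_boundary_regular:
  fixes S :: "'a::euclidean_space set"
  assumes S: "open S" "lipschitz_boundary S"
  shows "interior (closure S) = S"
proof
  show "S \<subseteq> interior (closure S)" using S(1) by (simp add: interior_maximal closure_subset)
  show "interior (closure S) \<subseteq> S"
  proof (rule ccontr)
    assume "\<not> interior (closure S) \<subseteq> S"
    then obtain x where x: "x \<in> interior (closure S)" "x \<notin> S" by blast
    then have fr: "x \<in> frontier S"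
      using interior_subset[of "closure S"] S(1) by (auto simp: frontier_def interior_open)
    then obtain r e g L where r: "0 < r" and e: "norm e = 1" and g: "L-lipschitz_on UNIV (g::'a \<Rightarrow> real)"
      and graph: "S \<inter> ball x r = {y \<in> ball x r. y \<bullet> e < g (y - (y \<bullet> e) *\<^sub>R e)}"
      using S(2) unfolding lipschitz_boundary_def by meson
    define W where "W = ball x r \<inter> {y. g (y - (y \<bullet> e) *\<^sub>R e) < y \<bullet> e}"
    have gc: "continuous_on UNIV g" using g by (rule lipschitz_on_continuous_on)
    have "open W" unfolding W_def
      by (intro open_Int open_ball open_Collect_less continuous_intros
          continuous_on_compose2[OF gc]) auto
    moreover have "W \<inter> S = {}"
    proof -
      have "y \<notin> S" if "y \<in> W" for y
      proof
        assume "y \<in> S"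
        then have "y \<in> S \<inter> ball x r" using that by (simp add: W_def)
        then show False unfolding graph using that by (simp add: W_def)
      qed
      then show ?thesis by blast
    qed
    ultimately have W: "W \<inter> closure S = {}"
      by (metis Int_commute open_Int_closure_eq_empty)
    have x_above: "g (x - (x \<bullet> e) *\<^sub>R e) \<le> x \<bullet> e"
    proof (rule ccontr)
      assume "\<not> ?thesis"
      then have "x \<in> S \<inter> ball x r" unfolding graph using r by simp
      with x(2) show False by simp
    qed
    obtain \<rho> where \<rho>: "0 < \<rho>" "ball x \<rho> \<subseteq> closure S" using x(1) by (auto simp: mem_interior)
    define t where "t = min r \<rho> / 2"
    have t: "0 < t" "t < r" "t < \<rho>" using r \<rho>(1) by (auto simp: t_def min_def)
    define y where "y = x + t *\<^sub>R e"
    have ee: "e \<bullet> e = 1" using e by (simp add: norm_eq_1)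
    have ye: "y \<bullet> e = x \<bullet> e + t" by (simp add: y_def inner_add_left ee)
    have "y - (y \<bullet> e) *\<^sub>R e = x - (x \<bullet> e) *\<^sub>R e"
      unfolding ye by (simp add: y_def algebra_simps)
    moreover have "dist x y = t" using t e by (simp add: y_def dist_norm)
    ultimately have "y \<in> W" "y \<in> ball x \<rho>" using x_above t by (auto simp: W_def ye)
    with W \<rho>(2) show False by blast
  qed
qed

lemma sub_subset_dom:
  assumes "valid_problem P" "i < num_sub P"
  shows "sub P i \<subseteq> dom P"
proof -
  have "open (sub P i)" using assms by (auto simp: valid_problem_def polytopal_lipschitz_domain_def)
  moreover have "sub P i \<subseteq> closure (dom P)"
    using assms closure_subset[of "sub P i"] by (auto simp: valid_problem_def)
  ultimately have "sub P i \<subseteq> interior (closure (dom P))" by (rule interior_maximal[rotated])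
  also have "\<dots> = dom P"
    using assms by (intro lipschitz_boundary_regular) (auto simp: valid_problem_def polytopal_lipschitz_domain_def)
  finally show ?thesis .
qed

section \<open>Mesh elements\<close>

lemma parallelepiped_polytope_interior:
  fixes E :: "(real^'n) set"
  assumes "parallelepiped E"
  shows "polytope E" "interior E \<noteq> {}"
proof -
  obtain a f where f: "linear f" "inj f" "E = (\<lambda>x. a + f x) ` cbox 0 (1::real^'n)"
    using assms by (auto simp: parallelepiped_def)
  have E: "E = (+) a ` f ` cbox 0 1" using f(3) by (simp add: image_image)
  have "polytope (f ` cbox 0 1)" using f(1) polytope_linear_image polytope_interval by blast
  then show "polytope E" unfolding E by (simp add: polytope_translation_eq)
  have "interior E = (+) a ` f ` interior (cbox 0 1)"
    unfolding E interior_translation using interior_injective_linear_image[OF f(1,2)] by simp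
  moreover have "interior (cbox 0 (1::real^'n)) \<noteq> {}"
    by (simp add: interval_ne_empty_cart)
  ultimately show "interior E \<noteq> {}" by simp
qed

lemma full_simplex_polytope_interior:
  fixes E :: "(real^'n) set"
  assumes "int CARD('n) simplex E"
  shows "polytope E" "interior E \<noteq> {}"
proof -
  show "polytope E" using assms by (rule simplex_imp_polytope)
  have "aff_dim E = int CARD('n)" using assms by (rule aff_dim_simplex)
  then have "affine hull E = UNIV" using aff_dim_eq_full[of E] by simp
  moreover from this have "E \<noteq> {}" by auto
  ultimately show "interior E \<noteq> {}"
    using convex_simplex[OF assms] by (metis rel_interior_eq_empty rel_interior_interior)
qed

lemma spatial_partition_element:
  fixes E :: "(real^'n) set"
  assumes "spatial_partition S \<T>" "E \<in> \<T>"
  shows "polytope E" "interior E \<noteq> {}" "rel_interior E = interior E" "closed E" "closure (interior E) = E"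
proof -
  show E: "polytope E" "interior E \<noteq> {}"
    using assms full_simplex_polytope_interior[of E] parallelepiped_polytope_interior[of E]
    by (auto simp: spatial_partition_def)
  show "rel_interior E = interior E" using E(2) by (rule rel_interior_nonempty_interior)
  show "closed E" using E(1) by (rule polytope_imp_closed)
  with E show "closure (interior E) = E"
    by (simp add: convex_closure_interior polytope_imp_convex)
qed

lemma closure_open_nontrivial_limit:
  fixes U :: "'a::euclidean_space set"
  assumes "open U" "x \<in> closure U"
  shows "at x within U \<noteq> bot"
proof -
  have "x islimpt U"
  proof (cases "x \<in> U")
    case True
    then show ?thesis using assms(1) interior_limit_point interior_open by blast
  next
    case False
    then show ?thesis using assms(2) by (simp add: closure_def)
  qed
  then show ?thesis by (simp add: trivial_limit_within)
qed

text \<open>A boundary point lies in a closed element but, by the second assertion, not in its interior.\<close>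

lemma spatial_partition_frontier:
  fixes S :: "(real^'n) set"
  assumes \<T>: "spatial_partition S \<T>" and S: "open S" "lipschitz_boundary S"
  shows "frontier S \<subseteq> (\<Union>E\<in>\<T>. frontier E)" "\<And>E. E \<in> \<T> \<Longrightarrow> interior E \<subseteq> S"
proof -
  have reg: "interior (closure S) = S" using S by (rule lipschitz_boundary_regular)
  have un: "\<Union>\<T> = closure S" using \<T> by (simp add: spatial_partition_def)
  show int: "interior E \<subseteq> S" if "E \<in> \<T>" for E
    using interior_mono[of E "closure S"] reg un that by blast
  show "frontier S \<subseteq> (\<Union>E\<in>\<T>. frontier E)"
  proof
    fix x assume x: "x \<in> frontier S"
    then obtain E where E: "E \<in> \<T>" "x \<in> E" using un by (auto simp: frontier_def)
    have "x \<notin> interior E" using int[OF E(1)] x S(1) by (auto simp: frontier_def interior_open)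
    then show "x \<in> (\<Union>E\<in>\<T>. frontier E)" using E closure_subset[of E] by (auto simp: frontier_def)
  qed
qed

text \<open>A polyhedron is a finite intersection of half-spaces, and a boundary point is not interior to all of
  them.\<close>

lemma polyhedron_frontier_hyperplanes:
  fixes E :: "'a::euclidean_space set"
  assumes "polyhedron E"
  shows "\<exists>H. finite H \<and> (\<forall>h\<in>H. \<exists>a b. a \<noteq> 0 \<and> h = {x. a \<bullet> x = b}) \<and> frontier E \<subseteq> \<Union>H"
proof -
  obtain F where F: "finite F" "E = \<Inter>F" "\<forall>h\<in>F. \<exists>a b. a \<noteq> 0 \<and> h = {x. a \<bullet> x \<le> b}"
    using assms unfolding polyhedron_def by blast
  have "frontier E \<subseteq> \<Union>(frontier ` F)"
  proof
    fix x assume x: "x \<in> frontier E"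
    have "closed E" using assms by (rule polyhedron_imp_closed)
    then have xE: "x \<in> E" using x frontier_subset_closed by blast
    have "open (\<Inter>(interior ` F))" using F(1) by (intro open_Inter) auto
    moreover have "\<Inter>(interior ` F) \<subseteq> E" unfolding F(2) using interior_subset by fastforce
    ultimately have "\<Inter>(interior ` F) \<subseteq> interior E" by (rule interior_maximal[rotated])
    then have "x \<notin> \<Inter>(interior ` F)" using x by (auto simp: frontier_def)
    then obtain h where "h \<in> F" "x \<notin> interior h" by blast
    moreover have "x \<in> closure h" using xE \<open>h \<in> F\<close> F(2) closure_subset by blast
    ultimately show "x \<in> \<Union>(frontier ` F)" by (auto simp: frontier_def)
  qed
  moreover have "\<exists>a b. a \<noteq> 0 \<and> frontier h = {x. a \<bullet> x = b}" if h: "h \<in> F" for h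
  proof -
    obtain a b where ab: "a \<noteq> 0" "h = {x. a \<bullet> x \<le> b}" using F(3) h by blast
    then have "frontier h = {x. a \<bullet> x = b}" by (simp add: frontier_halfspace_le)
    with ab(1) show ?thesis by blast
  qed
  ultimately show ?thesis using F(1) by (intro exI[of _ "frontier ` F"]) auto
qed

section \<open>Finiteness of the surface measure of the boundary\<close>

text \<open>\<open>M ^ k\<close> pieces of diameter \<open>d / M\<close> contribute an amount that is independent of \<open>M\<close>, while \<open>M\<close> can be
  chosen large enough for every prescribed mesh size \<open>\<delta>\<close>.\<close>

lemma hausdorff_outer_le:
  fixes A :: "'a::metric_space set"
  assumes k: "k \<ge> 1" and d: "0 \<le> d"
    and cover: "\<And>M::nat. M \<ge> 1 \<Longrightarrow> \<exists>J (V :: 'j \<Rightarrow> 'a set). finite J \<and> card J \<le> M ^ k \<and> A \<subseteq> (\<Union>j\<in>J. V j) \<and>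
       (\<forall>j\<in>J. bounded (V j) \<and> diameter (V j) \<le> d / real M)"
  shows "hausdorff_outer k A \<le> ennreal (unit_ball_vol (real k) * (d / 2) ^ k)"
  unfolding hausdorff_outer_def
proof (rule SUP_least)
  fix \<delta> :: real assume "\<delta> \<in> {0<..}"
  then have \<delta>: "0 < \<delta>" by simp
  obtain M0 :: nat where M0: "d / \<delta> < real M0" using reals_Archimedean2 by blast
  define M where "M = Suc M0"
  have M: "M \<ge> 1" "d / real M \<le> \<delta>" using M0 \<delta> by (auto simp: M_def field_simps)
  obtain J and V :: "'j \<Rightarrow> 'a set" where J: "finite J" "card J \<le> M ^ k" "A \<subseteq> (\<Union>j\<in>J. V j)"
    and V: "\<forall>j\<in>J. bounded (V j) \<and> diameter (V j) \<le> d / real M"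
    using cover[OF M(1)] by blast
  obtain h where h: "bij_betw h {..<card J} J" using J(1) ex_bij_betw_nat_finite atLeast0LessThan by metis
  define U where "U = (\<lambda>n. if n < card J then V (h n) else {})"
  have hJ: "h n \<in> J" if "n < card J" for n using h that by (auto simp: bij_betw_def)
  have U: "bounded (U n)" "diameter (U n) \<le> d / real M" "0 \<le> diameter (U n)" for n
    using V hJ[of n] d by (auto simp: U_def diameter_ge_0)
  have "A \<subseteq> (\<Union>n. U n)"
  proof
    fix x assume "x \<in> A"
    then obtain j where "j \<in> J" "x \<in> V j" using J(3) by blast
    moreover obtain n where "n < card J" "h n = j"
      using h \<open>j \<in> J\<close> unfolding bij_betw_def by (metis imageE lessThan_iff)
    ultimately have "x \<in> U n" by (simp add: U_def)
    then show "x \<in> (\<Union>n. U n)" by blast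
  qed
  moreover have "\<forall>n. bounded (U n) \<and> diameter (U n) \<le> \<delta>" using U(1,2) M(2) by (meson order_trans)
  ultimately have U_in: "U \<in> {U. A \<subseteq> (\<Union>n. U n) \<and> (\<forall>n. bounded (U n) \<and> diameter (U n) \<le> \<delta>)}" by simp
  have ubv: "0 \<le> unit_ball_vol (real k)" by simp
  let ?f = "\<lambda>n. ennreal (unit_ball_vol (real k) * (diameter (U n) / 2) ^ k)"
  have "(\<Sum>n. ?f n) = (\<Sum>n<card J. ?f n)"
  proof (rule suminf_finite)
    fix n assume "n \<notin> {..<card J}"
    then show "?f n = 0" using k by (simp add: U_def diameter_def)
  qed simp
  also have "\<dots> \<le> (\<Sum>n<card J. ennreal (unit_ball_vol (real k) * ((d / real M) / 2) ^ k))"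
    using U ubv by (intro sum_mono ennreal_leI mult_left_mono power_mono divide_right_mono) auto
  also have "\<dots> = ennreal (real (card J) * (unit_ball_vol (real k) * ((d / real M) / 2) ^ k))"
    using d ubv by (simp add: ennreal_mult' ennreal_of_nat_eq_real_of_nat)
  also have "\<dots> \<le> ennreal (real (M ^ k) * (unit_ball_vol (real k) * ((d / real M) / 2) ^ k))"
    using J(2) d ubv by (intro ennreal_leI mult_right_mono) (auto simp del: of_nat_power)
  also have "real (M ^ k) * (unit_ball_vol (real k) * ((d / real M) / 2) ^ k) = unit_ball_vol (real k) * (d / 2) ^ k"
    using M(1) by (simp add: power_divide)
  finally show "(INF U\<in>{U. A \<subseteq> (\<Union>n. U n) \<and> (\<forall>n. bounded (U n) \<and> diameter (U n) \<le> \<delta>)}.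
      \<Sum>n. ennreal (unit_ball_vol (real k) * (diameter (U n) / 2) ^ k))
      \<le> ennreal (unit_ball_vol (real k) * (d / 2) ^ k)"
    by (intro INF_lower2[OF U_in])
qed

text \<open>On a hyperplane that is not parallel to the \<open>k\<close>-th axis, the \<open>k\<close>-th coordinate is an affine function
  of the others.\<close>

lemma hyperplane_dist_le:
  fixes a x y :: "real^'n"
  assumes ak: "a $ k \<noteq> 0" and xy: "a \<bullet> x = a \<bullet> y" and le: "\<And>j. j \<noteq> k \<Longrightarrow> \<bar>x $ j - y $ j\<bar> \<le> \<eta>" and \<eta>: "0 \<le> \<eta>"
  shows "dist x y \<le> (real CARD('n) + (\<Sum>j\<in>UNIV-{k}. \<bar>a $ j / a $ k\<bar>)) * \<eta>"
proof -
  define z where "z = x - y"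
  have "(\<Sum>j\<in>UNIV. a $ j * z $ j) = 0"
    using xy by (simp add: z_def inner_vec_def algebra_simps sum_subtractf)
  then have "a $ k * z $ k + (\<Sum>j\<in>UNIV-{k}. a $ j * z $ j) = 0"
    by (simp add: sum.remove[of UNIV k])
  then have "z $ k = - (\<Sum>j\<in>UNIV-{k}. a $ j * z $ j) / a $ k"
    using ak by (simp add: field_simps)
  then have "z $ k = - (\<Sum>j\<in>UNIV-{k}. a $ j / a $ k * z $ j)"
    by (simp add: sum_divide_distrib)
  then have "\<bar>z $ k\<bar> \<le> (\<Sum>j\<in>UNIV-{k}. \<bar>a $ j / a $ k * z $ j\<bar>)" by (simp only: abs_minus_cancel sum_abs)
  also have "\<dots> \<le> (\<Sum>j\<in>UNIV-{k}. \<bar>a $ j / a $ k\<bar> * \<eta>)"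
    unfolding abs_mult using le by (intro sum_mono mult_left_mono) (auto simp: z_def)
  finally have zk: "\<bar>z $ k\<bar> \<le> (\<Sum>j\<in>UNIV-{k}. \<bar>a $ j / a $ k\<bar>) * \<eta>" by (simp add: sum_distrib_right)
  have "norm z \<le> (\<Sum>j\<in>UNIV. \<bar>z $ j\<bar>)" by (rule norm_le_l1_cart)
  also have "\<dots> = \<bar>z $ k\<bar> + (\<Sum>j\<in>UNIV-{k}. \<bar>z $ j\<bar>)" by (simp add: sum.remove[of UNIV k])
  also have "(\<Sum>j\<in>UNIV-{k}. \<bar>z $ j\<bar>) \<le> (\<Sum>j\<in>UNIV-{k}. \<eta>)" using le by (intro sum_mono) (auto simp: z_def)
  also have "\<dots> \<le> real CARD('n) * \<eta>" using \<eta> by (simp add: mult_right_mono)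
  finally show ?thesis using zk by (simp add: z_def dist_norm algebra_simps)
qed

text \<open>The set is cut along a grid in the coordinates other than \<open>k\<close>, with \<open>M\<close> cells in each of these
  directions.\<close>

lemma hausdorff_outer_hyperplane_finite:
  fixes A :: "(real^'n) set"
  assumes card: "CARD('n) \<ge> 2" and a: "a \<noteq> 0" and A: "A \<subseteq> {x. a \<bullet> x = b}" "bounded A"
  shows "hausdorff_outer (CARD('n) - 1) A < \<infinity>"
proof -
  obtain k where k: "a $ k \<noteq> 0" using a by (auto simp: vec_eq_iff)
  define c where "c = real CARD('n) + (\<Sum>j\<in>UNIV-{k}. \<bar>a $ j / a $ k\<bar>)"
  have c: "0 \<le> c" by (simp add: c_def sum_nonneg)
  obtain R where R: "0 < R" "\<And>x. x \<in> A \<Longrightarrow> norm x \<le> R" using A(2) by (auto simp: bounded_pos)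
  have "hausdorff_outer (CARD('n) - 1) A \<le> ennreal (unit_ball_vol (real (CARD('n) - 1)) * ((c * (2 * R)) / 2) ^ (CARD('n) - 1))"
  proof (rule hausdorff_outer_le)
    show "1 \<le> CARD('n) - 1" using card by simp
    show "0 \<le> c * (2 * R)" using c R by simp
    fix M :: nat assume M: "M \<ge> 1"
    define \<eta> where "\<eta> = 2 * R / real M"
    have \<eta>: "0 < \<eta>" using R M by (simp add: \<eta>_def)
    define J :: "('n \<Rightarrow> nat) set" where "J = (\<Pi>\<^sub>E j\<in>UNIV-{k}. {..<M})"
    define V :: "('n \<Rightarrow> nat) \<Rightarrow> (real^'n) set" where
      "V \<phi> = {x \<in> A. \<forall>j. j \<noteq> k \<longrightarrow> - R + \<eta> * real (\<phi> j) \<le> x $ j \<and> x $ j \<le> - R + \<eta> * (real (\<phi> j) + 1)}" for \<phi>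
    have "finite J" by (simp add: J_def finite_PiE)
    moreover have "card J = M ^ (CARD('n) - 1)" by (simp add: J_def card_PiE card_Diff_singleton)
    moreover have "A \<subseteq> (\<Union>\<phi>\<in>J. V \<phi>)"
    proof
      fix x assume x: "x \<in> A"
      have "\<exists>m<M. - R + \<eta> * real m \<le> x $ j \<and> x $ j \<le> - R + \<eta> * (real m + 1)" for j
      proof -
        have xj: "\<bar>x $ j\<bar> \<le> R" using component_le_norm_cart[of x j] R(2)[OF x] by linarith
        define s where "s = (x $ j + R) / \<eta>"
        have "0 \<le> x $ j + R" "x $ j + R \<le> \<eta> * real M" using xj M by (auto simp: \<eta>_def)
        then have s: "0 \<le> s" "s \<le> real M" using \<eta> by (auto simp: s_def pos_divide_le_eq mult.commute)
        have xs: "x $ j = - R + \<eta> * s" using \<eta> by (simp add: s_def)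
        show ?thesis
        \<comment> \<open>The upper end of the range belongs to the last cell.\<close>
        proof (cases "s = real M")
          case True
          then show ?thesis using M \<eta> by (intro exI[of _ "M - 1"]) (auto simp: xs of_nat_diff)
        next
          case False
          define m where "m = nat \<lfloor>s\<rfloor>"
          have "real m \<le> s" "s < real m + 1" using s unfolding m_def by linarith+
          moreover have "m < M" using False s \<open>real m \<le> s\<close> by linarith
          ultimately show ?thesis using \<eta> by (intro exI[of _ m]) (auto simp: xs mult_left_mono)
        qed
      qed
      then obtain m where m: "\<And>j. m j < M" "\<And>j. - R + \<eta> * real (m j) \<le> x $ j \<and> x $ j \<le> - R + \<eta> * (real (m j) + 1)"
        by metis
      have "restrict m (UNIV - {k}) \<in> J" using m(1) by (auto simp: J_def)
      moreover have "x \<in> V (restrict m (UNIV - {k}))" using x m(2) by (auto simp: V_def)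
      ultimately show "x \<in> (\<Union>\<phi>\<in>J. V \<phi>)" by blast
    qed
    moreover have "bounded (V \<phi>)" for \<phi> using A(2) by (rule bounded_subset) (auto simp: V_def)
    moreover have "diameter (V \<phi>) \<le> c * (2 * R) / real M" for \<phi>
    proof (rule diameter_le)
      show "V \<phi> \<noteq> {} \<or> 0 \<le> c * (2 * R) / real M" using c R by simp
      fix x y assume xy: "x \<in> V \<phi>" "y \<in> V \<phi>"
      have "\<bar>x $ j - y $ j\<bar> \<le> \<eta>" if "j \<noteq> k" for j
      proof -
        have "- R + \<eta> * real (\<phi> j) \<le> x $ j" "x $ j \<le> - R + \<eta> * (real (\<phi> j) + 1)"
          "- R + \<eta> * real (\<phi> j) \<le> y $ j" "y $ j \<le> - R + \<eta> * (real (\<phi> j) + 1)"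
          using xy that by (auto simp: V_def)
        then show ?thesis by (auto simp: abs_le_iff distrib_left)
      qed
      moreover have "a \<bullet> x = a \<bullet> y" using xy A(1) by (auto simp: V_def)
      ultimately have "dist x y \<le> c * \<eta>" unfolding c_def using k \<eta> by (intro hyperplane_dist_le) auto
      then show "norm (x - y) \<le> c * (2 * R) / real M" by (simp add: \<eta>_def dist_norm)
    qed
    ultimately show "\<exists>J (V :: ('n \<Rightarrow> nat) \<Rightarrow> (real^'n) set). finite J \<and> card J \<le> M ^ (CARD('n) - 1) \<and> A \<subseteq> (\<Union>j\<in>J. V j) \<and>
       (\<forall>j\<in>J. bounded (V j) \<and> diameter (V j) \<le> c * (2 * R) / real M)"
      by (intro exI[of _ J] exI[of _ V]) simp
  qed
  then show ?thesis by (simp add: le_less_trans)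
qed

lemma sets_surface_measure: "sets borel \<subseteq> sets surface_measure"
proof -
  have "sets (measure_of UNIV (sets borel) (hausdorff_outer (CARD('n) - 1)) :: (real^'n) measure) = sets borel"
    by (simp add: sets_measure_of_conv) (metis sets.sigma_sets_eq space_borel)
  then show ?thesis unfolding surface_measure_def using sets_completionI_sets by fastforce
qed

lemma space_surface_measure [simp]: "space surface_measure = UNIV"
  by (simp add: surface_measure_def space_measure_of_conv)

text \<open>On a Borel set, \<open>measure_of\<close> has the value of the given set function or, if that one is not a measure,
  the value zero.\<close>

lemma emeasure_surface_measure_le:
  fixes A :: "(real^'n) set"
  assumes "A \<in> sets borel"
  shows "emeasure surface_measure A \<le> hausdorff_outer (CARD('n) - 1) A"
proof -
  have "sets (measure_of UNIV (sets borel) (hausdorff_outer (CARD('n) - 1)) :: (real^'n) measure) = sets borel"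
    by (simp add: sets_measure_of_conv) (metis sets.sigma_sets_eq space_borel)
  then have "emeasure surface_measure A = emeasure (measure_of UNIV (sets borel) (hausdorff_outer (CARD('n) - 1))) A"
    unfolding surface_measure_def using assms by simp
  also have "\<dots> \<le> hausdorff_outer (CARD('n) - 1) A"
    by (simp add: emeasure_measure_of_conv)
  finally show ?thesis .
qed

lemma borel_measurable_surface:
  assumes "f \<in> borel_measurable borel"
  shows "f \<in> borel_measurable (surface_on S)"
  unfolding surface_on_def
proof (rule measurable_restrict_space1)
  have "(\<lambda>x. x) \<in> measurable surface_measure (borel :: (real^'n) measure)"
  proof (rule measurableI)
    fix A :: "(real^'n) set" assume "A \<in> sets borel"
    then show "(\<lambda>x. x) -` A \<inter> space surface_measure \<in> sets surface_measure"
      using subsetD[OF sets_surface_measure] by simp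
  qed simp
  from measurable_compose[OF this assms] show "f \<in> borel_measurable surface_measure" .
qed

text \<open>The boundary is covered by the boundaries of the mesh elements, hence by finitely many hyperplanes.\<close>

lemma surface_frontier_finite:
  fixes S :: "(real^'n) set"
  assumes card: "CARD('n) \<ge> 2" and \<T>: "spatial_partition S \<T>" and S: "open S" "lipschitz_boundary S" "bounded S"
  shows "emeasure surface_measure (frontier S) < \<infinity>"
proof -
  have "\<exists>H. finite H \<and> (\<forall>h\<in>H. \<exists>a b. a \<noteq> 0 \<and> h = {x. a \<bullet> x = b}) \<and> frontier E \<subseteq> \<Union>H" if "E \<in> \<T>" for E
    using spatial_partition_element(1)[OF \<T> that] polytope_imp_polyhedron polyhedron_frontier_hyperplanes by blast
  then obtain H where H: "\<And>E. E \<in> \<T> \<Longrightarrow> finite (H E)"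
      "\<And>E h. E \<in> \<T> \<Longrightarrow> h \<in> H E \<Longrightarrow> \<exists>a b. a \<noteq> 0 \<and> h = {x. a \<bullet> x = b}" "\<And>E. E \<in> \<T> \<Longrightarrow> frontier E \<subseteq> \<Union>(H E)"
    by metis
  define \<H> where "\<H> = (\<Union>E\<in>\<T>. H E)"
  have fin: "finite \<H>" using H(1) \<T> by (auto simp: \<H>_def spatial_partition_def)
  have "(\<Union>E\<in>\<T>. frontier E) \<subseteq> \<Union>\<H>" using H(3) unfolding \<H>_def by blast
  then have cov: "frontier S = (\<Union>h\<in>\<H>. frontier S \<inter> h)"
    using spatial_partition_frontier(1)[OF \<T> S(1,2)]
    unfolding Int_Union[symmetric] by (metis Int_absorb2 order_trans)
  have bor: "frontier S \<inter> h \<in> sets borel" if h: "h \<in> \<H>" for h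
  proof -
    obtain a b where "h = {x. a \<bullet> x = b}" using H(2) h unfolding \<H>_def by blast
    then have "closed h" by (simp add: closed_hyperplane)
    then show ?thesis by (intro sets.Int borel_closed) auto
  qed
  have fin_h: "emeasure surface_measure (frontier S \<inter> h) < \<infinity>" if h: "h \<in> \<H>" for h
  proof -
    obtain a b where ab: "a \<noteq> 0" "h = {x. a \<bullet> x = b}" using H(2) h unfolding \<H>_def by blast
    have "bounded (frontier S \<inter> h)"
      using bounded_closure[OF S(3)] by (rule bounded_subset) (auto simp: frontier_def)
    moreover have "frontier S \<inter> h \<subseteq> {x. a \<bullet> x = b}" unfolding ab(2) by blast
    ultimately have "hausdorff_outer (CARD('n) - 1) (frontier S \<inter> h) < \<infinity>"
      using hausdorff_outer_hyperplane_finite[OF card ab(1)] by blast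
    then show ?thesis using emeasure_surface_measure_le[OF bor[OF h]] by (rule le_less_trans[rotated])
  qed
  have "emeasure surface_measure (\<Union>h\<in>\<H>. frontier S \<inter> h) \<le> (\<Sum>h\<in>\<H>. emeasure surface_measure (frontier S \<inter> h))"
    using bor sets_surface_measure by (intro emeasure_subadditive_finite fin) auto
  also have "\<dots> < \<infinity>" using fin_h fin by simp
  finally show ?thesis using cov by simp
qed

section \<open>The permeability form\<close>

lemma matrix_mult_matrix_inv:
  fixes A :: "real^'n^'n"
  assumes "invertible A"
  shows "A ** matrix_inv A = mat 1"
  using someI_ex[of "\<lambda>A'. A ** A' = mat 1 \<and> A' ** A = mat 1"] assms
  by (simp add: invertible_def matrix_inv_def)

text \<open>For \<open>w = K\<inverse> u\<close> the lower bound reads \<open>k |w|\<^sup>2 \<le> w \<bullet> u\<close>; everything follows from this inequality.\<close>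

lemma elliptic_matrix_inv:
  fixes K :: "real^'n^'n"
  assumes k: "0 < k" "\<And>\<zeta>. k * (\<zeta> \<bullet> \<zeta>) \<le> \<zeta> \<bullet> (K *v \<zeta>)"
  shows "det K \<noteq> 0" "K *v (matrix_inv K *v u) = u" "norm (matrix_inv K *v u) \<le> norm u / k"
    "0 \<le> (matrix_inv K *v u) \<bullet> u" "(matrix_inv K *v u) \<bullet> u = 0 \<Longrightarrow> u = 0"
proof -
  have "\<zeta> = 0" if "K *v \<zeta> = 0" for \<zeta>
  proof -
    have "k * (\<zeta> \<bullet> \<zeta>) \<le> 0" using k(2)[of \<zeta>] that by simp
    then show ?thesis using k(1) by (metis inner_gt_zero_iff mult_pos_pos not_less)
  qed
  then have "\<exists>B. B ** K = mat 1" unfolding matrix_left_invertible_ker by blast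
  then have inv: "invertible K" by (simp add: invertible_left_inverse)
  then show "det K \<noteq> 0" by (simp add: invertible_det_nz)
  have KK: "K *v (matrix_inv K *v u) = u" for u
    using inv by (simp add: matrix_vector_mul_assoc matrix_mult_matrix_inv)
  then show "K *v (matrix_inv K *v u) = u" .
  define w where "w = matrix_inv K *v u"
  have u: "u = K *v w" using KK by (simp add: w_def)
  have le: "k * (w \<bullet> w) \<le> w \<bullet> u" unfolding u by (rule k(2))
  have "k * (norm w)\<^sup>2 \<le> w \<bullet> u" using le by (simp add: power2_norm_eq_inner)
  also have "\<dots> \<le> norm w * norm u" by (rule norm_cauchy_schwarz)
  finally have "norm w * (k * norm w) \<le> norm w * norm u" by (simp add: power2_eq_square mult_ac)
  then have "k * norm w \<le> norm u" by (cases "w = 0") auto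
  then show "norm (matrix_inv K *v u) \<le> norm u / k"
    using k(1) by (simp add: w_def[symmetric] pos_le_divide_eq mult.commute)
  have ww: "0 \<le> k * (w \<bullet> w)" using k(1) by simp
  with le show "0 \<le> (matrix_inv K *v u) \<bullet> u" by (simp add: w_def[symmetric])
  assume "(matrix_inv K *v u) \<bullet> u = 0"
  then have "k * (w \<bullet> w) \<le> 0" using le by (simp add: w_def[symmetric])
  then have "w = 0" using k(1) by (metis inner_gt_zero_iff mult_pos_pos not_less)
  then show "u = 0" unfolding u by simp
qed

text \<open>Completeness of the Lebesgue measure.\<close>

lemma measurable_lebesgue_on_AE:
  fixes f g :: "'a::euclidean_space \<Rightarrow> 'b::topological_space"
  assumes S: "S \<in> sets lebesgue" and f: "f \<in> borel_measurable (lebesgue_on S)"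
    and eq: "AE x in lebesgue_on S. f x = g x"
  shows "g \<in> borel_measurable (lebesgue_on S)"
proof (rule measurableI)
  fix B :: "'b set" assume B: "B \<in> sets borel"
  have "f -` B \<inter> S \<in> sets (lebesgue_on S)" using measurable_sets[OF f B] by simp
  then have fB: "f -` B \<inter> S \<in> sets lebesgue" using S by (simp add: sets_restrict_space_iff)
  have "AE x in lebesgue. x \<in> S \<longrightarrow> f x = g x" using eq S by (simp add: AE_restrict_space_iff)
  then have "AE x in lebesgue. x \<in> f -` B \<inter> S \<longleftrightarrow> x \<in> g -` B \<inter> S"
    by eventually_elim auto
  then have "g -` B \<inter> S \<in> sets lebesgue"
    by (rule completion.in_sets_AE[OF _ fB]) simp
  then show "g -` B \<inter> space (lebesgue_on S) \<in> sets (lebesgue_on S)"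
    using S by (simp add: sets_restrict_space_iff)
qed simp

text \<open>Cramer's rule expresses the components as quotients of determinants, which are polynomials in the
  measurable entries.\<close>

lemma measurable_matrix_inv_vector:
  fixes K :: "'a::euclidean_space \<Rightarrow> real^'n^'n"
  assumes S: "S \<in> sets lebesgue" and K: "K \<in> borel_measurable (lebesgue_on S)"
    and u: "u \<in> borel_measurable (lebesgue_on S)" and det: "AE x in lebesgue_on S. det (K x) \<noteq> 0"
  shows "(\<lambda>x. matrix_inv (K x) *v u x) \<in> borel_measurable (lebesgue_on S)"
proof -
  let ?M = "lebesgue_on S"
  have comp: "(\<lambda>x. f x $ k) \<in> borel_measurable ?M" if f: "f \<in> borel_measurable ?M" for f :: "'a \<Rightarrow> 'b::real_normed_vector^'n" and k
    using f by (rule measurable_compose) (rule borel_measurable_continuous_onI, intro continuous_intros)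
  have Kc: "(\<lambda>x. K x $ i $ j) \<in> borel_measurable ?M" for i j
    using comp[OF comp[OF K]] .
  have uc: "(\<lambda>x. u x $ i) \<in> borel_measurable ?M" for i using comp[OF u] .
  have detm: "(\<lambda>x. det (\<chi> i j. A x i j)) \<in> borel_measurable ?M"
    if A: "\<And>i j. (\<lambda>x. A x i j) \<in> borel_measurable ?M" for A :: "'a \<Rightarrow> 'n \<Rightarrow> 'n \<Rightarrow> real"
    unfolding det_def using A
    by (auto intro!: borel_measurable_sum borel_measurable_times borel_measurable_prod borel_measurable_const)
  define g where "g x = (\<chi> k. det (\<chi> i j. if j = k then u x $ i else K x $ i $ j) / det (\<chi> i j. K x $ i $ j))" for x
  have "g \<in> borel_measurable ?M"
  proof (rule borel_measurable_euclidean_space[THEN iffD2], rule ballI)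
    fix b :: "real^'n" assume "b \<in> Basis"
    then obtain k where b: "b = axis k 1" by (auto simp: Basis_vec_def)
    have "(\<lambda>x. det (\<chi> i j. if j = k then u x $ i else K x $ i $ j)) \<in> borel_measurable ?M"
      using Kc uc by (intro detm) (auto split: if_splits)
    then show "(\<lambda>x. g x \<bullet> b) \<in> borel_measurable ?M"
      unfolding g_def b inner_axis using detm[of "\<lambda>x i j. K x $ i $ j"] Kc by (simp add: borel_measurable_divide)
  qed
  moreover have "AE x in ?M. g x = matrix_inv (K x) *v u x"
    using det
  proof eventually_elim
    case (elim x)
    then have "K x *v (matrix_inv (K x) *v u x) = u x"
      by (simp add: invertible_det_nz[symmetric] matrix_vector_mul_assoc matrix_mult_matrix_inv)
    then show ?case unfolding cramer[OF elim] by (simp add: g_def)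
  qed
  ultimately show ?thesis by (rule measurable_lebesgue_on_AE[OF S])
qed

lemma sub_perm_elliptic:
  fixes P :: "'n::finite problem"
  assumes P: "valid_problem P" "i < num_sub P"
  shows "\<exists>k>0. AE x in lebesgue_on (sub P i). \<forall>\<zeta>. k * (\<zeta> \<bullet> \<zeta>) \<le> \<zeta> \<bullet> (perm P x *v \<zeta>)"
    and "perm P \<in> borel_measurable (lebesgue_on (sub P i))"
proof -
  have sub: "sub P i \<subseteq> dom P" using P by (rule sub_subset_dom)
  have op: "open (sub P i)" "open (dom P)"
    using P by (auto simp: valid_problem_def polytopal_lipschitz_domain_def)
  have perm: "valid_perm (dom P) (perm P)" using P by (simp add: valid_problem_def)
  then obtain k k' where k: "0 < k" and ae: "AE x in lebesgue_on (dom P). \<forall>\<zeta>.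
           k * (\<zeta> \<bullet> \<zeta>) \<le> \<zeta> \<bullet> (perm P x *v \<zeta>) \<and> \<zeta> \<bullet> (perm P x *v \<zeta>) \<le> k' * (\<zeta> \<bullet> \<zeta>)"
    by (auto simp: valid_perm_def)
  have "AE x in lebesgue. x \<in> dom P \<longrightarrow> (\<forall>\<zeta>.
           k * (\<zeta> \<bullet> \<zeta>) \<le> \<zeta> \<bullet> (perm P x *v \<zeta>) \<and> \<zeta> \<bullet> (perm P x *v \<zeta>) \<le> k' * (\<zeta> \<bullet> \<zeta>))"
    using ae op by (simp add: AE_restrict_space_iff)
  then have "AE x in lebesgue. x \<in> sub P i \<longrightarrow> (\<forall>\<zeta>. k * (\<zeta> \<bullet> \<zeta>) \<le> \<zeta> \<bullet> (perm P x *v \<zeta>))"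
    by eventually_elim (use sub in blast)
  then show "\<exists>k>0. AE x in lebesgue_on (sub P i). \<forall>\<zeta>. k * (\<zeta> \<bullet> \<zeta>) \<le> \<zeta> \<bullet> (perm P x *v \<zeta>)"
    using op k by (auto simp: AE_restrict_space_iff)
  have "perm P \<in> borel_measurable (restrict_space (lebesgue_on (dom P)) (sub P i))"
    using perm by (auto simp: valid_perm_def intro: measurable_restrict_space1)
  moreover have "restrict_space (lebesgue_on (dom P)) (sub P i) = lebesgue_on (sub P i)"
    using op sub by (subst restrict_restrict_space) (auto simp: Int_absorb1)
  ultimately show "perm P \<in> borel_measurable (lebesgue_on (sub P i))" by simp
qed

lemma perm_inv_L2:
  fixes P :: "'n::finite problem"
  assumes P: "valid_problem P" "i < num_sub P" and u: "u \<in> L2 (lebesgue_on (sub P i))"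
  shows "(\<lambda>x. matrix_inv (perm P x) *v u x) \<in> L2 (lebesgue_on (sub P i))"
proof -
  have op: "open (sub P i)" using P by (auto simp: valid_problem_def polytopal_lipschitz_domain_def)
  obtain k where k: "0 < k" "AE x in lebesgue_on (sub P i). \<forall>\<zeta>. k * (\<zeta> \<bullet> \<zeta>) \<le> \<zeta> \<bullet> (perm P x *v \<zeta>)"
    using sub_perm_elliptic(1)[OF P] by blast
  have "AE x in lebesgue_on (sub P i). det (perm P x) \<noteq> 0"
    using k(2) by eventually_elim (use elliptic_matrix_inv(1)[OF k(1)] in blast)
  then have meas: "(\<lambda>x. matrix_inv (perm P x) *v u x) \<in> borel_measurable (lebesgue_on (sub P i))"
    using op u sub_perm_elliptic(2)[OF P] by (intro measurable_matrix_inv_vector) (auto dest: L2_measurable)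
  have "integrable (lebesgue_on (sub P i)) (\<lambda>x. (norm (matrix_inv (perm P x) *v u x))\<^sup>2)"
  proof (rule Bochner_Integration.integrable_bound)
    show "integrable (lebesgue_on (sub P i)) (\<lambda>x. (1 / k)\<^sup>2 * (norm (u x))\<^sup>2)" using u by (simp add: L2_def)
    show "(\<lambda>x. (norm (matrix_inv (perm P x) *v u x))\<^sup>2) \<in> borel_measurable (lebesgue_on (sub P i))"
      using meas by measurable
    show "AE x in lebesgue_on (sub P i). norm ((norm (matrix_inv (perm P x) *v u x))\<^sup>2) \<le> norm ((1 / k)\<^sup>2 * (norm (u x))\<^sup>2)"
      using k(2)
    proof eventually_elim
      case (elim x)
      then have "norm (matrix_inv (perm P x) *v u x) \<le> norm (u x) / k"
        by (intro elliptic_matrix_inv(3)[OF k(1)]) blast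
      then have "(norm (matrix_inv (perm P x) *v u x))\<^sup>2 \<le> (norm (u x) / k)\<^sup>2" by (intro power_mono) auto
      then show ?case by (simp add: power_divide)
    qed
  qed
  with meas show ?thesis by (simp add: L2_def)
qed

lemma a_form_lincomb:
  fixes P :: "'n::finite problem"
  assumes P: "valid_problem P" "i < num_sub P"
    and u: "\<And>j. j \<in> J \<Longrightarrow> e j \<in> L2 (lebesgue_on (sub P i))"
    and uu: "u \<in> L2 (lebesgue_on (sub P i))" "AE x in lebesgue_on (sub P i). u x = (\<Sum>j\<in>J. c j *\<^sub>R e j x)"
    and vv: "v \<in> L2 (lebesgue_on (sub P i))" "AE x in lebesgue_on (sub P i). v x = (\<Sum>j\<in>J. d j *\<^sub>R e j x)"
  shows "a_form P i u v = (\<Sum>j\<in>J. \<Sum>k\<in>J. a_form P i (e j) (e k) * (c j * d k))"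
proof -
  let ?M = "lebesgue_on (sub P i)"
  have eL: "(\<lambda>x. matrix_inv (perm P x) *v e j x) \<in> L2 ?M" if "j \<in> J" for j
    using perm_inv_L2[OF P u[OF that]] .
  have "a_form P i u v = l2_inner ?M (\<lambda>x. \<Sum>j\<in>J. c j *\<^sub>R (matrix_inv (perm P x) *v e j x)) (\<lambda>x. \<Sum>j\<in>J. d j *\<^sub>R e j x)"
    unfolding a_form_def
  proof (rule l2_inner_cong_AE)
    show "AE x in ?M. matrix_inv (perm P x) *v u x = (\<Sum>j\<in>J. c j *\<^sub>R (matrix_inv (perm P x) *v e j x))"
      using uu(2) by eventually_elim
        (simp add: linear_sum[OF matrix_vector_mul_linear] linear_scale[OF matrix_vector_mul_linear])
    show "(\<lambda>x. \<Sum>j\<in>J. c j *\<^sub>R (matrix_inv (perm P x) *v e j x)) \<in> borel_measurable ?M"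
      using eL by (intro L2_measurable L2_sum L2_scaleR)
    show "(\<lambda>x. \<Sum>j\<in>J. d j *\<^sub>R e j x) \<in> borel_measurable ?M"
      using u by (intro L2_measurable L2_sum L2_scaleR)
  qed (use uu vv perm_inv_L2[OF P uu(1)] in \<open>auto intro: L2_measurable\<close>)
  also have "\<dots> = (\<Sum>j\<in>J. c j * l2_inner ?M (\<lambda>x. matrix_inv (perm P x) *v e j x) (\<lambda>x. \<Sum>j\<in>J. d j *\<^sub>R e j x))"
    using eL u by (intro l2_inner_lincomb_left L2_sum L2_scaleR)
  also have "\<dots> = (\<Sum>j\<in>J. c j * (\<Sum>k\<in>J. d k * a_form P i (e j) (e k)))"
    unfolding a_form_def using eL u by (intro sum.cong refl arg_cong2[of _ _ _ _ "(*)"] l2_inner_lincomb_right)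
  finally show ?thesis by (simp add: sum_distrib_left mult_ac)
qed

lemma a_form_self:
  fixes P :: "'n::finite problem"
  assumes P: "valid_problem P" "i < num_sub P" and u: "u \<in> L2 (lebesgue_on (sub P i))"
  shows "0 \<le> a_form P i u u" "a_form P i u u = 0 \<Longrightarrow> AE x in lebesgue_on (sub P i). u x = 0"
proof -
  let ?M = "lebesgue_on (sub P i)"
  obtain k where k: "0 < k" "AE x in ?M. \<forall>\<zeta>. k * (\<zeta> \<bullet> \<zeta>) \<le> \<zeta> \<bullet> (perm P x *v \<zeta>)"
    using sub_perm_elliptic(1)[OF P] by blast
  have int: "integrable ?M (\<lambda>x. (matrix_inv (perm P x) *v u x) \<bullet> u x)"
    using L2_inner_integrable[OF perm_inv_L2[OF P u] u] .
  have nn: "AE x in ?M. 0 \<le> (matrix_inv (perm P x) *v u x) \<bullet> u x"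
    using k(2) by eventually_elim (use elliptic_matrix_inv(4)[OF k(1)] in blast)
  show "0 \<le> a_form P i u u" unfolding a_form_def l2_inner_def using nn by (rule integral_nonneg_AE)
  assume "a_form P i u u = 0"
  then have "AE x in ?M. (matrix_inv (perm P x) *v u x) \<bullet> u x = 0"
    unfolding a_form_def l2_inner_def using integral_nonneg_eq_0_iff_AE[OF int nn] by simp
  then show "AE x in ?M. u x = 0"
    using k(2) by eventually_elim (use elliptic_matrix_inv(5)[OF k(1)] in blast)
qed

section \<open>Outward normals\<close>

lemma is_outward_normal_unique:
  assumes "is_outward_normal S x n" "is_outward_normal S x n'"
  shows "n = n'"
proof (rule ccontr)
  assume ne: "n \<noteq> n'"
  obtain r where r: "0 < r" "S \<inter> ball x r = {y \<in> ball x r. (y - x) \<bullet> n < 0}" and n: "norm n = 1"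
    using assms(1) by (auto simp: is_outward_normal_def)
  obtain r' where r': "0 < r'" "S \<inter> ball x r' = {y \<in> ball x r'. (y - x) \<bullet> n' < 0}" and n': "norm n' = 1"
    using assms(2) by (auto simp: is_outward_normal_def)
  have nn: "n \<bullet> n = 1" "n' \<bullet> n' = 1" using n n' by (simp_all add: norm_eq_1)
  have "0 < (n - n') \<bullet> (n - n')" using ne by simp
  then have lt: "n \<bullet> n' < 1" using nn by (simp add: inner_diff_left inner_diff_right inner_commute)
  \<comment> \<open>A step in the direction \<open>n' - n\<close> enters the half-space of \<open>n\<close> and leaves the one of \<open>n'\<close>.\<close>
  define t where "t = min r r' / (2 * norm (n' - n))"
  have pos: "0 < norm (n' - n)" using ne by simp
  then have t: "0 < t" "t * norm (n' - n) < r" "t * norm (n' - n) < r'"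
    using r(1) r'(1) by (auto simp: t_def)
  define y where "y = x + t *\<^sub>R (n' - n)"
  have "dist x y = t * norm (n' - n)" using t(1) by (simp add: y_def dist_norm)
  then have yb: "y \<in> ball x r" "y \<in> ball x r'" using t by auto
  have "(y - x) \<bullet> n = t * (n' \<bullet> n - 1)" "(y - x) \<bullet> n' = t * (1 - n \<bullet> n')"
    by (simp_all add: y_def inner_diff_left nn)
  then have "(y - x) \<bullet> n < 0" "\<not> (y - x) \<bullet> n' < 0"
    using lt t(1) by (simp_all add: inner_commute mult_less_0_iff not_less)
  then have "y \<in> S \<inter> ball x r" "y \<notin> S \<inter> ball x r'" unfolding r(2) r'(2) using yb by auto
  with yb show False by blast
qed

lemma outward_normal_eq:
  assumes "is_outward_normal S x n"
  shows "outward_normal S x = n"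
proof -
  have "(THE n. is_outward_normal S x n) = n"
    using assms is_outward_normal_unique[OF _ assms] by (rule the_equality)
  moreover have "\<exists>n. is_outward_normal S x n" using assms by blast
  ultimately show ?thesis by (simp add: outward_normal_def)
qed

lemma norm_outward_normal_le: "norm (outward_normal S x) \<le> 1"
proof (cases "\<exists>n. is_outward_normal S x n")
  case True
  then obtain n where n: "is_outward_normal S x n" by blast
  then show ?thesis using outward_normal_eq[OF n] by (simp add: is_outward_normal_def)
qed (simp add: outward_normal_def)

lemma is_outward_normal_frontier:
  assumes "open S" "is_outward_normal S x n"
  shows "x \<in> frontier S"
proof -
  obtain r where r: "0 < r" "S \<inter> ball x r = {y \<in> ball x r. (y - x) \<bullet> n < 0}" and n: "norm n = 1"
    using assms(2) by (auto simp: is_outward_normal_def)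
  have nn: "n \<bullet> n = 1" using n by (simp add: norm_eq_1)
  have "x \<notin> S \<inter> ball x r" unfolding r(2) by simp
  then have "x \<notin> S" using r(1) by simp
  moreover have "x \<in> closure S"
    unfolding closure_approachable
  proof (intro allI impI)
    fix e :: real assume "0 < e"
    define t where "t = min e r / 2"
    have t: "0 < t" "t < e" "t < r" using \<open>0 < e\<close> r(1) by (auto simp: t_def)
    have "x - t *\<^sub>R n \<in> S \<inter> ball x r" unfolding r(2) using t n by (simp add: dist_norm nn)
    then show "\<exists>y\<in>S. dist y x < e" using t n by (intro bexI[of _ "x - t *\<^sub>R n"]) (auto simp: dist_norm)
  qed
  ultimately show ?thesis using assms(1) by (simp add: frontier_def interior_open)
qed

text \<open>Near \<open>x\<close> the boundary is the hyperplane through \<open>x\<close> orthogonal to \<open>n\<close>, because points on either side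
  of it are interior to the set or to its complement.\<close>

lemma is_outward_normal_nearby:
  assumes S: "open S" and r: "S \<inter> ball x r = {y \<in> ball x r. (y - x) \<bullet> n < 0}" "norm n = 1"
    and y: "y \<in> ball x r" "y \<in> frontier S"
  shows "is_outward_normal S y n"
proof -
  have yS: "y \<notin> S" using S y(2) by (simp add: frontier_def interior_open)
  then have ge: "0 \<le> (y - x) \<bullet> n" using r(1) y(1) by (auto simp: not_less[symmetric])
  moreover have "\<not> 0 < (y - x) \<bullet> n"
  proof
    assume pos: "0 < (y - x) \<bullet> n"
    define W where "W = ball x r \<inter> {z. 0 < (z - x) \<bullet> n}"
    have "open W" unfolding W_def
      by (intro open_Int open_ball open_Collect_less continuous_intros)
    moreover have "W \<inter> S = {}"
    proof -
      have "z \<notin> S" if z: "z \<in> W" for z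
      proof
        assume "z \<in> S"
        then have "z \<in> S \<inter> ball x r" using z by (simp add: W_def)
        then show False unfolding r(1) using z by (simp add: W_def)
      qed
      then show ?thesis by blast
    qed
    ultimately have "W \<inter> closure S = {}" by (metis Int_commute open_Int_closure_eq_empty)
    moreover have "y \<in> W" using pos y(1) by (simp add: W_def)
    ultimately show False using y(2) by (auto simp: frontier_def)
  qed
  ultimately have y0: "(y - x) \<bullet> n = 0" by linarith
  define \<rho> where "\<rho> = r - dist x y"
  have \<rho>: "0 < \<rho>" "ball y \<rho> \<subseteq> ball x r"
    using y(1) by (auto simp: \<rho>_def) (metis add.commute add_less_cancel_left dist_commute dist_triangle_lt less_diff_eq)
  have "S \<inter> ball y \<rho> = {z \<in> ball y \<rho>. (z - y) \<bullet> n < 0}"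
  proof -
    have "(z - y) \<bullet> n = (z - x) \<bullet> n" for z using y0 by (simp add: inner_diff_left)
    moreover have "S \<inter> ball y \<rho> = (S \<inter> ball x r) \<inter> ball y \<rho>" using \<rho>(2) by blast
    ultimately show ?thesis unfolding r(1) using \<rho>(2) by auto
  qed
  with \<rho>(1) r(2) show ?thesis unfolding is_outward_normal_def by blast
qed

text \<open>The normal is locally constant on the set of flat boundary points, and this set is relatively open in
  the closed boundary.\<close>

lemma outward_normal_borel:
  fixes S :: "'a::euclidean_space set"
  assumes S: "open S"
  shows "outward_normal S \<in> borel_measurable borel"
proof -
  define G where "G = {x. \<exists>n. is_outward_normal S x n}"
  have "\<exists>n r. 0 < r \<and> (\<forall>y\<in>ball x r \<inter> frontier S. is_outward_normal S y n)" if x: "x \<in> G" for x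
  proof -
    obtain n where n: "is_outward_normal S x n" using x by (auto simp: G_def)
    then obtain r where "0 < r" "S \<inter> ball x r = {y \<in> ball x r. (y - x) \<bullet> n < 0}" "norm n = 1"
      by (auto simp: is_outward_normal_def)
    with is_outward_normal_nearby[OF S this(2,3)] show ?thesis by blast
  qed
  then obtain n r where r: "\<And>x. x \<in> G \<Longrightarrow> 0 < r x"
      and n: "\<And>x y. x \<in> G \<Longrightarrow> y \<in> ball x (r x) \<inter> frontier S \<Longrightarrow> is_outward_normal S y (n x)"
    by metis
  have G_fr: "G \<subseteq> frontier S" using is_outward_normal_frontier[OF S] by (auto simp: G_def)
  have "G = frontier S \<inter> (\<Union>x\<in>G. ball x (r x))"
  proof
    show "G \<subseteq> frontier S \<inter> (\<Union>x\<in>G. ball x (r x))" using G_fr r by auto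
    show "frontier S \<inter> (\<Union>x\<in>G. ball x (r x)) \<subseteq> G"
    proof
      fix y assume "y \<in> frontier S \<inter> (\<Union>x\<in>G. ball x (r x))"
      then obtain x where "x \<in> G" "y \<in> ball x (r x) \<inter> frontier S" by blast
      from n[OF this] show "y \<in> G" unfolding G_def by blast
    qed
  qed
  moreover have "frontier S \<inter> (\<Union>x\<in>G. ball x (r x)) \<in> sets borel"
    by (intro sets.Int borel_open borel_closed open_UN) auto
  ultimately have G: "G \<in> sets borel" by simp
  have "continuous_on G (outward_normal S)"
    unfolding continuous_on_eq_continuous_within
  proof
    fix x assume x: "x \<in> G"
    have eq: "outward_normal S y = n x" if "y \<in> G" "y \<in> ball x (r x)" for y
      using n[OF x, of y] that G_fr by (auto intro: outward_normal_eq)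
    show "continuous (at x within G) (outward_normal S)"
    proof (rule continuous_transform_within[where f = "\<lambda>_. n x" and \<delta> = "r x"])
      show "\<And>y. y \<in> G \<Longrightarrow> dist y x < r x \<Longrightarrow> n x = outward_normal S y"
        using eq by (simp add: dist_commute)
    qed (use x r in auto)
  qed
  then have "(\<lambda>x. indicator G x *\<^sub>R outward_normal S x) \<in> borel_measurable borel"
    by (rule borel_measurable_continuous_on_indicator[OF G])
  also have "(\<lambda>x. indicator G x *\<^sub>R outward_normal S x) = outward_normal S"
    by (auto simp: G_def indicator_def outward_normal_def fun_eq_iff)
  finally show ?thesis .
qed

section \<open>Normal traces of piecewise polynomial fields\<close>

lemma piecewise_polynomial_limit:
  fixes S :: "(real^'n) set" and v :: "real^'n \<Rightarrow> 'b::euclidean_space"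
  assumes \<T>: "spatial_partition S \<T>" "E \<in> \<T>" "x \<in> E"
    and p: "polynomial_function p" "\<forall>x\<in>rel_interior E. v x = p x"
  shows "(v \<longlongrightarrow> p x) (at x within interior E)"
proof -
  have "(p \<longlongrightarrow> p x) (at x within interior E)"
    using continuous_polymonial_function[OF p(1), of x]
    by (meson continuous_at continuous_at_imp_continuous_at_within continuous_within)
  moreover have "\<forall>\<^sub>F y in at x within interior E. p y = v y"
    using p(2) spatial_partition_element(3)[OF \<T>(1,2)] by (auto simp: eventually_at_filter)
  ultimately show ?thesis by (rule Lim_transform_eventually)
qed

lemma element_nontrivial_limit:
  fixes S :: "(real^'n) set"
  assumes "spatial_partition S \<T>" "E \<in> \<T>" "x \<in> E"
  shows "at x within interior E \<noteq> bot"
  using assms spatial_partition_element(5)[OF assms(1,2)] by (intro closure_open_nontrivial_limit) auto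

lemma normal_trace_eq:
  fixes P :: "'n::finite problem"
  assumes \<T>: "spatial_partition (sub P i) (mesh D i)" and E: "E \<in> mesh D i" "x \<in> E"
    and uniq: "\<And>F. F \<in> mesh D i \<Longrightarrow> x \<in> F \<Longrightarrow> F = E"
    and lim: "(v \<longlongrightarrow> l) (at x within interior E)"
  shows "normal_trace P D i v x = l \<bullet> outward_normal (sub P i) x"
proof -
  have "\<exists>!E. E \<in> mesh D i \<and> x \<in> E" using E uniq by blast
  moreover have "(THE E. E \<in> mesh D i \<and> x \<in> E) = E" using E uniq by (intro the_equality) blast+
  moreover have "Lim (at x within interior E) v = l"
    using element_nontrivial_limit[OF \<T> E] lim by (rule tendsto_Lim)
  ultimately show ?thesis by (simp add: normal_trace_def)
qed

lemma piecewise_polynomial_limit_exists: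
  fixes S :: "(real^'n) set" and v :: "real^'n \<Rightarrow> 'b::euclidean_space"
  assumes \<T>: "spatial_partition S \<T>" "E \<in> \<T>" "x \<in> E" and v: "piecewise_polynomial \<T> v"
  shows "\<exists>l. (v \<longlongrightarrow> l) (at x within interior E)"
  using v \<T>(2) piecewise_polynomial_limit[OF \<T>] unfolding piecewise_polynomial_def by blast

text \<open>Linearity holds because the one-sided limits exist for piecewise polynomials.\<close>

lemma normal_trace_lincomb:
  fixes P :: "'n::finite problem"
  assumes \<T>: "spatial_partition (sub P i) (mesh D i)"
    and v: "\<And>j. j \<in> J \<Longrightarrow> piecewise_polynomial (mesh D i) (v j)"
  shows "normal_trace P D i (\<lambda>x. \<Sum>j\<in>J. c j *\<^sub>R v j x) x = (\<Sum>j\<in>J. c j * normal_trace P D i (v j) x)"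
proof (cases "\<exists>!E. E \<in> mesh D i \<and> x \<in> E")
  case True
  then obtain E where E: "E \<in> mesh D i" "x \<in> E" and uniq: "\<And>F. F \<in> mesh D i \<Longrightarrow> x \<in> F \<Longrightarrow> F = E"
    by blast
  have "\<forall>j\<in>J. \<exists>l. (v j \<longlongrightarrow> l) (at x within interior E)"
    using piecewise_polynomial_limit_exists[OF \<T> E v] by blast
  then obtain l where l: "\<And>j. j \<in> J \<Longrightarrow> (v j \<longlongrightarrow> l j) (at x within interior E)" by metis
  have "((\<lambda>x. \<Sum>j\<in>J. c j *\<^sub>R v j x) \<longlongrightarrow> (\<Sum>j\<in>J. c j *\<^sub>R l j)) (at x within interior E)"
    using l by (intro tendsto_sum tendsto_scaleR tendsto_const)
  from normal_trace_eq[OF \<T> E uniq this] show ?thesis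
    using normal_trace_eq[OF \<T> E uniq l] by (simp add: inner_sum_left)
next
  case False
  then have "normal_trace P D i w x = 0" for w by (simp add: normal_trace_def)
  then show ?thesis by simp
qed

lemma normal_trace_borel_bounded:
  fixes P :: "'n::finite problem"
  assumes \<T>: "spatial_partition (sub P i) (mesh D i)" and S: "open (sub P i)"
    and v: "piecewise_polynomial (mesh D i) v"
  shows "normal_trace P D i v \<in> borel_measurable borel" "\<exists>B. \<forall>x. \<bar>normal_trace P D i v x\<bar> \<le> B"
proof -
  let ?\<T> = "mesh D i" and ?n = "outward_normal (sub P i)"
  have fin: "finite ?\<T>" using \<T> by (simp add: spatial_partition_def)
  have "\<forall>E\<in>?\<T>. \<exists>p. polynomial_function p \<and> (\<forall>x\<in>rel_interior E. v x = p x)"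
    using v by (simp add: piecewise_polynomial_def)
  then obtain p where p: "\<And>E. E \<in> ?\<T> \<Longrightarrow> polynomial_function (p E)"
    "\<And>E. E \<in> ?\<T> \<Longrightarrow> \<forall>x\<in>rel_interior E. v x = p E x" by metis
  define A where "A E = E - \<Union>(?\<T> - {E})" for E
  have eq: "normal_trace P D i v x = (\<Sum>E\<in>?\<T>. indicator (A E) x * (p E x \<bullet> ?n x))" for x
  proof (cases "\<exists>!E. E \<in> ?\<T> \<and> x \<in> E")
    case True
    then obtain E where E: "E \<in> ?\<T>" "x \<in> E" and uniq: "\<And>F. F \<in> ?\<T> \<Longrightarrow> x \<in> F \<Longrightarrow> F = E" by blast
    have "(\<Sum>F\<in>?\<T>. indicator (A F) x * (p F x \<bullet> ?n x)) = (\<Sum>F\<in>?\<T>. if F = E then p E x \<bullet> ?n x else 0)"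
    proof (rule sum.cong)
      fix F assume F: "F \<in> ?\<T>"
      have "x \<in> A F \<longleftrightarrow> F = E" using E uniq F unfolding A_def by blast
      then show "indicator (A F) x * (p F x \<bullet> ?n x) = (if F = E then p E x \<bullet> ?n x else 0)"
        by (cases "F = E") auto
    qed simp
    also have "\<dots> = p E x \<bullet> ?n x" using E fin by simp
    also have "\<dots> = normal_trace P D i v x"
      using normal_trace_eq[OF \<T> E uniq piecewise_polynomial_limit[OF \<T> E p(1,2)]] E(1) by simp
    finally show ?thesis by simp
  next
    case False
    then have "x \<notin> A E" if "E \<in> ?\<T>" for E using that by (auto simp: A_def)
    then show ?thesis using False by (simp add: normal_trace_def)
  qed
  have closed: "closed E" if "E \<in> ?\<T>" for E using spatial_partition_element(4)[OF \<T> that] .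
  have A: "A E \<in> sets borel" if "E \<in> ?\<T>" for E
    unfolding A_def using fin that closed by (intro sets.Diff borel_closed closed_Union) auto
  have pc: "continuous_on UNIV (p E)" if "E \<in> ?\<T>" for E
    using continuous_polymonial_function[OF p(1)[OF that]] by (simp add: continuous_at_imp_continuous_on)
  show "normal_trace P D i v \<in> borel_measurable borel"
    unfolding eq[abs_def]
    by (intro borel_measurable_sum borel_measurable_times borel_measurable_indicator
        borel_measurable_inner borel_measurable_continuous_onI[OF pc] outward_normal_borel[OF S] A)
  have "\<exists>B. \<forall>x\<in>E. norm (p E x) \<le> B" if E: "E \<in> ?\<T>" for E
  proof -
    have "compact E" using spatial_partition_element(1)[OF \<T> E] by (rule polytope_imp_compact)
    then have "bounded (p E ` E)"
      using pc[OF E] by (intro compact_imp_bounded compact_continuous_image) (auto intro: continuous_on_subset)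
    then show ?thesis by (auto simp: bounded_iff)
  qed
  then obtain B where B: "\<And>E x. E \<in> ?\<T> \<Longrightarrow> x \<in> E \<Longrightarrow> norm (p E x) \<le> B E" by metis
  have "\<bar>normal_trace P D i v x\<bar> \<le> (\<Sum>E\<in>?\<T>. \<bar>B E\<bar>)" for x
  proof -
    have "\<bar>normal_trace P D i v x\<bar> \<le> (\<Sum>E\<in>?\<T>. \<bar>indicator (A E) x * (p E x \<bullet> ?n x)\<bar>)"
      unfolding eq by (rule sum_abs)
    also have "\<dots> \<le> (\<Sum>E\<in>?\<T>. \<bar>B E\<bar>)"
    proof (rule sum_mono)
      fix E assume E: "E \<in> ?\<T>"
      show "\<bar>indicator (A E) x * (p E x \<bullet> ?n x)\<bar> \<le> \<bar>B E\<bar>"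
      proof (cases "x \<in> A E")
        case True
        have "\<bar>p E x \<bullet> ?n x\<bar> \<le> norm (p E x) * norm (?n x)" by (rule Cauchy_Schwarz_ineq2)
        also have "\<dots> \<le> B E * 1"
          using True B[OF E, of x] norm_outward_normal_le by (intro mult_mono) (auto simp: A_def intro: order_trans[OF norm_ge_zero])
        finally show ?thesis using True by simp
      qed simp
    qed
    finally show ?thesis .
  qed
  then show "\<exists>B. \<forall>x. \<bar>normal_trace P D i v x\<bar> \<le> B" by blast
qed

lemma sets_surface_measure_borel: "A \<in> sets borel \<Longrightarrow> A \<in> sets surface_measure"
  using subsetD[OF sets_surface_measure] .

lemma normal_trace_L2:
  fixes P :: "'n::finite problem"
  assumes card: "CARD('n) \<ge> 2" and \<T>: "spatial_partition (sub P i) (mesh D i)"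
    and S: "polytopal_lipschitz_domain (sub P i)"
    and v: "piecewise_polynomial (mesh D i) v"
    and A: "A \<in> sets borel" "A \<subseteq> frontier (sub P i)"
  shows "normal_trace P D i v \<in> L2 (surface_on A)"
proof -
  have oS: "open (sub P i)" "lipschitz_boundary (sub P i)" "bounded (sub P i)"
    using S by (auto simp: polytopal_lipschitz_domain_def)
  have As: "A \<in> sets surface_measure" using A(1) by (rule sets_surface_measure_borel)
  have "emeasure surface_measure A \<le> emeasure surface_measure (frontier (sub P i))"
    using A(2) by (intro emeasure_mono sets_surface_measure_borel borel_closed) auto
  also have "\<dots> < \<infinity>" using surface_frontier_finite[OF card \<T> oS] .
  finally have "emeasure (surface_on A) (space (surface_on A)) < \<infinity>"
    using As by (simp add: surface_on_def emeasure_restrict_space space_restrict_space)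
  then interpret finite_measure "surface_on A" by (intro finite_measureI) simp
  obtain B where B: "\<And>x. \<bar>normal_trace P D i v x\<bar> \<le> B"
    using normal_trace_borel_bounded(2)[OF \<T> oS(1) v] by blast
  have meas: "normal_trace P D i v \<in> borel_measurable (surface_on A)"
    using normal_trace_borel_bounded(1)[OF \<T> oS(1) v] by (rule borel_measurable_surface)
  have "(\<bar>normal_trace P D i v x\<bar>)\<^sup>2 \<le> B\<^sup>2" for x using B[of x] by (intro power_mono) auto
  then have "integrable (surface_on A) (\<lambda>x. (norm (normal_trace P D i v x))\<^sup>2)"
    using meas by (intro integrable_const_bound[where B = "B\<^sup>2"]) auto
  with meas show ?thesis by (simp add: L2_def)
qed

text \<open>The trace depends only on the almost-everywhere class: a polynomial that vanishes almost everywhere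
  in an element vanishes there by continuity.\<close>

lemma normal_trace_AE_zero:
  fixes P :: "'n::finite problem"
  assumes \<T>: "spatial_partition (sub P i) (mesh D i)" and S: "polytopal_lipschitz_domain (sub P i)"
    and v: "piecewise_polynomial (mesh D i) v" and zero: "AE x in lebesgue_on (sub P i). v x = 0"
  shows "normal_trace P D i v x = 0"
proof (cases "\<exists>!E. E \<in> mesh D i \<and> x \<in> E")
  case True
  then obtain E where E: "E \<in> mesh D i" "x \<in> E" and uniq: "\<And>F. F \<in> mesh D i \<Longrightarrow> x \<in> F \<Longrightarrow> F = E" by blast
  obtain p where p: "polynomial_function p" "\<forall>x\<in>rel_interior E. v x = p x"
    using v E(1) by (auto simp: piecewise_polynomial_def)
  have oS: "open (sub P i)" "lipschitz_boundary (sub P i)" using S by (auto simp: polytopal_lipschitz_domain_def)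
  have sub: "interior E \<subseteq> sub P i" using spatial_partition_frontier(2)[OF \<T> oS E(1)] .
  have pc: "continuous_on UNIV p"
    using continuous_polymonial_function[OF p(1)] by (simp add: continuous_at_imp_continuous_on)
  define W where "W = interior E \<inter> {y. p y \<noteq> 0}"
  have oW: "open W" unfolding W_def using pc by (intro open_Int open_Collect_neq) auto
  have "AE y in lebesgue. y \<in> sub P i \<longrightarrow> v y = 0"
    using zero oS(1) by (simp add: AE_restrict_space_iff)
  then have "AE y in lebesgue. y \<notin> W"
  proof eventually_elim
    case (elim y)
    then show ?case using sub p(2) spatial_partition_element(3)[OF \<T> E(1)] by (auto simp: W_def)
  qed
  then have "W \<in> null_sets lebesgue"
    using oW by (intro AE_iff_null_sets[THEN iffD2]) auto
  then have "negligible W" by (simp add: negligible_iff_null_sets)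
  then have "W = {}" using oW open_not_negligible by blast
  then have v0: "v y = 0" if "y \<in> interior E" for y
    using that p(2) spatial_partition_element(3)[OF \<T> E(1)] by (auto simp: W_def)
  have "((\<lambda>_. 0) \<longlongrightarrow> 0) (at x within interior E)" by simp
  moreover have "\<forall>\<^sub>F y in at x within interior E. 0 = v y"
    using v0 by (simp add: eventually_at_filter)
  ultimately have "(v \<longlongrightarrow> 0) (at x within interior E)" by (rule Lim_transform_eventually)
  from normal_trace_eq[OF \<T> E uniq this] show ?thesis by simp
qed (simp add: normal_trace_def)

section \<open>Saddle point systems\<close>

text \<open>The system is square, so uniqueness suffices.  Testing the homogeneous equations with \<open>u\<close> and \<open>p\<close>
  cancels the coupling through \<open>B\<close>; the remaining sum of nonnegative terms forces \<open>u = 0\<close>, after which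
  the second equation and the nondegeneracy of \<open>C\<close> give \<open>p = 0\<close>.\<close>

lemma saddle_point_system_solvable:
  fixes A B C :: "nat \<Rightarrow> nat \<Rightarrow> real" and F :: "nat \<Rightarrow> nat \<Rightarrow> real"
  assumes A: "\<And>c. 0 \<le> (\<Sum>i<n. \<Sum>j<n. A i j * (c i * c j))"
      "\<And>c. (\<Sum>i<n. \<Sum>j<n. A i j * (c i * c j)) = 0 \<Longrightarrow> \<forall>i<n. c i = 0"
    and C: "\<And>c. 0 \<le> (\<Sum>r<R. \<Sum>s<R. C r s * (c r * c s))"
      "\<And>c. (\<And>s. s < R \<Longrightarrow> (\<Sum>r<R. C r s * c r) = 0) \<Longrightarrow> \<forall>r<R. c r = 0"
  shows "\<exists>u p. (\<forall>j<n. \<forall>s<R. (\<Sum>i<n. A i j * u i s) + (\<Sum>l<m. B j l * p l s) = F j s) \<and>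
               (\<forall>l<m. \<forall>s<R. (\<Sum>r<R. C r s * p l r) - (\<Sum>j<n. B j l * u j s) = 0)"
proof -
  define I where "I = ({..<n} \<times> {..<R}) <+> ({..<m} \<times> {..<R})"
  define M where "M a b = (case a of
      Inl (j, s) \<Rightarrow> (case b of Inl (i, r) \<Rightarrow> if r = s then A i j else 0 | Inr (l, r) \<Rightarrow> if r = s then B j l else 0)
    | Inr (l, s) \<Rightarrow> (case b of Inl (j, r) \<Rightarrow> if r = s then - B j l else 0 | Inr (l', r) \<Rightarrow> if l' = l then C r s else 0))"
    for a b :: "(nat \<times> nat) + (nat \<times> nat)"
  have finI: "finite I" by (simp add: I_def)
  have sumI: "(\<Sum>b\<in>I. f b) = (\<Sum>i<n. \<Sum>r<R. f (Inl (i, r))) + (\<Sum>l<m. \<Sum>r<R. f (Inr (l, r)))" for f :: "_ \<Rightarrow> real"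
    by (simp add: I_def sum.Plus sum.cartesian_product)
  have row1: "(\<Sum>b\<in>I. M (Inl (j, s)) b * c b)
      = (\<Sum>i<n. A i j * c (Inl (i, s))) + (\<Sum>l<m. B j l * c (Inr (l, s)))" if "s < R" for j s c
  proof -
    have "(\<Sum>r<R. (if r = s then A i j else 0) * c (Inl (i, r))) = A i j * c (Inl (i, s))" for i
      using that by (simp add: if_distrib[where f = "\<lambda>x. x * _"] cong: if_cong)
    moreover have "(\<Sum>r<R. (if r = s then B j l else 0) * c (Inr (l, r))) = B j l * c (Inr (l, s))" for l
      using that by (simp add: if_distrib[where f = "\<lambda>x. x * _"] cong: if_cong)
    ultimately show ?thesis by (simp add: sumI M_def)
  qed
  have row2: "(\<Sum>b\<in>I. M (Inr (l, s)) b * c b)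
      = (\<Sum>r<R. C r s * c (Inr (l, r))) - (\<Sum>j<n. B j l * c (Inl (j, s)))" if "s < R" "l < m" for l s c
  proof -
    have "(\<Sum>r<R. (if r = s then - B j l else 0) * c (Inl (j, r))) = - (B j l * c (Inl (j, s)))" for j
      using that by (simp add: if_distrib[where f = "\<lambda>x. x * _"] cong: if_cong)
    moreover have "(\<Sum>r<R. (if l' = l then C r s else 0) * c (Inr (l', r)))
        = (if l' = l then (\<Sum>r<R. C r s * c (Inr (l, r))) else 0)" for l'
      by simp
    ultimately show ?thesis using that by (simp add: sumI M_def sum_negf)
  qed
  have "\<exists>c. \<forall>a\<in>I. (\<Sum>b\<in>I. M a b * c b) = (case a of Inl (j, s) \<Rightarrow> F j s | Inr _ \<Rightarrow> 0)"
  proof (rule injective_square_system_solvable[OF finI])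
    fix c assume hom: "\<And>a. a \<in> I \<Longrightarrow> (\<Sum>b\<in>I. M a b * c b) = 0"
    define u where "u i s = c (Inl (i, s))" for i s
    define p where "p l s = c (Inr (l, s))" for l s
    have e1: "(\<Sum>i<n. A i j * u i s) + (\<Sum>l<m. B j l * p l s) = 0" if "j < n" "s < R" for j s
      using hom[of "Inl (j, s)"] row1[OF that(2)] that by (auto simp: I_def u_def p_def)
    have e2: "(\<Sum>r<R. C r s * p l r) - (\<Sum>j<n. B j l * u j s) = 0" if "l < m" "s < R" for l s
      using hom[of "Inr (l, s)"] row2[OF that(2,1)] that by (auto simp: I_def u_def p_def)
    let ?a = "\<lambda>s. \<Sum>i<n. \<Sum>j<n. A i j * (u i s * u j s)"
    let ?c = "\<lambda>l. \<Sum>r<R. \<Sum>s<R. C r s * (p l r * p l s)"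
    let ?b = "\<lambda>s. \<Sum>j<n. \<Sum>l<m. B j l * (u j s * p l s)"
    have a: "?a s = - ?b s" if "s < R" for s
    proof -
      have "?a s = (\<Sum>j<n. u j s * (\<Sum>i<n. A i j * u i s))"
        by (subst sum.swap) (simp add: sum_distrib_left mult_ac)
      also have "\<dots> = (\<Sum>j<n. u j s * (- (\<Sum>l<m. B j l * p l s)))"
        using e1[OF _ that] by (intro sum.cong refl arg_cong2[of _ _ _ _ "(*)"]) (simp add: eq_neg_iff_add_eq_0)
      finally show ?thesis by (simp add: sum_negf sum_distrib_left mult_ac)
    qed
    have c: "(\<Sum>l<m. ?c l) = (\<Sum>s<R. ?b s)"
    proof -
      have "?c l = (\<Sum>s<R. \<Sum>j<n. B j l * (u j s * p l s))" if "l < m" for l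
      proof -
        have "?c l = (\<Sum>s<R. p l s * (\<Sum>r<R. C r s * p l r))"
          by (subst sum.swap) (simp add: sum_distrib_left mult_ac)
        also have "\<dots> = (\<Sum>s<R. p l s * (\<Sum>j<n. B j l * u j s))"
          using right_minus_eq[THEN iffD1, OF e2[OF that]] by simp
        finally show ?thesis by (simp add: sum_distrib_left mult_ac)
      qed
      then have "(\<Sum>l<m. ?c l) = (\<Sum>l<m. \<Sum>s<R. \<Sum>j<n. B j l * (u j s * p l s))" by simp
      also have "\<dots> = (\<Sum>s<R. \<Sum>l<m. \<Sum>j<n. B j l * (u j s * p l s))" by (rule sum.swap)
      also have "\<dots> = (\<Sum>s<R. ?b s)" by (intro sum.cong refl sum.swap)
      finally show ?thesis .
    qed
    have "(\<Sum>s<R. ?a s) + (\<Sum>l<m. ?c l) = 0" using a c by (simp add: sum_negf)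
    moreover have "0 \<le> (\<Sum>l<m. ?c l)" by (rule sum_nonneg) (rule C(1))
    moreover have "0 \<le> (\<Sum>s<R. ?a s)" by (rule sum_nonneg) (rule A(1))
    ultimately have "(\<Sum>s<R. ?a s) = 0" by linarith
    then have "\<forall>s\<in>{..<R}. ?a s = 0"
      using A(1)[of "\<lambda>i. u i _"] by (subst (asm) sum_nonneg_eq_0_iff) auto
    then have u0: "u i s = 0" if "i < n" "s < R" for i s
      using A(2)[of "\<lambda>i. u i s"] that by auto
    have p0: "p l s = 0" if "l < m" "s < R" for l s
    proof -
      have "(\<Sum>r<R. C r s * p l r) = 0" if "s < R" for s
        using e2[OF \<open>l < m\<close> that] u0[OF _ that] by simp
      then show ?thesis using C(2)[of "p l"] that by auto
    qed
    show "\<forall>b\<in>I. c b = 0" using u0 p0 by (auto simp: I_def u_def p_def)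
  qed
  then obtain c where c: "\<And>a. a \<in> I \<Longrightarrow> (\<Sum>b\<in>I. M a b * c b) = (case a of Inl (j, s) \<Rightarrow> F j s | Inr _ \<Rightarrow> 0)"
    by blast
  show ?thesis
  proof (intro exI conjI allI impI)
    fix j s assume js: "j < n" "s < R"
    show "(\<Sum>i<n. A i j * c (Inl (i, s))) + (\<Sum>l<m. B j l * c (Inr (l, s))) = F j s"
      using c[of "Inl (j, s)"] row1[OF js(2)] js by (auto simp: I_def)
  next
    fix l s assume ls: "l < m" "s < R"
    show "(\<Sum>r<R. C r s * c (Inr (l, r))) - (\<Sum>j<n. B j l * c (Inl (j, s))) = 0"
      using c[of "Inr (l, s)"] row2[OF ls(2,1)] ls by (auto simp: I_def)
  qed
qed

section \<open>The scalar discontinuous Galerkin form\<close>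

lemma poly_AE_zero_on_interval:
  fixes p :: "real poly"
  assumes "a < b" "AE s in lebesgue_on {a<..<b}. poly p s = 0"
  shows "p = 0"
proof (rule ccontr)
  assume "p \<noteq> 0"
  then have fin: "finite {s. poly p s = 0}" by (rule poly_roots_finite)
  have "AE s in lebesgue. s \<in> {a<..<b} \<longrightarrow> poly p s = 0"
    using assms(2) by (simp add: AE_restrict_space_iff)
  moreover have "AE s in lebesgue. s \<notin> {s. poly p s = 0}"
  proof (rule AE_not_in)
    have "negligible {s. poly p s = 0}" using fin by (rule negligible_finite)
    then show "{s. poly p s = 0} \<in> null_sets lebesgue" by (simp add: negligible_iff_null_sets)
  qed
  ultimately have "AE s in lebesgue. s \<notin> {a<..<b}" by eventually_elim auto
  then have "{a<..<b} \<in> null_sets lebesgue" by (intro AE_iff_null_sets[THEN iffD2]) auto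
  then have "negligible {a<..<b}" by (simp add: negligible_iff_null_sets)
  then show False using open_not_negligible[of "{a<..<b}"] assms(1) by auto
qed

lemma continuous_integrable_open_interval:
  fixes f :: "real \<Rightarrow> real"
  assumes "continuous_on UNIV f"
  shows "integrable (lebesgue_on {a<..<b}) f"
proof -
  have "integrable (lebesgue_on {a..b}) f"
    using assms by (intro continuous_imp_integrable_real) (auto intro: continuous_on_subset)
  then have "set_integrable lebesgue {a..b} f"
    by (simp add: integrable_restrict_space set_integrable_def)
  then have "set_integrable lebesgue {a<..<b} f" by (rule set_integrable_subset) auto
  then show ?thesis by (simp add: integrable_restrict_space set_integrable_def)
qed

lemma poly_FTC_open_interval:
  fixes p :: "real poly"
  assumes "a \<le> b"
  shows "(LINT s|lebesgue_on {a<..<b}. poly (pderiv p) s) = poly p b - poly p a"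
proof -
  have "(LINT s|lebesgue_on {a<..<b}. poly (pderiv p) s) = integral {a<..<b} (poly (pderiv p))"
    by (intro lebesgue_integral_eq_integral continuous_integrable_open_interval) (auto intro!: continuous_intros)
  also have "\<dots> = integral {a..b} (poly (pderiv p))" by (simp add: integral_open_interval_real)
  also have "\<dots> = poly p b - poly p a"
  proof (rule integral_unique, rule fundamental_theorem_of_calculus[OF assms])
    fix s
    have "(poly p has_real_derivative poly (pderiv p) s) (at s within {a..b})"
      using poly_DERIV by (rule has_field_derivative_at_within)
    then show "(poly p has_vector_derivative poly (pderiv p) s) (at s within {a..b})"
      by (simp add: has_real_derivative_iff_has_vector_derivative)
  qed
  finally show ?thesis .
qed

definition dg_polys :: "nat \<Rightarrow> nat \<Rightarrow> (nat \<Rightarrow> real) \<Rightarrow> (nat \<Rightarrow> real poly) \<Rightarrow> (real \<Rightarrow> real) \<Rightarrow> bool" where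
  "dg_polys q N t p \<phi> \<longleftrightarrow> (\<forall>k<N. degree (p k) \<le> q \<and> (\<forall>s\<in>{t k<..<t (Suc k)}. \<phi> s = poly (p k) s))"

text \<open>The discontinuous Galerkin time derivative with zero initial value, tested with \<open>w\<close>, for functions of
  time alone.\<close>

definition scalar_dg_form :: "nat \<Rightarrow> (nat \<Rightarrow> real) \<Rightarrow> (real \<Rightarrow> real) \<Rightarrow> (real \<Rightarrow> real) \<Rightarrow> real" where
  "scalar_dg_form N t \<phi> w =
     (\<Sum>k=1..N. LINT s|lebesgue_on {t (k - 1)<..<t k}. deriv \<phi> s * w s) +
     (\<Sum>k=1..N. (Lim (at_right (t (k - 1))) \<phi> - (if k - 1 = 0 then 0 else Lim (at_left (t (k - 1))) \<phi>))
        * Lim (at_right (t (k - 1))) w)"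

definition poly_left_val :: "(nat \<Rightarrow> real) \<Rightarrow> (nat \<Rightarrow> real poly) \<Rightarrow> nat \<Rightarrow> real" where
  "poly_left_val t p k = (if k = 0 then 0 else poly (p (k - 1)) (t k))"

lemma dg_space_polys: "\<phi> \<in> dg_space q N t \<longleftrightarrow> (\<exists>p. dg_polys q N t p \<phi>)"
  unfolding dg_space_def dg_polys_def mem_Collect_eq by metis

lemma dg_polys_right_lim:
  assumes t: "time_partition T N t" and p: "dg_polys q N t p \<phi>" and k: "k < N"
  shows "(\<phi> \<longlongrightarrow> poly (p k) (t k)) (at_right (t k))"
proof -
  have lt: "t k < t (Suc k)" using t k by (simp add: time_partition_def)
  have "(poly (p k) \<longlongrightarrow> poly (p k) (t k)) (at_right (t k))"
    by (intro tendsto_within_subset[OF poly_isCont[unfolded isCont_def]]) auto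
  moreover have "\<forall>\<^sub>F s in at_right (t k). poly (p k) s = \<phi> s"
    using p k lt unfolding dg_polys_def eventually_at_right[OF lt] by (intro exI[of _ "t (Suc k)"]) auto
  ultimately show ?thesis by (rule Lim_transform_eventually)
qed

lemma dg_polys_left_lim:
  assumes t: "time_partition T N t" and p: "dg_polys q N t p \<phi>" and k: "k < N"
  shows "(\<phi> \<longlongrightarrow> poly (p k) (t (Suc k))) (at_left (t (Suc k)))"
proof -
  have lt: "t k < t (Suc k)" using t k by (simp add: time_partition_def)
  have "(poly (p k) \<longlongrightarrow> poly (p k) (t (Suc k))) (at_left (t (Suc k)))"
    by (intro tendsto_within_subset[OF poly_isCont[unfolded isCont_def]]) auto
  moreover have "\<forall>\<^sub>F s in at_left (t (Suc k)). poly (p k) s = \<phi> s"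
    using p k lt unfolding dg_polys_def eventually_at_left[OF lt] by (intro exI[of _ "t k"]) auto
  ultimately show ?thesis by (rule Lim_transform_eventually)
qed

lemma dg_polys_deriv:
  assumes p: "dg_polys q N t p \<phi>" and k: "k < N" and s: "s \<in> {t k<..<t (Suc k)}"
  shows "(\<phi> has_real_derivative poly (pderiv (p k)) s) (at s)" "deriv \<phi> s = poly (pderiv (p k)) s"
proof -
  have "(poly (p k) has_real_derivative poly (pderiv (p k)) s) (at s)" by (rule poly_DERIV)
  then show d: "(\<phi> has_real_derivative poly (pderiv (p k)) s) (at s)"
    by (rule has_field_derivative_transform_within_open[where S = "{t k<..<t (Suc k)}"])
      (use p k s in \<open>auto simp: dg_polys_def\<close>)
  then show "deriv \<phi> s = poly (pderiv (p k)) s" by (rule DERIV_imp_deriv)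
qed

lemma dg_polys_lims:
  assumes t: "time_partition T N t" and p: "dg_polys q N t p \<phi>" and k: "k < N"
  shows "Lim (at_right (t k)) \<phi> = poly (p k) (t k)"
    "(if k = 0 then 0 else Lim (at_left (t k)) \<phi>) = poly_left_val t p k"
proof -
  show "Lim (at_right (t k)) \<phi> = poly (p k) (t k)"
    using dg_polys_right_lim[OF t p k] by (intro tendsto_Lim) auto
  show "(if k = 0 then 0 else Lim (at_left (t k)) \<phi>) = poly_left_val t p k"
  proof (cases k)
    case (Suc k')
    then have "Lim (at_left (t k)) \<phi> = poly (p k') (t k)"
      using dg_polys_left_lim[OF t p, of k'] k by (intro tendsto_Lim) auto
    with Suc show ?thesis by (simp add: poly_left_val_def)
  qed (simp add: poly_left_val_def)
qed

lemma scalar_dg_form_polys: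
  assumes t: "time_partition T N t" and p: "dg_polys q N t p \<phi>" and r: "dg_polys q N t r w"
  shows "scalar_dg_form N t \<phi> w =
     (\<Sum>k<N. (LINT s|lebesgue_on {t k<..<t (Suc k)}. poly (pderiv (p k)) s * poly (r k) s)
        + (poly (p k) (t k) - poly_left_val t p k) * poly (r k) (t k))"
proof -
  have "(LINT s|lebesgue_on {t k<..<t (Suc k)}. deriv \<phi> s * w s)
      = (LINT s|lebesgue_on {t k<..<t (Suc k)}. poly (pderiv (p k)) s * poly (r k) s)" if "k < N" for k
    using dg_polys_deriv(2)[OF p that] r that
    by (intro Bochner_Integration.integral_cong) (auto simp: dg_polys_def)
  then show ?thesis
    unfolding scalar_dg_form_def
    by (simp add: sum.atLeast1_atMost_eq sum.distrib dg_polys_lims[OF t p] dg_polys_lims(1)[OF t r] cong: if_cong)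
qed

text \<open>On each step, \<open>2 \<integral> p' p\<close> is the difference of the squared end values, and the jump term is completed
  to a square; the differences of the squared left values then telescope.\<close>

lemma scalar_dg_form_energy:
  assumes t: "time_partition T N t" and p: "dg_polys q N t p \<phi>"
  shows "2 * scalar_dg_form N t \<phi> \<phi>
    = (\<Sum>k<N. (poly (p k) (t k) - poly_left_val t p k)\<^sup>2) + (poly_left_val t p N)\<^sup>2"
proof -
  let ?l = "poly_left_val t p"
  have step: "2 * ((LINT s|lebesgue_on {t k<..<t (Suc k)}. poly (pderiv (p k)) s * poly (p k) s)
        + (poly (p k) (t k) - ?l k) * poly (p k) (t k))
     = (poly (p k) (t k) - ?l k)\<^sup>2 + ((?l (Suc k))\<^sup>2 - (?l k)\<^sup>2)" if "k < N" for k
  proof -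
    have le: "t k \<le> t (Suc k)" using t that by (simp add: time_partition_def less_imp_le)
    have "2 * (LINT s|lebesgue_on {t k<..<t (Suc k)}. poly (pderiv (p k)) s * poly (p k) s)
        = (LINT s|lebesgue_on {t k<..<t (Suc k)}. poly (pderiv (p k * p k)) s)"
      by (simp add: pderiv_mult algebra_simps flip: integral_mult_right_zero)
    also have "\<dots> = (poly (p k) (t (Suc k)))\<^sup>2 - (poly (p k) (t k))\<^sup>2"
      using poly_FTC_open_interval[OF le, of "p k * p k"] by (simp add: power2_eq_square)
    finally show ?thesis by (simp add: poly_left_val_def power2_eq_square algebra_simps)
  qed
  have "2 * scalar_dg_form N t \<phi> \<phi> = (\<Sum>k<N. (poly (p k) (t k) - ?l k)\<^sup>2 + ((?l (Suc k))\<^sup>2 - (?l k)\<^sup>2))"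
    unfolding scalar_dg_form_polys[OF t p p] sum_distrib_left using step by (intro sum.cong) auto
  also have "\<dots> = (\<Sum>k<N. (poly (p k) (t k) - ?l k)\<^sup>2) + (\<Sum>k<N. (?l (Suc k))\<^sup>2 - (?l k)\<^sup>2)"
    by (rule sum.distrib)
  also have "(\<Sum>k<N. (?l (Suc k))\<^sup>2 - (?l k)\<^sup>2) = (?l N)\<^sup>2 - (?l 0)\<^sup>2" by (rule sum_lessThan_telescope)
  finally show ?thesis by (simp add: poly_left_val_def)
qed

lemma scalar_dg_form_nonneg:
  assumes t: "time_partition T N t" and \<phi>: "\<phi> \<in> dg_space q N t"
  shows "0 \<le> scalar_dg_form N t \<phi> \<phi>"
proof -
  obtain p where "dg_polys q N t p \<phi>" using \<phi> dg_space_polys by blast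
  from scalar_dg_form_energy[OF t this] have "0 \<le> 2 * scalar_dg_form N t \<phi> \<phi>" by (simp add: sum_nonneg)
  then show ?thesis by simp
qed

text \<open>Testing with \<open>\<phi>\<close> removes all jumps.  Testing with the derivative of \<open>\<phi>\<close>, which is admissible since
  degrees only drop, makes all pieces constant.  Starting from the initial value zero, the constants
  vanish one after the other.\<close>

lemma scalar_dg_form_nondegenerate:
  assumes t: "time_partition T N t" and p: "dg_polys q N t p \<phi>"
    and zero: "\<And>w. w \<in> dg_space q N t \<Longrightarrow> scalar_dg_form N t \<phi> w = 0"
  shows "\<forall>k<N. p k = 0"
proof -
  have "\<phi> \<in> dg_space q N t" using p dg_space_polys by blast
  then have "(\<Sum>k<N. (poly (p k) (t k) - poly_left_val t p k)\<^sup>2) + (poly_left_val t p N)\<^sup>2 = 0"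
    using scalar_dg_form_energy[OF t p] zero by simp
  moreover have "0 \<le> (\<Sum>k<N. (poly (p k) (t k) - poly_left_val t p k)\<^sup>2)" by (simp add: sum_nonneg)
  ultimately have "(\<Sum>k<N. (poly (p k) (t k) - poly_left_val t p k)\<^sup>2) = 0"
    using zero_le_power2[of "poly_left_val t p N"] by linarith
  then have jump: "poly (p k) (t k) = poly_left_val t p k" if "k < N" for k
    using that by (simp add: sum_nonneg_eq_0_iff)
  have dp: "dg_polys q N t (\<lambda>k. pderiv (p k)) (deriv \<phi>)"
    unfolding dg_polys_def using p dg_polys_deriv(2)[OF p]
    by (auto simp: dg_polys_def degree_pderiv intro: order_trans[OF diff_le_self])
  then have "deriv \<phi> \<in> dg_space q N t" using dg_space_polys by blast
  from zero[OF this] have "(\<Sum>k<N. LINT s|lebesgue_on {t k<..<t (Suc k)}. (poly (pderiv (p k)) s)\<^sup>2) = 0"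
    unfolding scalar_dg_form_polys[OF t p dp] using jump by (simp add: power2_eq_square)
  then have int0: "(LINT s|lebesgue_on {t k<..<t (Suc k)}. (poly (pderiv (p k)) s)\<^sup>2) = 0" if "k < N" for k
    using that by (subst (asm) sum_nonneg_eq_0_iff) auto
  have const: "pderiv (p k) = 0" if "k < N" for k
  proof (rule poly_AE_zero_on_interval)
    show "t k < t (Suc k)" using t that by (simp add: time_partition_def)
    have "integrable (lebesgue_on {t k<..<t (Suc k)}) (\<lambda>s. (poly (pderiv (p k)) s)\<^sup>2)"
      by (intro continuous_integrable_open_interval continuous_intros)
    then have "AE s in lebesgue_on {t k<..<t (Suc k)}. (poly (pderiv (p k)) s)\<^sup>2 = 0"
      using int0[OF that] by (subst (asm) integral_nonneg_eq_0_iff_AE) auto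
    then show "AE s in lebesgue_on {t k<..<t (Suc k)}. poly (pderiv (p k)) s = 0" by simp
  qed
  have "k < N \<Longrightarrow> p k = 0" for k
  proof (induction k)
    case 0
    have "degree (p 0) = 0" using const[OF 0] by (simp add: pderiv_eq_0_iff)
    then obtain c where c: "p 0 = [:c:]" by (rule degree_eq_zeroE)
    then show ?case using jump[OF 0] by (simp add: poly_left_val_def)
  next
    case (Suc k)
    have "degree (p (Suc k)) = 0" using const[OF Suc.prems] by (simp add: pderiv_eq_0_iff)
    then obtain c where c: "p (Suc k) = [:c:]" by (rule degree_eq_zeroE)
    then show ?case using jump[OF Suc.prems] Suc by (simp add: poly_left_val_def)
  qed
  then show ?thesis by blast
qed

lemma time_partition_mono:
  assumes "time_partition T N t" "j \<le> k" "k \<le> N"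
  shows "t j \<le> t k"
  using assms(2,3)
proof (induction k rule: dec_induct)
  case (step k)
  then have "t k < t (Suc k)" using assms(1) by (simp add: time_partition_def)
  with step show ?case by simp
qed simp

lemma time_partition_interval_subset:
  assumes "time_partition T N t" "k < N"
  shows "{t k<..<t (Suc k)} \<subseteq> {0<..<T}"
  using time_partition_mono[OF assms(1), of 0 k] time_partition_mono[OF assms(1), of "Suc k" N] assms
  by (auto simp: time_partition_def)

lemma time_partition_interval_unique:
  assumes t: "time_partition T N t" and jk: "j < N" "k < N" and s: "s \<in> {t j<..<t (Suc j)}" "s \<in> {t k<..<t (Suc k)}"
  shows "j = k"
proof (rule ccontr)
  assume "j \<noteq> k"
  then consider "Suc j \<le> k" | "Suc k \<le> j" by linarith
  then show False
    using time_partition_mono[OF t, of "Suc j" k] time_partition_mono[OF t, of "Suc k" j] jk s by cases auto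
qed

lemma time_partition_AE_interval:
  assumes t: "time_partition T N t"
  shows "AE s in lebesgue_on {0<..<T}. \<exists>k<N. s \<in> {t k<..<t (Suc k)}"
proof -
  have *: "\<exists>k<M. t k < s \<and> s < t (Suc k)" if "t 0 < s" "s < t M" "\<And>j. j \<le> M \<Longrightarrow> s \<noteq> t j" for M s
    using that
  proof (induction M)
    case (Suc M)
    show ?case
    proof (cases "s < t M")
      case True
      then obtain k where "k < M" "t k < s \<and> s < t (Suc k)" using Suc.IH Suc.prems by auto
      then show ?thesis by (intro exI[of _ k]) simp
    next
      case False
      then have "t M < s" using Suc.prems(3)[of M] by simp
      then show ?thesis using Suc.prems(2) by (intro exI[of _ M]) simp
    qed
  qed simp
  have "AE s in lebesgue. s \<notin> t ` {..N}"
  proof (rule AE_not_in)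
    have "negligible (t ` {..N})" by (intro negligible_finite) simp
    then show "t ` {..N} \<in> null_sets lebesgue" by (simp add: negligible_iff_null_sets)
  qed
  then have "AE s in lebesgue. s \<in> {0<..<T} \<longrightarrow> (\<exists>k<N. s \<in> {t k<..<t (Suc k)})"
  proof eventually_elim
    case (elim s)
    show ?case using *[of s N] elim t by (auto simp: time_partition_def)
  qed
  then show ?thesis by (simp add: AE_restrict_space_iff)
qed

lemma dg_polys_lincomb:
  assumes "finite J" "\<And>j. j \<in> J \<Longrightarrow> dg_polys q N t (p j) (\<phi> j)"
  shows "dg_polys q N t (\<lambda>k. \<Sum>j\<in>J. smult (c j) (p j k)) (\<lambda>s. \<Sum>j\<in>J. c j * \<phi> j s)"
  unfolding dg_polys_def
proof (intro allI impI conjI ballI)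
  fix k assume k: "k < N"
  show "degree (\<Sum>j\<in>J. smult (c j) (p j k)) \<le> q"
    using assms k by (intro degree_sum_le) (auto simp: dg_polys_def intro: order_trans[OF degree_smult_le])
  fix s assume "s \<in> {t k<..<t (Suc k)}"
  then have "\<phi> j s = poly (p j k) s" if "j \<in> J" for j using assms(2)[OF that] k by (simp add: dg_polys_def)
  then show "(\<Sum>j\<in>J. c j * \<phi> j s) = poly (\<Sum>j\<in>J. smult (c j) (p j k)) s" by (simp add: poly_sum)
qed

lemma dg_space_lincomb:
  assumes "finite J" "\<And>j. j \<in> J \<Longrightarrow> \<phi> j \<in> dg_space q N t"
  shows "(\<lambda>s. \<Sum>j\<in>J. c j * \<phi> j s) \<in> dg_space q N t"
proof -
  have "\<forall>j\<in>J. \<exists>p. dg_polys q N t p (\<phi> j)" using assms(2) dg_space_polys by blast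
  then obtain p where p: "\<And>j. j \<in> J \<Longrightarrow> dg_polys q N t (p j) (\<phi> j)" by metis
  have "dg_polys q N t (\<lambda>k. \<Sum>j\<in>J. smult (c j) (p j k)) (\<lambda>s. \<Sum>j\<in>J. c j * \<phi> j s)"
    using assms(1) p by (rule dg_polys_lincomb)
  then show ?thesis unfolding dg_space_polys by blast
qed

lemma dg_space_zero: "(\<lambda>s. 0) \<in> dg_space q N t"
  using dg_space_lincomb[of "{}" "\<lambda>_ _. 0" q N t] by simp

text \<open>This makes the form insensitive to the choice of representatives.\<close>

lemma dg_polys_AE_unique:
  assumes t: "time_partition T N t" and p: "dg_polys q N t p \<phi>" and p': "dg_polys q' N t p' \<phi>'"
    and eq: "AE s in lebesgue_on {0<..<T}. \<phi> s = \<phi>' s" and k: "k < N"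
  shows "p k = p' k"
proof -
  have "AE s in lebesgue. s \<in> {0<..<T} \<longrightarrow> \<phi> s = \<phi>' s"
    using eq by (simp add: AE_restrict_space_iff)
  then have "AE s in lebesgue. s \<in> {t k<..<t (Suc k)} \<longrightarrow> poly (p k - p' k) s = 0"
    using time_partition_interval_subset[OF t k]
  proof (elim AE_mp, intro AE_I2 impI)
    fix s assume "s \<in> {0<..<T} \<longrightarrow> \<phi> s = \<phi>' s" "s \<in> {t k<..<t (Suc k)}"
    then show "poly (p k - p' k) s = 0"
      using time_partition_interval_subset[OF t k] p p' k by (auto simp: dg_polys_def subset_iff)
  qed
  then have "AE s in lebesgue_on {t k<..<t (Suc k)}. poly (p k - p' k) s = 0"
    by (simp add: AE_restrict_space_iff)
  then have "p k - p' k = 0"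
    using t k by (intro poly_AE_zero_on_interval) (auto simp: time_partition_def)
  then show ?thesis by simp
qed

lemma scalar_dg_form_lincomb_left:
  assumes t: "time_partition T N t" and J: "finite J" "\<And>j. j \<in> J \<Longrightarrow> \<phi> j \<in> dg_space q N t"
    and \<psi>: "\<psi> \<in> dg_space q N t" "AE s in lebesgue_on {0<..<T}. \<psi> s = (\<Sum>j\<in>J. c j * \<phi> j s)"
    and w: "w \<in> dg_space q N t"
  shows "scalar_dg_form N t \<psi> w = (\<Sum>j\<in>J. c j * scalar_dg_form N t (\<phi> j) w)"
proof -
  have "\<forall>j\<in>J. \<exists>p. dg_polys q N t p (\<phi> j)" using J(2) dg_space_polys by blast
  then obtain p where p: "\<And>j. j \<in> J \<Longrightarrow> dg_polys q N t (p j) (\<phi> j)" by metis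
  obtain r where r: "dg_polys q N t r w" using w dg_space_polys by blast
  obtain p\<psi> where p\<psi>: "dg_polys q N t p\<psi> \<psi>" using \<psi>(1) dg_space_polys by blast
  have eq: "p\<psi> k = (\<Sum>j\<in>J. smult (c j) (p j k))" if "k < N" for k
    using dg_polys_AE_unique[OF t p\<psi> dg_polys_lincomb[OF J(1) p] \<psi>(2) that] .
  have left: "poly_left_val t p\<psi> k = (\<Sum>j\<in>J. c j * poly_left_val t (p j) k)" if "k < N" for k
    using eq[of "k - 1"] that by (simp add: poly_left_val_def poly_sum)
  have integ: "(LINT s|lebesgue_on {t k<..<t (Suc k)}. poly (pderiv (p\<psi> k)) s * poly (r k) s)
     = (\<Sum>j\<in>J. c j * (LINT s|lebesgue_on {t k<..<t (Suc k)}. poly (pderiv (p j k)) s * poly (r k) s))" if "k < N" for k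
  proof -
    have "integrable (lebesgue_on {t k<..<t (Suc k)}) (\<lambda>s. c j * (poly (pderiv (p j k)) s * poly (r k) s))" for j
      by (intro continuous_integrable_open_interval continuous_intros)
    then have "(LINT s|lebesgue_on {t k<..<t (Suc k)}. (\<Sum>j\<in>J. c j * (poly (pderiv (p j k)) s * poly (r k) s)))
     = (\<Sum>j\<in>J. LINT s|lebesgue_on {t k<..<t (Suc k)}. c j * (poly (pderiv (p j k)) s * poly (r k) s))"
      by (rule Bochner_Integration.integral_sum)
    moreover have "poly (pderiv (p\<psi> k)) s * poly (r k) s = (\<Sum>j\<in>J. c j * (poly (pderiv (p j k)) s * poly (r k) s))" for s
    proof -
      have "pderiv (p\<psi> k) = (\<Sum>j\<in>J. smult (c j) (pderiv (p j k)))"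
        unfolding eq[OF that] using higher_pderiv_sum[of 1 "\<lambda>j. smult (c j) (p j k)" J]
        by (simp add: pderiv_smult)
      then show ?thesis by (simp add: poly_sum sum_distrib_right mult.assoc)
    qed
    ultimately show ?thesis by simp
  qed
  have "scalar_dg_form N t \<psi> w = (\<Sum>k<N. \<Sum>j\<in>J. c j *
      ((LINT s|lebesgue_on {t k<..<t (Suc k)}. poly (pderiv (p j k)) s * poly (r k) s)
       + (poly (p j k) (t k) - poly_left_val t (p j) k) * poly (r k) (t k)))"
    unfolding scalar_dg_form_polys[OF t p\<psi> r]
  proof (rule sum.cong)
    fix k assume "k \<in> {..<N}"
    then have k: "k < N" by simp
    have "poly (p\<psi> k) (t k) - poly_left_val t p\<psi> k = (\<Sum>j\<in>J. c j * (poly (p j k) (t k) - poly_left_val t (p j) k))"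
      using eq[OF k] left[OF k] by (simp add: poly_sum sum_subtractf right_diff_distrib)
    then show "(LINT s|lebesgue_on {t k<..<t (Suc k)}. poly (pderiv (p\<psi> k)) s * poly (r k) s)
        + (poly (p\<psi> k) (t k) - poly_left_val t p\<psi> k) * poly (r k) (t k)
      = (\<Sum>j\<in>J. c j * ((LINT s|lebesgue_on {t k<..<t (Suc k)}. poly (pderiv (p j k)) s * poly (r k) s)
       + (poly (p j k) (t k) - poly_left_val t (p j) k) * poly (r k) (t k)))"
      by (simp add: integ[OF k] sum_distrib_right distrib_left sum.distrib mult.assoc)
  qed simp
  also have "\<dots> = (\<Sum>j\<in>J. c j * scalar_dg_form N t (\<phi> j) w)"
    by (subst sum.swap) (simp add: scalar_dg_form_polys[OF t p r] sum_distrib_left)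
  finally show ?thesis .
qed

lemma scalar_dg_form_lincomb_right:
  assumes t: "time_partition T N t" and J: "finite J" "\<And>j. j \<in> J \<Longrightarrow> \<phi> j \<in> dg_space q N t"
    and \<psi>: "\<psi> \<in> dg_space q N t" "AE s in lebesgue_on {0<..<T}. \<psi> s = (\<Sum>j\<in>J. c j * \<phi> j s)"
    and w: "w \<in> dg_space q N t"
  shows "scalar_dg_form N t w \<psi> = (\<Sum>j\<in>J. c j * scalar_dg_form N t w (\<phi> j))"
proof -
  have "\<forall>j\<in>J. \<exists>p. dg_polys q N t p (\<phi> j)" using J(2) dg_space_polys by blast
  then obtain p where p: "\<And>j. j \<in> J \<Longrightarrow> dg_polys q N t (p j) (\<phi> j)" by metis
  obtain r where r: "dg_polys q N t r w" using w dg_space_polys by blast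
  obtain p\<psi> where p\<psi>: "dg_polys q N t p\<psi> \<psi>" using \<psi>(1) dg_space_polys by blast
  have eq: "p\<psi> k = (\<Sum>j\<in>J. smult (c j) (p j k))" if "k < N" for k
    using dg_polys_AE_unique[OF t p\<psi> dg_polys_lincomb[OF J(1) p] \<psi>(2) that] .
  have integ: "(LINT s|lebesgue_on {t k<..<t (Suc k)}. poly (pderiv (r k)) s * poly (p\<psi> k) s)
     = (\<Sum>j\<in>J. c j * (LINT s|lebesgue_on {t k<..<t (Suc k)}. poly (pderiv (r k)) s * poly (p j k) s))" if "k < N" for k
  proof -
    have "integrable (lebesgue_on {t k<..<t (Suc k)}) (\<lambda>s. c j * (poly (pderiv (r k)) s * poly (p j k) s))" for j
      by (intro continuous_integrable_open_interval continuous_intros)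
    then have "(LINT s|lebesgue_on {t k<..<t (Suc k)}. (\<Sum>j\<in>J. c j * (poly (pderiv (r k)) s * poly (p j k) s)))
     = (\<Sum>j\<in>J. LINT s|lebesgue_on {t k<..<t (Suc k)}. c j * (poly (pderiv (r k)) s * poly (p j k) s))"
      by (rule Bochner_Integration.integral_sum)
    moreover have "poly (pderiv (r k)) s * poly (p\<psi> k) s = (\<Sum>j\<in>J. c j * (poly (pderiv (r k)) s * poly (p j k) s))" for s
      using eq[OF that] by (simp add: poly_sum sum_distrib_left mult_ac)
    ultimately show ?thesis by simp
  qed
  have "scalar_dg_form N t w \<psi> = (\<Sum>k<N. \<Sum>j\<in>J. c j *
      ((LINT s|lebesgue_on {t k<..<t (Suc k)}. poly (pderiv (r k)) s * poly (p j k) s)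
       + (poly (r k) (t k) - poly_left_val t r k) * poly (p j k) (t k)))"
    unfolding scalar_dg_form_polys[OF t r p\<psi>]
  proof (rule sum.cong)
    fix k assume "k \<in> {..<N}"
    then have k: "k < N" by simp
    have "poly (p\<psi> k) (t k) = (\<Sum>j\<in>J. c j * poly (p j k) (t k))" using eq[OF k] by (simp add: poly_sum)
    then show "(LINT s|lebesgue_on {t k<..<t (Suc k)}. poly (pderiv (r k)) s * poly (p\<psi> k) s)
        + (poly (r k) (t k) - poly_left_val t r k) * poly (p\<psi> k) (t k)
      = (\<Sum>j\<in>J. c j * ((LINT s|lebesgue_on {t k<..<t (Suc k)}. poly (pderiv (r k)) s * poly (p j k) s)
       + (poly (r k) (t k) - poly_left_val t r k) * poly (p j k) (t k)))"
      by (simp add: integ[OF k] sum_distrib_left distrib_left sum.distrib mult.left_commute)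
  qed simp
  also have "\<dots> = (\<Sum>j\<in>J. c j * scalar_dg_form N t w (\<phi> j))"
    by (subst sum.swap) (simp add: scalar_dg_form_polys[OF t r p] sum_distrib_left)
  finally show ?thesis .
qed

definition dg_generator :: "(nat \<Rightarrow> real) \<Rightarrow> nat \<times> nat \<Rightarrow> real \<Rightarrow> real" where
  "dg_generator t km s = indicator {t (fst km)<..<t (Suc (fst km))} s * s ^ snd km"

lemma dg_generator_L2: "dg_generator t km \<in> L2 (lebesgue_on {0<..<T})"
proof -
  have meas: "dg_generator t km \<in> borel_measurable (lebesgue_on {0<..<T})"
    unfolding dg_generator_def
    by (intro measurable_restrict_space1 measurable_completion) simp
  have "integrable (lebesgue_on {0<..<T}) (\<lambda>s. (norm (dg_generator t km s))\<^sup>2)"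
  proof (rule Bochner_Integration.integrable_bound)
    show "integrable (lebesgue_on {0<..<T}) (\<lambda>s. (s ^ snd km)\<^sup>2)"
      by (intro continuous_integrable_open_interval continuous_intros)
    show "(\<lambda>s. (norm (dg_generator t km s))\<^sup>2) \<in> borel_measurable (lebesgue_on {0<..<T})"
      using meas by measurable
    show "AE s in lebesgue_on {0<..<T}. norm ((norm (dg_generator t km s))\<^sup>2) \<le> norm ((s ^ snd km)\<^sup>2)"
      by (auto simp: dg_generator_def indicator_def)
  qed
  with meas show ?thesis by (simp add: L2_def)
qed

lemma dg_generator_in_dg_space:
  assumes t: "time_partition T N t" and km: "fst km < N" "snd km \<le> q"
  shows "dg_generator t km \<in> dg_space q N t"
proof -
  have "dg_polys q N t (\<lambda>k. if k = fst km then monom 1 (snd km) else 0) (dg_generator t km)"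
    unfolding dg_polys_def
  proof (intro allI impI conjI ballI)
    fix k assume k: "k < N"
    show "degree (if k = fst km then monom 1 (snd km) else (0::real poly)) \<le> q"
      using km(2) by (auto intro: order_trans[OF degree_monom_le])
    fix s assume s: "s \<in> {t k<..<t (Suc k)}"
    have "s \<in> {t (fst km)<..<t (Suc (fst km))} \<longleftrightarrow> k = fst km"
      using time_partition_interval_unique[OF t k km(1) s] s by blast
    then show "dg_generator t km s = poly (if k = fst km then monom 1 (snd km) else 0) s"
      by (cases "k = fst km") (auto simp: dg_generator_def poly_monom)
  qed
  then show ?thesis using dg_space_polys by blast
qed

text \<open>Up to the values at the nodes, truncated monomials span the space.\<close>

lemma dg_space_AE_generators:
  assumes t: "time_partition T N t" and \<phi>: "\<phi> \<in> dg_space q N t"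
  shows "\<exists>c. AE s in lebesgue_on {0<..<T}. \<phi> s = (\<Sum>km\<in>{..<N} \<times> {..q}. c km * dg_generator t km s)"
proof -
  obtain p where p: "dg_polys q N t p \<phi>" using \<phi> dg_space_polys by blast
  have "\<phi> s = (\<Sum>km\<in>{..<N} \<times> {..q}. coeff (p (fst km)) (snd km) * dg_generator t km s)"
    if k: "k < N" and s: "s \<in> {t k<..<t (Suc k)}" for k s
  proof -
    have ind: "indicator {t j<..<t (Suc j)} s = (if j = k then 1 else (0::real))" if "j < N" for j
    proof (cases "s \<in> {t j<..<t (Suc j)}")
      case True
      then show ?thesis using time_partition_interval_unique[OF t that k True s] by simp
    next
      case False
      then show ?thesis using s by (cases "j = k") simp_all
    qed
    have deg: "degree (p k) \<le> q" using p k by (simp add: dg_polys_def)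
    have "(\<Sum>km\<in>{..<N} \<times> {..q}. coeff (p (fst km)) (snd km) * dg_generator t km s)
       = (\<Sum>j<N. \<Sum>m\<le>q. coeff (p j) m * (indicator {t j<..<t (Suc j)} s * s ^ m))"
      by (simp add: sum.cartesian_product dg_generator_def case_prod_unfold)
    also have "\<dots> = (\<Sum>j<N. if j = k then (\<Sum>m\<le>q. coeff (p k) m * s ^ m) else 0)"
      by (intro sum.cong refl) (simp add: ind)
    also have "\<dots> = (\<Sum>m\<le>q. coeff (p k) m * s ^ m)" using k by simp
    also have "\<dots> = (\<Sum>m\<le>degree (p k). coeff (p k) m * s ^ m)"
      using deg by (intro sum.mono_neutral_right) (auto simp: coeff_eq_0)
    also have "\<dots> = \<phi> s" using p k s by (simp add: dg_polys_def poly_altdef)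
    finally show ?thesis by simp
  qed
  then have "AE s in lebesgue_on {0<..<T}. \<phi> s = (\<Sum>km\<in>{..<N} \<times> {..q}. coeff (p (fst km)) (snd km) * dg_generator t km s)"
    using time_partition_AE_interval[OF t] by (elim AE_mp) (auto intro!: AE_I2)
  then show ?thesis by (rule exI[of _ "\<lambda>km. coeff (p (fst km)) (snd km)"])
qed

lemma dg_space_L2:
  assumes t: "time_partition T N t"
  shows "dg_space q N t \<subseteq> L2 (lebesgue_on {0<..<T})"
proof
  fix \<phi> assume "\<phi> \<in> dg_space q N t"
  then obtain c where c: "AE s in lebesgue_on {0<..<T}. \<phi> s = (\<Sum>km\<in>{..<N} \<times> {..q}. c km * dg_generator t km s)"
    using dg_space_AE_generators[OF t] by blast
  let ?g = "\<lambda>s. \<Sum>km\<in>{..<N} \<times> {..q}. c km *\<^sub>R dg_generator t km s"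
  have g: "?g \<in> L2 (lebesgue_on {0<..<T})" by (intro L2_sum L2_scaleR dg_generator_L2)
  have eq: "AE s in lebesgue_on {0<..<T}. ?g s = \<phi> s" using c by eventually_elim simp
  then have "\<phi> \<in> borel_measurable (lebesgue_on {0<..<T})"
    by (rule measurable_lebesgue_on_AE[rotated 2]) (use g in \<open>auto intro: L2_measurable\<close>)
  then show "\<phi> \<in> L2 (lebesgue_on {0<..<T})" using L2_cong_AE[OF g] eq by blast
qed

lemma dg_space_basis:
  assumes t: "time_partition T N t"
  shows "\<exists>R \<theta>. l2_basis (lebesgue_on {0<..<T}) (dg_space q N t) R \<theta>"
proof -
  let ?M = "lebesgue_on {0<..<T}" and ?I = "{..<N} \<times> {..q}"
  let ?G = "dg_generator t ` ?I"
  have G: "finite ?G" "?G \<subseteq> L2 ?M" using dg_generator_L2 by auto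
  obtain R \<theta> where \<theta>: "l2_basis ?M (fun_span ?G) R \<theta>" using l2_basis_fun_span_exists[OF G] by blast
  have fd: "finite_dim_space (fun_span ?G)" using G(1) unfolding finite_dim_space_def by blast
  have sub: "fun_span ?G \<subseteq> dg_space q N t"
  proof
    fix f assume "f \<in> fun_span ?G"
    then obtain c where f: "f = (\<lambda>s. \<Sum>b\<in>?G. c b * b s)" by (auto simp: fun_span_finite[OF G(1)])
    show "f \<in> dg_space q N t" unfolding f
      by (intro dg_space_lincomb G(1)) (auto intro: dg_generator_in_dg_space[OF t])
  qed
  have "l2_basis ?M (dg_space q N t) R \<theta>"
    unfolding l2_basis_def
  proof (intro conjI ballI)
    show "\<forall>j<R. \<theta> j \<in> dg_space q N t" using \<theta> sub by (auto simp: l2_basis_def)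
    show "\<forall>i<R. \<forall>j<R. l2_inner ?M (\<theta> i) (\<theta> j) = (if i = j then 1 else 0)" using \<theta> by (simp add: l2_basis_def)
    fix \<phi> assume \<phi>: "\<phi> \<in> dg_space q N t"
    then obtain c where c: "AE s in ?M. \<phi> s = (\<Sum>km\<in>?I. c km * dg_generator t km s)"
      using dg_space_AE_generators[OF t] by blast
    define g where "g s = (\<Sum>km\<in>?I. c km *\<^sub>R dg_generator t km s)" for s
    have g_in: "g \<in> fun_span ?G"
      unfolding g_def using subsetD[OF fun_span_superset, of _ ?G] by (intro finite_dim_space_lincomb[OF fd]) auto
    have eq: "AE s in ?M. \<phi> s = g s" using c by (simp add: g_def)
    have coef: "l2_inner ?M \<phi> (\<theta> j) = l2_inner ?M g (\<theta> j)" if "j < R" for j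
      using \<phi> g_in that \<theta> sub dg_space_L2[OF t, of q] eq
      by (intro l2_inner_cong_AE L2_measurable) (auto simp: l2_basis_def)
    have "AE s in ?M. g s = (\<Sum>j<R. l2_inner ?M g (\<theta> j) *\<^sub>R \<theta> j s)"
      using \<theta> g_in by (simp add: l2_basis_def)
    then show "AE s in ?M. \<phi> s = (\<Sum>j<R. l2_inner ?M \<phi> (\<theta> j) *\<^sub>R \<theta> j s)"
      using eq by eventually_elim (simp add: coef)
  qed
  then show ?thesis by blast
qed

section \<open>The discontinuous Galerkin saddle point problem\<close>

text \<open>Expansion in an orthonormal basis of the temporal space reduces the problem to a saddle point system in
  which \<open>C\<close> is the matrix of the time derivative.\<close>

lemma dg_saddle_point_solution_exists:
  fixes A B :: "nat \<Rightarrow> nat \<Rightarrow> real" and g :: "nat \<Rightarrow> real \<Rightarrow> real"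
  assumes t: "time_partition T N t"
    and A: "\<And>c. 0 \<le> (\<Sum>i<n. \<Sum>j<n. A i j * (c i * c j))"
      "\<And>c. (\<Sum>i<n. \<Sum>j<n. A i j * (c i * c j)) = 0 \<Longrightarrow> \<forall>i<n. c i = 0"
    and g: "\<And>j. j < n \<Longrightarrow> g j \<in> L2 (lebesgue_on {0<..<T})"
  defines "ip \<equiv> l2_inner (lebesgue_on {0<..<T})"
  shows "\<exists>U P. (\<forall>i<n. U i \<in> dg_space q N t) \<and> (\<forall>l<m. P l \<in> dg_space q N t) \<and>
     (\<forall>V. (\<forall>j<n. V j \<in> dg_space q N t) \<longrightarrow>
        (\<Sum>i<n. \<Sum>j<n. A i j * ip (U i) (V j)) + (\<Sum>j<n. \<Sum>l<m. B j l * ip (V j) (P l)) = - (\<Sum>j<n. ip (V j) (g j))) \<and>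
     (\<forall>W. (\<forall>l<m. W l \<in> dg_space q N t) \<longrightarrow>
        (\<Sum>l<m. scalar_dg_form N t (P l) (W l)) - (\<Sum>j<n. \<Sum>l<m. B j l * ip (U j) (W l)) = 0)"
proof -
  let ?M = "lebesgue_on {0<..<T}" and ?D = "dg_space q N t"
  obtain R \<theta> where \<theta>: "l2_basis ?M ?D R \<theta>" using dg_space_basis[OF t] by blast
  have D: "\<phi> \<in> L2 ?M" if "\<phi> \<in> ?D" for \<phi> using that dg_space_L2[OF t] by blast
  have \<theta>D: "\<theta> r \<in> ?D" if "r < R" for r using \<theta> that by (simp add: l2_basis_def)
  have \<theta>orth: "ip (\<theta> r) (\<theta> s) = (if r = s then 1 else 0)" if "r < R" "s < R" for r s
    using \<theta> that by (simp add: l2_basis_def ip_def)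
  have expand: "AE s in ?M. \<phi> s = (\<Sum>r<R. ip \<phi> (\<theta> r) * \<theta> r s)" if "\<phi> \<in> ?D" for \<phi>
    using \<theta> that by (simp add: l2_basis_def ip_def)
  define C where "C r s = scalar_dg_form N t (\<theta> r) (\<theta> s)" for r s
  have combD: "(\<lambda>s. \<Sum>r<R. c r * \<theta> r s) \<in> ?D" for c using \<theta>D by (intro dg_space_lincomb) auto
  have combL: "scalar_dg_form N t (\<lambda>s. \<Sum>r<R. c r * \<theta> r s) w = (\<Sum>r<R. c r * scalar_dg_form N t (\<theta> r) w)"
    if "w \<in> ?D" for c w
    using that \<theta>D combD[of c] by (intro scalar_dg_form_lincomb_left[OF t]) auto
  have expR: "scalar_dg_form N t \<phi> w = (\<Sum>r<R. ip w (\<theta> r) * scalar_dg_form N t \<phi> (\<theta> r))"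
    if "w \<in> ?D" "\<phi> \<in> ?D" for \<phi> w
    using that \<theta>D expand[OF that(1)] by (intro scalar_dg_form_lincomb_right[OF t]) auto
  have ipcomb: "ip (\<lambda>s. \<Sum>r<R. c r * \<theta> r s) \<phi> = (\<Sum>r<R. c r * ip (\<theta> r) \<phi>)" if "\<phi> \<in> L2 ?M" for c \<phi>
    using l2_inner_lincomb_left[of "{..<R}" \<theta> ?M \<phi> c] that D \<theta>D by (simp add: ip_def)
  have ipexp: "ip \<phi> h = (\<Sum>r<R. ip \<phi> (\<theta> r) * ip (\<theta> r) h)" if "\<phi> \<in> ?D" "h \<in> L2 ?M" for \<phi> h
  proof -
    have "ip \<phi> h = ip (\<lambda>s. \<Sum>r<R. ip \<phi> (\<theta> r) * \<theta> r s) h"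
      unfolding ip_def using D[OF that(1)] D[OF combD] that(2) expand[OF that(1)]
      by (intro l2_inner_cong_AE L2_measurable) (auto simp: ip_def)
    then show ?thesis using ipcomb[OF that(2)] by simp
  qed
  have ip_sym: "ip \<phi> h = ip h \<phi>" for \<phi> h by (simp add: ip_def l2_inner_commute)
  have "\<exists>u p. (\<forall>j<n. \<forall>s<R. (\<Sum>i<n. A i j * u i s) + (\<Sum>l<m. B j l * p l s) = - ip (\<theta> s) (g j)) \<and>
               (\<forall>l<m. \<forall>s<R. (\<Sum>r<R. C r s * p l r) - (\<Sum>j<n. B j l * u j s) = 0)"
  proof (rule saddle_point_system_solvable[OF A])
    fix c
    let ?\<phi> = "\<lambda>s. \<Sum>r<R. c r * \<theta> r s"
    have comb2: "scalar_dg_form N t ?\<phi> w = (\<Sum>r<R. c r * scalar_dg_form N t (\<theta> r) w)" if "w \<in> ?D" for w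
      using combL[OF that] .
    have ip\<phi>: "ip ?\<phi> (\<theta> s) = c s" if "s < R" for s
      using ipcomb[OF D[OF \<theta>D[OF that]], of c] that by (simp add: \<theta>orth sum.delta if_distrib cong: if_cong)
    have "scalar_dg_form N t ?\<phi> ?\<phi> = (\<Sum>s<R. c s * scalar_dg_form N t ?\<phi> (\<theta> s))"
      using expR[OF combD[of c] combD[of c]] ip\<phi> by simp
    also have "\<dots> = (\<Sum>s<R. \<Sum>r<R. C r s * (c r * c s))"
      by (intro sum.cong refl) (simp add: comb2 \<theta>D C_def sum_distrib_left mult_ac)
    also have "\<dots> = (\<Sum>r<R. \<Sum>s<R. C r s * (c r * c s))" by (rule sum.swap)
    finally show "0 \<le> (\<Sum>r<R. \<Sum>s<R. C r s * (c r * c s))"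
      using scalar_dg_form_nonneg[OF t combD[of c]] by simp
    assume zero: "\<And>s. s < R \<Longrightarrow> (\<Sum>r<R. C r s * c r) = 0"
    have z: "scalar_dg_form N t ?\<phi> w = 0" if "w \<in> ?D" for w
    proof -
      have "scalar_dg_form N t ?\<phi> (\<theta> s) = 0" if "s < R" for s
        using zero[OF that] comb2[OF \<theta>D[OF that]] by (simp add: C_def mult.commute[of "c _"])
      then show ?thesis unfolding expR[OF that combD] by simp
    qed
    obtain p where p: "dg_polys q N t p ?\<phi>" using combD[of c] dg_space_polys by blast
    have "\<forall>k<N. p k = 0" using scalar_dg_form_nondegenerate[OF t p z] .
    then have "?\<phi> s = 0" if "k < N" "s \<in> {t k<..<t (Suc k)}" for k s
      using p that by (simp add: dg_polys_def)
    then have "AE s in ?M. ?\<phi> s = 0"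
      using time_partition_AE_interval[OF t] by (elim AE_mp) (auto intro!: AE_I2)
    then have "ip ?\<phi> (\<theta> s) = ip (\<lambda>_. 0) (\<theta> s)" if "s < R" for s
      unfolding ip_def using D[OF combD[of c]] D[OF \<theta>D[OF that]] by (intro l2_inner_cong_AE L2_measurable) auto
    then show "\<forall>r<R. c r = 0" using ip\<phi> by (simp add: ip_def l2_inner_def)
  qed
  then obtain u p where e1': "\<forall>j<n. \<forall>s<R. (\<Sum>i<n. A i j * u i s) + (\<Sum>l<m. B j l * p l s) = - ip (\<theta> s) (g j)"
      and e2': "\<forall>l<m. \<forall>s<R. (\<Sum>r<R. C r s * p l r) - (\<Sum>j<n. B j l * u j s) = 0"
    by (elim exE conjE) (rule that)
  have e1: "(\<Sum>i<n. A i j * u i s) + (\<Sum>l<m. B j l * p l s) = - ip (\<theta> s) (g j)" if "j < n" "s < R" for j s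
    using e1' that by blast
  have e2: "(\<Sum>r<R. C r s * p l r) - (\<Sum>j<n. B j l * u j s) = 0" if "l < m" "s < R" for l s
    using e2' that by blast
  define U where "U i = (\<lambda>s. \<Sum>r<R. u i r * \<theta> r s)" for i
  define P where "P l = (\<lambda>s. \<Sum>r<R. p l r * \<theta> r s)" for l
  have ipU: "ip (U i) \<phi> = (\<Sum>s<R. ip \<phi> (\<theta> s) * u i s)" if "\<phi> \<in> ?D" for i \<phi>
  proof -
    have "ip (U i) \<phi> = (\<Sum>s<R. u i s * ip (\<theta> s) \<phi>)" unfolding U_def by (rule ipcomb[OF D[OF that]])
    then show ?thesis by (simp add: mult.commute[of "u i _"] ip_sym[of \<phi>])
  qed
  have ipP: "ip \<phi> (P l) = (\<Sum>s<R. ip \<phi> (\<theta> s) * p l s)" if "\<phi> \<in> ?D" for l \<phi>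
  proof -
    have "ip (P l) \<phi> = (\<Sum>s<R. p l s * ip (\<theta> s) \<phi>)" unfolding P_def by (rule ipcomb[OF D[OF that]])
    then show ?thesis by (simp add: mult.commute[of "p l _"] ip_sym[of \<phi>])
  qed
  show ?thesis
  proof (rule exI[of _ U], rule exI[of _ P], intro conjI allI impI)
    show "U i \<in> ?D" for i unfolding U_def by (rule combD)
    show "P l \<in> ?D" for l unfolding P_def by (rule combD)
  next
    fix V assume V: "\<forall>j<n. V j \<in> ?D"
    have "ip (U i) (V j) = (\<Sum>s<R. ip (V j) (\<theta> s) * u i s)" "ip (V j) (P l) = (\<Sum>s<R. ip (V j) (\<theta> s) * p l s)"
      "ip (V j) (g j) = (\<Sum>s<R. ip (V j) (\<theta> s) * ip (\<theta> s) (g j))" if "j < n" for i j l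
      using V that ipU ipP ipexp[OF _ g, of "V j" j] by simp_all
    then have "(\<Sum>i<n. \<Sum>j<n. A i j * ip (U i) (V j)) + (\<Sum>j<n. \<Sum>l<m. B j l * ip (V j) (P l)) + (\<Sum>j<n. ip (V j) (g j))
      = (\<Sum>j<n. \<Sum>i<n. \<Sum>s<R. A i j * (ip (V j) (\<theta> s) * u i s)) + (\<Sum>j<n. \<Sum>l<m. \<Sum>s<R. B j l * (ip (V j) (\<theta> s) * p l s))
        + (\<Sum>j<n. \<Sum>s<R. ip (V j) (\<theta> s) * ip (\<theta> s) (g j))"
      by (subst sum.swap) (simp add: sum_distrib_left)
    also have "\<dots> = (\<Sum>j<n. (\<Sum>i<n. \<Sum>s<R. A i j * (ip (V j) (\<theta> s) * u i s)) + (\<Sum>l<m. \<Sum>s<R. B j l * (ip (V j) (\<theta> s) * p l s))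
        + (\<Sum>s<R. ip (V j) (\<theta> s) * ip (\<theta> s) (g j)))"
      by (simp only: sum.distrib)
    also have "\<dots> = (\<Sum>j<n. \<Sum>s<R. ip (V j) (\<theta> s) *
        ((\<Sum>i<n. A i j * u i s) + (\<Sum>l<m. B j l * p l s) + ip (\<theta> s) (g j)))"
    proof (rule sum.cong[OF refl])
      fix j
      have "(\<Sum>i<n. \<Sum>s<R. A i j * (ip (V j) (\<theta> s) * u i s)) = (\<Sum>s<R. ip (V j) (\<theta> s) * (\<Sum>i<n. A i j * u i s))"
        by (subst sum.swap) (simp add: sum_distrib_left mult_ac)
      moreover have "(\<Sum>l<m. \<Sum>s<R. B j l * (ip (V j) (\<theta> s) * p l s)) = (\<Sum>s<R. ip (V j) (\<theta> s) * (\<Sum>l<m. B j l * p l s))"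
        by (subst sum.swap) (simp add: sum_distrib_left mult_ac)
      ultimately show "(\<Sum>i<n. \<Sum>s<R. A i j * (ip (V j) (\<theta> s) * u i s)) + (\<Sum>l<m. \<Sum>s<R. B j l * (ip (V j) (\<theta> s) * p l s))
        + (\<Sum>s<R. ip (V j) (\<theta> s) * ip (\<theta> s) (g j)) = (\<Sum>s<R. ip (V j) (\<theta> s) *
        ((\<Sum>i<n. A i j * u i s) + (\<Sum>l<m. B j l * p l s) + ip (\<theta> s) (g j)))"
        by (simp add: sum.distrib distrib_left)
    qed
    also have "\<dots> = 0" by (intro sum.neutral ballI) (simp add: e1)
    finally show "(\<Sum>i<n. \<Sum>j<n. A i j * ip (U i) (V j)) + (\<Sum>j<n. \<Sum>l<m. B j l * ip (V j) (P l)) = - (\<Sum>j<n. ip (V j) (g j))"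
      by linarith
  next
    fix W assume W: "\<forall>l<m. W l \<in> ?D"
    have sd: "scalar_dg_form N t (P l) (W l) = (\<Sum>s<R. ip (W l) (\<theta> s) * (\<Sum>r<R. C r s * p l r))" if "l < m" for l
    proof -
      have "scalar_dg_form N t (P l) (\<theta> s) = (\<Sum>r<R. C r s * p l r)" if "s < R" for s
        using combL[OF \<theta>D[OF that], of "p l"] by (simp add: P_def C_def mult.commute)
      then show ?thesis using expR[of "W l" "P l"] W that combD[of "p l"] by (simp add: P_def[symmetric])
    qed
    have "(\<Sum>l<m. scalar_dg_form N t (P l) (W l)) - (\<Sum>j<n. \<Sum>l<m. B j l * ip (U j) (W l))
       = (\<Sum>l<m. \<Sum>s<R. ip (W l) (\<theta> s) * ((\<Sum>r<R. C r s * p l r) - (\<Sum>j<n. B j l * u j s)))"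
    proof -
      have "(\<Sum>j<n. \<Sum>l<m. B j l * ip (U j) (W l)) = (\<Sum>l<m. \<Sum>j<n. \<Sum>s<R. B j l * (ip (W l) (\<theta> s) * u j s))"
        using W by (subst sum.swap) (simp add: ipU sum_distrib_left)
      also have "\<dots> = (\<Sum>l<m. \<Sum>s<R. ip (W l) (\<theta> s) * (\<Sum>j<n. B j l * u j s))"
        by (rule sum.cong[OF refl], subst sum.swap) (simp add: sum_distrib_left mult_ac)
      finally show ?thesis by (simp add: sd sum_subtractf right_diff_distrib)
    qed
    also have "\<dots> = 0" by (intro sum.neutral ballI) (simp add: e2)
    finally show "(\<Sum>l<m. scalar_dg_form N t (P l) (W l)) - (\<Sum>j<n. \<Sum>l<m. B j l * ip (U j) (W l)) = 0" .
  qed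
qed

section \<open>Tensor product spaces\<close>

lemma l2_basis_finite_dim_exists:
  fixes V :: "('a \<Rightarrow> 'b::euclidean_space) set"
  assumes "finite_dim_space V" "V \<subseteq> L2 M"
  shows "\<exists>n e. l2_basis M V n e"
proof -
  obtain B where B: "finite B" "V = fun_span B" using assms(1) by (auto simp: finite_dim_space_def)
  then have "B \<subseteq> L2 M" using fun_span_superset[of B] assms(2) by blast
  then show ?thesis using l2_basis_fun_span_exists[OF B(1)] B(2) by blast
qed

text \<open>The common ground of the temporal spaces on the subdomains, which are infinite-dimensional spaces of
  functions, and of the finite-dimensional ones on the interfaces.\<close>

definition lincomb_closed :: "(real \<Rightarrow> real) set \<Rightarrow> bool" where
  "lincomb_closed \<Psi> \<longleftrightarrow>
     (\<forall>(m::nat) c \<psi>. (\<forall>k<m. \<psi> k \<in> \<Psi>) \<longrightarrow> (\<lambda>t. \<Sum>k<m. c k * \<psi> k t) \<in> \<Psi>)"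

lemma lincomb_closed_dg_space: "lincomb_closed (dg_space q N t)"
  unfolding lincomb_closed_def
proof (intro allI impI)
  fix m :: nat and c :: "nat \<Rightarrow> real" and \<psi> :: "nat \<Rightarrow> real \<Rightarrow> real"
  assume "\<forall>k<m. \<psi> k \<in> dg_space q N t"
  then show "(\<lambda>s. \<Sum>k<m. c k * \<psi> k s) \<in> dg_space q N t" by (intro dg_space_lincomb) auto
qed

lemma lincomb_closed_finite_dim:
  fixes \<Psi> :: "(real \<Rightarrow> real) set"
  assumes "finite_dim_space \<Psi>"
  shows "lincomb_closed \<Psi>"
  unfolding lincomb_closed_def
proof (intro allI impI)
  fix m :: nat and c :: "nat \<Rightarrow> real" and \<psi> :: "nat \<Rightarrow> real \<Rightarrow> real"
  assume "\<forall>k<m. \<psi> k \<in> \<Psi>"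
  then show "(\<lambda>s. \<Sum>k<m. c k * \<psi> k s) \<in> \<Psi>"
    using finite_dim_space_lincomb[OF assms, of "{..<m}" \<psi> c] by simp
qed

lemma tensor_space_slice:
  assumes "finite_dim_space V" "u \<in> tensor_space V \<Psi>"
  shows "u t \<in> V"
proof -
  obtain m \<psi> v where u: "u = (\<lambda>t x. \<Sum>k<(m::nat). \<psi> k t *\<^sub>R v k x)" "\<forall>k<m. \<psi> k \<in> \<Psi> \<and> v k \<in> V"
    using assms(2) unfolding tensor_space_def by blast
  show ?thesis unfolding u(1) using u(2) by (intro finite_dim_space_lincomb[OF assms(1)]) auto
qed

lemma tensor_space_functional:
  assumes "lincomb_closed \<Psi>" "u \<in> tensor_space V \<Psi>"
    and F: "\<And>(m::nat) c v. (\<And>k. k < m \<Longrightarrow> v k \<in> V) \<Longrightarrow> F (\<lambda>x. \<Sum>k<m. c k *\<^sub>R v k x) = (\<Sum>k<m. c k * F (v k))"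
  shows "(\<lambda>t. F (u t)) \<in> \<Psi>"
proof -
  obtain m \<psi> v where u: "u = (\<lambda>t x. \<Sum>k<(m::nat). \<psi> k t *\<^sub>R v k x)" "\<forall>k<m. \<psi> k \<in> \<Psi> \<and> v k \<in> V"
    using assms(2) unfolding tensor_space_def by blast
  have "(\<lambda>t. F (u t)) = (\<lambda>t. \<Sum>k<m. F (v k) * \<psi> k t)"
    unfolding u(1) using u(2) by (subst F) (auto simp: mult.commute)
  then show ?thesis using assms(1) u(2) by (auto simp: lincomb_closed_def)
qed

lemma tensor_space_coefficient:
  fixes V :: "('x \<Rightarrow> 'v::euclidean_space) set"
  assumes "lincomb_closed \<Psi>" "u \<in> tensor_space V \<Psi>" "V \<subseteq> L2 M" "h \<in> L2 M"
  shows "(\<lambda>t. l2_inner M (u t) h) \<in> \<Psi>"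
  by (rule tensor_space_functional[OF assms(1,2)], rule l2_inner_lincomb_left) (use assms(3,4) in auto)

text \<open>The exceptional null set does not depend on time, so that one may pass to time derivatives and to
  one-sided limits in time in the expansion.\<close>

lemma tensor_space_expansion:
  fixes V :: "('x \<Rightarrow> 'v::euclidean_space) set"
  assumes e: "l2_basis M V n e" and V: "V \<subseteq> L2 M" and u: "u \<in> tensor_space V \<Psi>"
  shows "AE x in M. \<forall>t. u t x = (\<Sum>j<n. l2_inner M (u t) (e j) *\<^sub>R e j x)"
proof -
  obtain m \<psi> v where u: "u = (\<lambda>t x. \<Sum>k<(m::nat). \<psi> k t *\<^sub>R v k x)" and v: "\<forall>k<m. \<psi> k \<in> \<Psi> \<and> v k \<in> V"
    using u unfolding tensor_space_def by blast
  have eV: "e j \<in> L2 M" if "j < n" for j using e V that by (auto simp: l2_basis_def)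
  have coef: "l2_inner M (u t) (e j) = (\<Sum>k<m. \<psi> k t * l2_inner M (v k) (e j))" if "j < n" for t j
    unfolding u using v V eV[OF that] by (intro l2_inner_lincomb_left) auto
  have "AE x in M. \<forall>k\<in>{..<m}. v k x = (\<Sum>j<n. l2_inner M (v k) (e j) *\<^sub>R e j x)"
    using e v by (intro AE_finite_allI) (auto simp: l2_basis_def)
  then show ?thesis
  proof eventually_elim
    case (elim x)
    show ?case
    proof
      fix t
      have "u t x = (\<Sum>k<m. \<Sum>j<n. (\<psi> k t * l2_inner M (v k) (e j)) *\<^sub>R e j x)"
        unfolding u using elim by (simp add: scaleR_sum_right)
      also have "\<dots> = (\<Sum>j<n. \<Sum>k<m. (\<psi> k t * l2_inner M (v k) (e j)) *\<^sub>R e j x)" by (rule sum.swap)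
      also have "\<dots> = (\<Sum>j<n. l2_inner M (u t) (e j) *\<^sub>R e j x)"
        by (simp add: coef scaleR_sum_left)
      finally show "u t x = (\<Sum>j<n. l2_inner M (u t) (e j) *\<^sub>R e j x)" .
    qed
  qed
qed

lemma tensor_space_intro:
  fixes n :: nat
  assumes "\<And>j. j < n \<Longrightarrow> U j \<in> \<Psi>" "\<And>j. j < n \<Longrightarrow> e j \<in> V"
  shows "(\<lambda>t x. \<Sum>j<n. U j t *\<^sub>R e j x) \<in> tensor_space V \<Psi>"
  unfolding tensor_space_def
  by (rule CollectI, rule exI[of _ n], rule exI[of _ U], rule exI[of _ e]) (use assms in auto)

lemma l2_basis_coefficient:
  fixes V :: "('x \<Rightarrow> 'v::euclidean_space) set"
  assumes e: "l2_basis M V n e" and V: "V \<subseteq> L2 M" and k: "k < n"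
  shows "l2_inner M (\<lambda>x. \<Sum>j<n. c j *\<^sub>R e j x) (e k) = c k"
proof -
  have eV: "e j \<in> L2 M" if "j < n" for j using e V that by (auto simp: l2_basis_def)
  have "l2_inner M (\<lambda>x. \<Sum>j<n. c j *\<^sub>R e j x) (e k) = (\<Sum>j<n. c j * l2_inner M (e j) (e k))"
    using eV k by (intro l2_inner_lincomb_left) auto
  also have "\<dots> = (\<Sum>j<n. if j = k then c k else 0)"
    using e k by (intro sum.cong) (auto simp: l2_basis_def)
  finally show ?thesis using k by simp
qed

lemma l2_inner_expansion:
  fixes V :: "('x \<Rightarrow> 'v::euclidean_space) set"
  assumes e: "l2_basis M V n e" and V: "V \<subseteq> L2 M" and f: "f \<in> V" and g: "g \<in> L2 M"
  shows "l2_inner M f g = (\<Sum>j<n. l2_inner M f (e j) * l2_inner M (e j) g)"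
proof -
  have eV: "e j \<in> L2 M" if "j < n" for j using e V that by (auto simp: l2_basis_def)
  have L: "(\<lambda>x. \<Sum>j<n. l2_inner M f (e j) *\<^sub>R e j x) \<in> L2 M" using eV by (intro L2_sum L2_scaleR) auto
  have "l2_inner M f g = l2_inner M (\<lambda>x. \<Sum>j<n. l2_inner M f (e j) *\<^sub>R e j x) g"
    using e f V g L by (intro l2_inner_cong_AE L2_measurable) (auto simp: l2_basis_def)
  also have "\<dots> = (\<Sum>j<n. l2_inner M f (e j) * l2_inner M (e j) g)"
    using eV g by (intro l2_inner_lincomb_left) auto
  finally show ?thesis .
qed

section \<open>Restriction of the surface measure\<close>

lemma surface_on_indicator:
  fixes f g :: "real^'n \<Rightarrow> real"
  assumes A: "A \<in> sets borel" "B \<in> sets borel" "A \<subseteq> B"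
  shows "f \<in> L2 (surface_on A) \<Longrightarrow> (\<lambda>x. indicator A x * f x) \<in> L2 (surface_on B)"
    and "l2_inner (surface_on B) g (\<lambda>x. indicator A x * f x) = l2_inner (surface_on A) g f"
proof -
  have s: "A \<inter> space surface_measure \<in> sets surface_measure" "B \<inter> space surface_measure \<in> sets surface_measure"
    using A by (auto intro: sets_surface_measure_borel)
  have AB: "indicator B x * (indicator A x * c) = indicator A x * (c::real)" for x c
    using A(3) by (auto simp: indicator_def)
  show "(\<lambda>x. indicator A x * f x) \<in> L2 (surface_on B)" if f: "f \<in> L2 (surface_on A)"
  proof -
    have fm: "(\<lambda>x. indicator A x * f x) \<in> borel_measurable surface_measure"
      using L2_measurable[OF f] s(1) by (simp add: surface_on_def borel_measurable_restrict_space_iff)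
    have "integrable (surface_on A) (\<lambda>x. (norm (f x))\<^sup>2)" using f by (simp add: L2_def)
    then have "integrable surface_measure (\<lambda>x. indicator A x * (norm (f x))\<^sup>2)"
      using s(1) by (simp add: surface_on_def integrable_restrict_space)
    also have "(\<lambda>x. indicator A x * (norm (f x))\<^sup>2) = (\<lambda>x. indicator B x * (norm (indicator A x * f x))\<^sup>2)"
      using A(3) by (auto simp: indicator_def fun_eq_iff)
    finally have "integrable (surface_on B) (\<lambda>x. (norm (indicator A x * f x))\<^sup>2)"
      using s(2) by (simp add: surface_on_def integrable_restrict_space)
    moreover have "(\<lambda>x. indicator A x * f x) \<in> borel_measurable (surface_on B)"
      unfolding surface_on_def using fm by (rule measurable_restrict_space1)
    ultimately show ?thesis by (simp add: L2_def)
  qed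
  have "(\<lambda>x. indicator B x * (g x * (indicator A x * f x))) = (\<lambda>x. indicator A x * (g x * f x))"
    using A(3) by (auto simp: indicator_def fun_eq_iff)
  then show "l2_inner (surface_on B) g (\<lambda>x. indicator A x * f x) = l2_inner (surface_on A) g f"
    using s by (simp add: l2_inner_def surface_on_def integral_restrict_space)
qed

lemma bdry_borel: "bdry P i \<in> sets borel" "bdry P i \<subseteq> frontier (sub P i)"
  by (auto simp: bdry_def intro!: sets.Diff borel_closed)

lemma iface_borel: "iface P e \<in> sets borel" "iface P e \<subseteq> bdry P (fst e)" "iface P e \<subseteq> bdry P (snd e)"
  using bdry_borel by (auto simp: iface_def)

lemma finite_interfaces: "finite (interfaces P)"
proof (rule finite_subset)
  show "interfaces P \<subseteq> {..<num_sub P} \<times> {..<num_sub P}" by (auto simp: interfaces_def)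
qed simp

lemma interfaces_less: "e \<in> interfaces P \<Longrightarrow> fst e < num_sub P" "e \<in> interfaces P \<Longrightarrow> snd e < num_sub P"
  by (auto simp: interfaces_def)

lemma mortar_on_L2:
  fixes P :: "'n::finite problem"
  assumes "\<And>e. e \<in> interfaces P \<Longrightarrow> \<mu> e \<in> L2 (surface_on (iface P e))"
    and B: "B \<in> sets borel" "bdry P i \<subseteq> B"
  shows "mortar_on P i \<mu> \<in> L2 (surface_on B)"
    "g \<in> L2 (surface_on B) \<Longrightarrow> l2_inner (surface_on B) g (mortar_on P i \<mu>)
      = (\<Sum>e\<in>{e \<in> interfaces P. i = fst e \<or> i = snd e}. l2_inner (surface_on (iface P e)) g (\<mu> e))"
proof -
  let ?E = "{e \<in> interfaces P. i = fst e \<or> i = snd e}"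
  have sub: "iface P e \<subseteq> B" if "e \<in> ?E" for e using iface_borel(2,3)[of P e] B(2) that by auto
  have L: "(\<lambda>x. indicator (iface P e) x * \<mu> e x) \<in> L2 (surface_on B)" if "e \<in> ?E" for e
    using surface_on_indicator(1)[OF iface_borel(1) B(1) sub[OF that]] assms(1) that by simp
  have eq: "mortar_on P i \<mu> = (\<lambda>x. \<Sum>e\<in>?E. indicator (iface P e) x * \<mu> e x)"
    by (simp add: mortar_on_def fun_eq_iff)
  show "mortar_on P i \<mu> \<in> L2 (surface_on B)" unfolding eq using L by (rule L2_sum)
  assume g: "g \<in> L2 (surface_on B)"
  have "l2_inner (surface_on B) g (mortar_on P i \<mu>)
      = (\<Sum>e\<in>?E. l2_inner (surface_on B) g (\<lambda>x. indicator (iface P e) x * \<mu> e x))"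
    unfolding eq using l2_inner_sum_left[of ?E "\<lambda>e x. indicator (iface P e) x * \<mu> e x", OF L g] by (simp add: l2_inner_commute[of _ g])
  also have "\<dots> = (\<Sum>e\<in>?E. l2_inner (surface_on (iface P e)) g (\<mu> e))"
    using surface_on_indicator(2)[OF iface_borel(1) B(1) sub] by (intro sum.cong) auto
  finally show "l2_inner (surface_on B) g (mortar_on P i \<mu>)
      = (\<Sum>e\<in>?E. l2_inner (surface_on (iface P e)) g (\<mu> e))" .
qed

section \<open>The time derivative form in coefficients\<close>

lemma l2_inner_lebesgue_on_cong_AE:
  fixes f g f' g' :: "'a::euclidean_space \<Rightarrow> real"
  assumes S: "S \<in> sets lebesgue" and fg: "f \<in> L2 (lebesgue_on S)" "g \<in> L2 (lebesgue_on S)"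
    and eq: "AE x in lebesgue_on S. f' x = f x" "AE x in lebesgue_on S. g' x = g x"
  shows "l2_inner (lebesgue_on S) f' g' = l2_inner (lebesgue_on S) f g"
proof -
  have "AE x in lebesgue_on S. f x = f' x" "AE x in lebesgue_on S. g x = g' x" using eq by auto
  then have "f' \<in> borel_measurable (lebesgue_on S)" "g' \<in> borel_measurable (lebesgue_on S)"
    using fg by (auto intro: measurable_lebesgue_on_AE[OF S] L2_measurable)
  then show ?thesis using fg eq by (intro l2_inner_cong_AE) (auto intro: L2_measurable)
qed

lemma orthonormal_l2_inner:
  fixes f :: "nat \<Rightarrow> 'a \<Rightarrow> real"
  assumes f: "\<And>l. l < m \<Longrightarrow> f l \<in> L2 M" and orth: "\<And>l l'. l < m \<Longrightarrow> l' < m \<Longrightarrow> l2_inner M (f l) (f l') = (if l = l' then 1 else 0)"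
  shows "l2_inner M (\<lambda>x. \<Sum>l<m. a l * f l x) (\<lambda>x. \<Sum>l<m. b l * f l x) = (\<Sum>l<m. a l * b l)"
proof -
  have L: "(\<lambda>x. \<Sum>l<m. b l *\<^sub>R f l x) \<in> L2 M" using f by (intro L2_sum L2_scaleR) auto
  have "l2_inner M (\<lambda>x. \<Sum>l<m. a l *\<^sub>R f l x) (\<lambda>x. \<Sum>l<m. b l *\<^sub>R f l x)
      = (\<Sum>l<m. a l * l2_inner M (f l) (\<lambda>x. \<Sum>l<m. b l *\<^sub>R f l x))"
    using f L by (intro l2_inner_lincomb_left) auto
  also have "\<dots> = (\<Sum>l<m. a l * b l)"
  proof (rule sum.cong[OF refl])
    fix l assume "l \<in> {..<m}"
    then have l: "l < m" by simp
    have "l2_inner M (f l) (\<lambda>x. \<Sum>l<m. b l *\<^sub>R f l x) = (\<Sum>l'<m. b l' * l2_inner M (f l) (f l'))"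
      using f l by (intro l2_inner_lincomb_right) auto
    also have "\<dots> = (\<Sum>l'<m. if l' = l then b l else 0)" using orth l by (intro sum.cong) auto
    also have "\<dots> = b l" using l by simp
    finally show "a l * l2_inner M (f l) (\<lambda>x. \<Sum>l<m. b l *\<^sub>R f l x) = a l * b l" by simp
  qed
  finally show ?thesis by simp
qed

text \<open>Orthonormality in space decouples the form into scalar ones for the coefficient functions.\<close>

lemma dg_time_form_expansion:
  fixes S :: "'a::euclidean_space set" and m :: nat
  assumes t: "time_partition T N t" and S: "S \<in> sets lebesgue"
    and f: "\<And>l. l < m \<Longrightarrow> f l \<in> L2 (lebesgue_on S)"
    and orth: "\<And>l l'. l < m \<Longrightarrow> l' < m \<Longrightarrow> l2_inner (lebesgue_on S) (f l) (f l') = (if l = l' then 1 else 0)"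
    and PW: "\<And>l. l < m \<Longrightarrow> P l \<in> dg_space q N t" "\<And>l. l < m \<Longrightarrow> W l \<in> dg_space q N t"
    and p: "AE x in lebesgue_on S. \<forall>s. p s x = (\<Sum>l<m. P l s * f l x)"
    and w: "AE x in lebesgue_on S. \<forall>s. w s x = (\<Sum>l<m. W l s * f l x)"
  shows "dg_time_form (lebesgue_on S) N t (\<lambda>x. 0) p w = (\<Sum>l<m. scalar_dg_form N t (P l) (W l))"
proof -
  let ?M = "lebesgue_on S"
  have comb: "(\<lambda>x. \<Sum>l<m. c l * f l x) \<in> L2 ?M" for c
    using L2_sum[of "{..<m}" "\<lambda>l x. c l *\<^sub>R f l x" ?M] L2_scaleR[OF f] by simp
  have expand: "l2_inner ?M g h = (\<Sum>l<m. a l * b l)"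
    if "AE x in ?M. g x = (\<Sum>l<m. a l * f l x)" "AE x in ?M. h x = (\<Sum>l<m. b l * f l x)" for g h a b
    using l2_inner_lebesgue_on_cong_AE[OF S comb comb that] orthonormal_l2_inner[of m f ?M a b] f orth by simp
  have "\<forall>l\<in>{..<m}. \<exists>r. dg_polys q N t r (P l)" using PW(1) dg_space_polys by blast
  then obtain a where a: "\<And>l. l < m \<Longrightarrow> dg_polys q N t (a l) (P l)" by (metis lessThan_iff)
  have "\<forall>l\<in>{..<m}. \<exists>r. dg_polys q N t r (W l)" using PW(2) dg_space_polys by blast
  then obtain b where b: "\<And>l. l < m \<Longrightarrow> dg_polys q N t (b l) (W l)" by (metis lessThan_iff)
  have d: "l2_inner ?M (\<lambda>x. deriv (\<lambda>\<tau>. p \<tau> x) s) (w s) = (\<Sum>l<m. deriv (P l) s * W l s)"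
    if k: "k < N" and s: "s \<in> {t k<..<t (Suc k)}" for k s
  proof (rule expand)
    show "AE x in ?M. deriv (\<lambda>\<tau>. p \<tau> x) s = (\<Sum>l<m. deriv (P l) s * f l x)"
      using p
    proof eventually_elim
      case (elim x)
      have "(P l has_real_derivative deriv (P l) s) (at s)" if "l < m" for l
        using dg_polys_deriv[OF a[OF that] k s] by simp
      then have "((\<lambda>\<tau>. \<Sum>l<m. P l \<tau> * f l x) has_real_derivative (\<Sum>l<m. deriv (P l) s * f l x)) (at s)"
        by (intro DERIV_sum DERIV_cmult_right) auto
      then show ?case using elim by (simp add: DERIV_imp_deriv)
    qed
    show "AE x in ?M. w s x = (\<Sum>l<m. W l s * f l x)" using w by eventually_elim simp
  qed
  have lim: "Lim (at_right (t k)) (\<lambda>s. \<Sum>l<m. Q l s * f l x) = (\<Sum>l<m. Lim (at_right (t k)) (Q l) * f l x)"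
    if "k < N" "\<And>l. l < m \<Longrightarrow> dg_polys q N t (c l) (Q l)" for k x Q c
  proof (rule tendsto_Lim)
    show "((\<lambda>s. \<Sum>l<m. Q l s * f l x) \<longlongrightarrow> (\<Sum>l<m. Lim (at_right (t k)) (Q l) * f l x)) (at_right (t k))"
      using dg_polys_right_lim[OF t that(2) that(1)] dg_polys_lims(1)[OF t that(2) that(1)]
      by (intro tendsto_sum tendsto_mult_right) simp
  qed simp
  have right_p: "AE x in ?M. right_val t p k x = (\<Sum>l<m. Lim (at_right (t k)) (P l) * f l x)" if k: "k < N" for k
    using p by eventually_elim (simp add: right_val_def lim[OF k a])
  have right_w: "AE x in ?M. right_val t w k x = (\<Sum>l<m. Lim (at_right (t k)) (W l) * f l x)" if k: "k < N" for k
    using w by eventually_elim (simp add: right_val_def lim[OF k b])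
  have left_p: "AE x in ?M. left_val t (\<lambda>x. 0) p k x = (\<Sum>l<m. (if k = 0 then 0 else Lim (at_left (t k)) (P l)) * f l x)"
    if k: "k < N" for k
    using p
  proof eventually_elim
    case (elim x)
    show ?case
    proof (cases k)
      case (Suc k')
      then have k': "k' < N" using k by simp
      have lim': "(P l \<longlongrightarrow> Lim (at_left (t k)) (P l)) (at_left (t k))" if "l < m" for l
      proof -
        have "(P l \<longlongrightarrow> poly (a l k') (t k)) (at_left (t k))"
          using dg_polys_left_lim[OF t a[OF that] k'] Suc by simp
        moreover from this have "Lim (at_left (t k)) (P l) = poly (a l k') (t k)" by (intro tendsto_Lim) auto
        ultimately show ?thesis by simp
      qed
      have "((\<lambda>s. \<Sum>l<m. P l s * f l x) \<longlongrightarrow> (\<Sum>l<m. Lim (at_left (t k)) (P l) * f l x)) (at_left (t k))"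
        using lim' by (intro tendsto_sum tendsto_mult_right) simp
      then have "Lim (at_left (t k)) (\<lambda>s. \<Sum>l<m. P l s * f l x) = (\<Sum>l<m. Lim (at_left (t k)) (P l) * f l x)"
        by (intro tendsto_Lim) auto
      with Suc elim show ?thesis by (simp add: left_val_def)
    qed (simp add: left_val_def)
  qed
  let ?j = "\<lambda>k l. Lim (at_right (t k)) (P l) - (if k = 0 then 0 else Lim (at_left (t k)) (P l))"
  have jump: "l2_inner ?M (\<lambda>x. right_val t p k x - left_val t (\<lambda>x. 0) p k x) (right_val t w k)
      = (\<Sum>l<m. ?j k l * Lim (at_right (t k)) (W l))" if k: "k < N" for k
  proof (rule expand[OF _ right_w[OF k]])
    show "AE x in ?M. right_val t p k x - left_val t (\<lambda>x. 0) p k x = (\<Sum>l<m. ?j k l * f l x)"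
      using right_p[OF k] left_p[OF k]
      by eventually_elim (simp add: left_diff_distrib sum_subtractf)
  qed
  have integ: "(LINT s|lebesgue_on {t k<..<t (Suc k)}. l2_inner ?M (\<lambda>x. deriv (\<lambda>\<tau>. p \<tau> x) s) (w s))
      = (\<Sum>l<m. LINT s|lebesgue_on {t k<..<t (Suc k)}. deriv (P l) s * W l s)" if k: "k < N" for k
  proof -
    have "(LINT s|lebesgue_on {t k<..<t (Suc k)}. l2_inner ?M (\<lambda>x. deriv (\<lambda>\<tau>. p \<tau> x) s) (w s))
      = (LINT s|lebesgue_on {t k<..<t (Suc k)}. (\<Sum>l<m. deriv (P l) s * W l s))"
      using d[OF k] by (intro Bochner_Integration.integral_cong) auto
    also have "\<dots> = (\<Sum>l<m. LINT s|lebesgue_on {t k<..<t (Suc k)}. deriv (P l) s * W l s)"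
    proof (rule Bochner_Integration.integral_sum)
      fix l assume "l \<in> {..<m}"
      then have l: "l < m" by simp
      have "integrable (lebesgue_on {t k<..<t (Suc k)}) (\<lambda>s. poly (pderiv (a l k)) s * poly (b l k) s)"
        by (intro continuous_integrable_open_interval continuous_intros)
      then show "integrable (lebesgue_on {t k<..<t (Suc k)}) (\<lambda>s. deriv (P l) s * W l s)"
        by (rule Bochner_Integration.integrable_cong[THEN iffD1, rotated 2])
          (use dg_polys_deriv(2)[OF a[OF l] k] b[OF l] k in \<open>auto simp: dg_polys_def\<close>)
    qed
    finally show ?thesis .
  qed
  have "dg_time_form ?M N t (\<lambda>x. 0) p w
     = (\<Sum>k<N. \<Sum>l<m. LINT s|lebesgue_on {t k<..<t (Suc k)}. deriv (P l) s * W l s)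
       + (\<Sum>k<N. \<Sum>l<m. ?j k l * Lim (at_right (t k)) (W l))"
    unfolding dg_time_form_def by (simp add: sum.atLeast1_atMost_eq integ jump)
  also have "\<dots> = (\<Sum>l<m. \<Sum>k<N. LINT s|lebesgue_on {t k<..<t (Suc k)}. deriv (P l) s * W l s)
       + (\<Sum>l<m. \<Sum>k<N. ?j k l * Lim (at_right (t k)) (W l))"
    by (intro arg_cong2[of _ _ _ _ "(+)"] sum.swap)
  also have "\<dots> = (\<Sum>l<m. scalar_dg_form N t (P l) (W l))"
    unfolding scalar_dg_form_def by (simp add: sum.atLeast1_atMost_eq sum.distrib cong: if_cong)
  finally show ?thesis .
qed

section \<open>The discrete problem on one subdomain\<close>

text \<open>The velocity and pressure spaces of a subdomain come with orthonormal bases \<open>e\<close> and \<open>f\<close>.  All forms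
  are evaluated through the coefficients with respect to them, which are functions of time.\<close>

locale subdomain_discretization =
  fixes P :: "'n::finite problem" and D :: "'n discretization" and i :: nat
    and n :: nat and e :: "nat \<Rightarrow> real^'n \<Rightarrow> real^'n" and m :: nat and f :: "nat \<Rightarrow> real^'n \<Rightarrow> real"
  assumes card: "CARD('n) \<ge> 2"
    and P: "valid_problem P" and D: "valid_discretization P D" and i: "i < num_sub P"
    and e: "l2_basis (lebesgue_on (sub P i)) (vel_space D i) n e"
    and f: "l2_basis (lebesgue_on (sub P i)) (pres_space D i) m f"
    and time_cond: "\<And>a. a \<in> interfaces P \<Longrightarrow> i = fst a \<or> i = snd a \<Longrightarrow>
        mortar_time_space D a \<subseteq> sub_time_space P D i"
begin

abbreviation "\<Omega> \<equiv> lebesgue_on (sub P i)"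
abbreviation "I \<equiv> lebesgue_on {0<..<final_time P}"
abbreviation "V \<equiv> vel_space D i"
abbreviation "W \<equiv> pres_space D i"
abbreviation "\<Psi> \<equiv> sub_time_space P D i"
abbreviation "adjacent \<equiv> {a \<in> interfaces P. i = fst a \<or> i = snd a}"

lemma domain: "polytopal_lipschitz_domain (sub P i)" "open (sub P i)" "sub P i \<in> sets lebesgue"
proof -
  show *: "polytopal_lipschitz_domain (sub P i)" using P i by (simp add: valid_problem_def)
  then show "open (sub P i)" by (simp add: polytopal_lipschitz_domain_def)
  then show "sub P i \<in> sets lebesgue" by simp
qed

lemma partitions: "spatial_partition (sub P i) (mesh D i)" "time_partition (final_time P) (steps D i) (node D i)"
  using D i by (simp_all add: valid_discretization_def)

lemma mixed: "mixed_pair (sub P i) (mesh D i) V W"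
  using D i by (simp add: valid_discretization_def)

lemma velocity_space: "finite_dim_space V" "V \<subseteq> Hdiv (sub P i)" "V \<subseteq> L2 \<Omega>" "\<And>v. v \<in> V \<Longrightarrow> piecewise_polynomial (mesh D i) v"
  using mixed Hdiv_weak_div(2) by (auto simp: mixed_pair_def)

lemma pressure_space: "finite_dim_space W" "W \<subseteq> L2 \<Omega>"
  using mixed by (auto simp: mixed_pair_def)

lemma time_space: "lincomb_closed \<Psi>" "\<Psi> \<subseteq> L2 I"
  unfolding sub_time_space_def using lincomb_closed_dg_space dg_space_L2[OF partitions(2)] by auto

lemma basis_in: "j < n \<Longrightarrow> e j \<in> V" "l < m \<Longrightarrow> f l \<in> W"
  using e f by (auto simp: l2_basis_def)

definition coef :: "(real \<Rightarrow> real^'n \<Rightarrow> real^'n) \<Rightarrow> nat \<Rightarrow> real \<Rightarrow> real" where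
  "coef v j = (\<lambda>t. l2_inner \<Omega> (v t) (e j))"

definition pcoef :: "(real \<Rightarrow> real^'n \<Rightarrow> real) \<Rightarrow> nat \<Rightarrow> real \<Rightarrow> real" where
  "pcoef p l = (\<lambda>t. l2_inner \<Omega> (p t) (f l))"

text \<open>The coefficient functions of the pairing with \<open>\<mu>\<close>, as a functional of the velocity.\<close>

definition load :: "(nat \<times> nat \<Rightarrow> real \<Rightarrow> real^'n \<Rightarrow> real) \<Rightarrow> nat \<Rightarrow> real \<Rightarrow> real" where
  "load \<mu> j = (\<lambda>t. flux_pairing P D i (e j) (\<lambda>a. \<mu> a t))"

lemma coef_in: "v \<in> vel_st P D i \<Longrightarrow> j < n \<Longrightarrow> coef v j \<in> \<Psi>" "v \<in> vel_st P D i \<Longrightarrow> j < n \<Longrightarrow> coef v j \<in> L2 I"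
proof -
  show *: "coef v j \<in> \<Psi>" if "v \<in> vel_st P D i" "j < n"
    unfolding coef_def using that velocity_space basis_in
    by (intro tensor_space_coefficient[OF time_space(1), of _ "V"]) (auto simp: vel_st_def)
  show "v \<in> vel_st P D i \<Longrightarrow> j < n \<Longrightarrow> coef v j \<in> L2 I" using * time_space(2) by blast
qed

lemma pcoef_in: "p \<in> pres_st P D i \<Longrightarrow> l < m \<Longrightarrow> pcoef p l \<in> \<Psi>" "p \<in> pres_st P D i \<Longrightarrow> l < m \<Longrightarrow> pcoef p l \<in> L2 I"
proof -
  show *: "pcoef p l \<in> \<Psi>" if "p \<in> pres_st P D i" "l < m"
    unfolding pcoef_def using that pressure_space basis_in
    by (intro tensor_space_coefficient[OF time_space(1), of _ "W"]) (auto simp: pres_st_def)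
  show "p \<in> pres_st P D i \<Longrightarrow> l < m \<Longrightarrow> pcoef p l \<in> L2 I" using * time_space(2) by blast
qed

lemma slice: "v \<in> vel_st P D i \<Longrightarrow> v t \<in> V" "p \<in> pres_st P D i \<Longrightarrow> p t \<in> W"
  using tensor_space_slice[OF velocity_space(1)] tensor_space_slice[OF pressure_space(1)] by (auto simp: vel_st_def pres_st_def)

lemma expand:
  "v \<in> V \<Longrightarrow> AE x in \<Omega>. v x = (\<Sum>j<n. l2_inner \<Omega> v (e j) *\<^sub>R e j x)"
  "w \<in> W \<Longrightarrow> AE x in \<Omega>. w x = (\<Sum>l<m. l2_inner \<Omega> w (f l) *\<^sub>R f l x)"
  using e f by (auto simp: l2_basis_def)

lemma synthesis:
  assumes "\<And>j. j < n \<Longrightarrow> U j \<in> \<Psi>"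
  shows "(\<lambda>t x. \<Sum>j<n. U j t *\<^sub>R e j x) \<in> vel_st P D i"
    "j < n \<Longrightarrow> coef (\<lambda>t x. \<Sum>j<n. U j t *\<^sub>R e j x) j = U j"
  using tensor_space_intro[of n U "\<Psi>" e "V"] assms basis_in(1) l2_basis_coefficient[OF e velocity_space(3)]
  by (auto simp: vel_st_def coef_def fun_eq_iff)

lemma psynthesis:
  assumes "\<And>l. l < m \<Longrightarrow> U l \<in> \<Psi>"
  shows "(\<lambda>t x. \<Sum>l<m. U l t *\<^sub>R f l x) \<in> pres_st P D i"
    "l < m \<Longrightarrow> pcoef (\<lambda>t x. \<Sum>l<m. U l t *\<^sub>R f l x) l = U l"
  using tensor_space_intro[of m U "\<Psi>" f "W"] assms basis_in(2) l2_basis_coefficient[OF f pressure_space(2)]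
  by (auto simp: pres_st_def pcoef_def fun_eq_iff)

lemma time_form_bilinear:
  fixes c d :: "nat \<Rightarrow> real \<Rightarrow> real"
  assumes s: "\<And>t. s (u t) (v t) = (\<Sum>j<n'. \<Sum>k<m'. A j k * (c j t * d k t))"
    and cd: "\<And>j. j < n' \<Longrightarrow> c j \<in> L2 I" "\<And>k. k < m' \<Longrightarrow> d k \<in> L2 I"
  shows "time_form (final_time P) s u v = (\<Sum>j<n'. \<Sum>k<m'. A j k * l2_inner I (c j) (d k))"
    "integrable I (\<lambda>t. s (u t) (v t))"
proof -
  have int: "integrable I (\<lambda>t. A j k * (c j t * d k t))" if "j < n'" "k < m'" for j k
    using L2_mult_integrable[OF cd(1)[OF that(1)] cd(2)[OF that(2)]] by simp
  have int': "integrable I (\<lambda>t. \<Sum>k<m'. A j k * (c j t * d k t))" if "j < n'" for j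
    by (rule Bochner_Integration.integrable_sum) (rule int[OF that], simp)
  show "integrable I (\<lambda>t. s (u t) (v t))"
    unfolding s by (rule Bochner_Integration.integrable_sum) (rule int', simp)
  have "time_form (final_time P) s u v = (\<Sum>j<n'. LINT t|I. (\<Sum>k<m'. A j k * (c j t * d k t)))"
    unfolding time_form_def s by (rule Bochner_Integration.integral_sum) (rule int', simp)
  also have "\<dots> = (\<Sum>j<n'. \<Sum>k<m'. LINT t|I. A j k * (c j t * d k t))"
    by (rule sum.cong[OF refl], rule Bochner_Integration.integral_sum) (rule int, simp_all)
  finally show "time_form (final_time P) s u v = (\<Sum>j<n'. \<Sum>k<m'. A j k * l2_inner I (c j) (d k))"
    by (simp add: l2_inner_def)
qed

lemma a_expand:
  assumes "u \<in> vel_st P D i" "v \<in> vel_st P D i"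
  shows "a_form P i (u t) (v t) = (\<Sum>j<n. \<Sum>k<n. a_form P i (e j) (e k) * (coef u j t * coef v k t))"
  unfolding coef_def using assms slice velocity_space(3) basis_in(1) expand(1)
  by (intro a_form_lincomb[OF P i]) auto

lemma a_time:
  assumes "u \<in> vel_st P D i" "v \<in> vel_st P D i"
  shows "time_form (final_time P) (a_form P i) u v
    = (\<Sum>j<n. \<Sum>k<n. a_form P i (e j) (e k) * l2_inner I (coef u j) (coef v k))"
  by (rule time_form_bilinear(1)[where s = "a_form P i" and A = "\<lambda>j k. a_form P i (e j) (e k)" and c = "coef u" and d = "coef v"])
    (use assms coef_in a_expand in auto)

lemma b_expand:
  assumes v: "v \<in> V" and w: "w \<in> W"
  shows "b_form P i v w = (\<Sum>j<n. \<Sum>l<m. b_form P i (e j) (f l) * (l2_inner \<Omega> v (e j) * l2_inner \<Omega> w (f l)))"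
proof -
  let ?d = "weak_div (sub P i)"
  have He: "e j \<in> Hdiv (sub P i)" if "j < n" for j using basis_in(1)[OF that] velocity_space(2) by blast
  have dL: "?d (e j) \<in> L2 \<Omega>" if "j < n" for j using Hdiv_weak_div(3)[OF He[OF that]] .
  have fL: "f l \<in> L2 \<Omega>" if "l < m" for l using basis_in(2)[OF that] pressure_space(2) by blast
  have vH: "v \<in> Hdiv (sub P i)" using v velocity_space(2) by blast
  have d: "AE x in \<Omega>. ?d v x = (\<Sum>j<n. l2_inner \<Omega> v (e j) *\<^sub>R ?d (e j) x)"
    using He vH expand(1)[OF v] by (intro weak_div_lincomb_AE[OF domain(2)]) auto
  have sL: "(\<lambda>x. \<Sum>j<n. l2_inner \<Omega> v (e j) *\<^sub>R ?d (e j) x) \<in> L2 \<Omega>" using dL by (intro L2_sum L2_scaleR) auto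
  have wL: "(\<lambda>x. \<Sum>l<m. l2_inner \<Omega> w (f l) *\<^sub>R f l x) \<in> L2 \<Omega>" using fL by (intro L2_sum L2_scaleR) auto
  have "l2_inner \<Omega> (?d v) w = l2_inner \<Omega> (\<lambda>x. \<Sum>j<n. l2_inner \<Omega> v (e j) *\<^sub>R ?d (e j) x)
      (\<lambda>x. \<Sum>l<m. l2_inner \<Omega> w (f l) *\<^sub>R f l x)"
    using sL wL Hdiv_weak_div(3)[OF vH] w pressure_space(2) d expand(2)[OF w] by (intro l2_inner_cong_AE L2_measurable) auto
  also have "\<dots> = (\<Sum>j<n. l2_inner \<Omega> v (e j) * l2_inner \<Omega> (?d (e j)) (\<lambda>x. \<Sum>l<m. l2_inner \<Omega> w (f l) *\<^sub>R f l x))"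
    using dL wL by (intro l2_inner_lincomb_left) auto
  also have "\<dots> = (\<Sum>j<n. l2_inner \<Omega> v (e j) * (\<Sum>l<m. l2_inner \<Omega> w (f l) * l2_inner \<Omega> (?d (e j)) (f l)))"
  proof (rule sum.cong[OF refl])
    fix j assume "j \<in> {..<n}"
    then have "l2_inner \<Omega> (?d (e j)) (\<lambda>x. \<Sum>l<m. l2_inner \<Omega> w (f l) *\<^sub>R f l x)
        = (\<Sum>l<m. l2_inner \<Omega> w (f l) * l2_inner \<Omega> (?d (e j)) (f l))"
      using dL fL by (intro l2_inner_lincomb_right) auto
    then show "l2_inner \<Omega> v (e j) * l2_inner \<Omega> (?d (e j)) (\<lambda>x. \<Sum>l<m. l2_inner \<Omega> w (f l) *\<^sub>R f l x)
        = l2_inner \<Omega> v (e j) * (\<Sum>l<m. l2_inner \<Omega> w (f l) * l2_inner \<Omega> (?d (e j)) (f l))" by simp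
  qed
  finally show ?thesis
    by (simp add: b_form_def sum_distrib_left sum_negf mult_ac)
qed

lemma b_time:
  assumes "v \<in> vel_st P D i" "p \<in> pres_st P D i"
  shows "time_form (final_time P) (b_form P i) v p
    = (\<Sum>j<n. \<Sum>l<m. b_form P i (e j) (f l) * l2_inner I (coef v j) (pcoef p l))"
  by (rule time_form_bilinear(1)[where s = "b_form P i" and A = "\<lambda>j l. b_form P i (e j) (f l)" and c = "coef v" and d = "pcoef p"]) (use assms coef_in pcoef_in slice b_expand in \<open>auto simp: coef_def pcoef_def\<close>)

lemma dg_time:
  assumes "p \<in> pres_st P D i" "w \<in> pres_st P D i"
  shows "dg_time_form \<Omega> (steps D i) (node D i) (\<lambda>x. 0) p w
    = (\<Sum>l<m. scalar_dg_form (steps D i) (node D i) (pcoef p l) (pcoef w l))"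
proof (rule dg_time_form_expansion[OF partitions(2) domain(3)])
  show "f l \<in> L2 \<Omega>" if "l < m" for l using basis_in(2)[OF that] pressure_space(2) by blast
  show "l2_inner \<Omega> (f l) (f l') = (if l = l' then 1 else 0)" if "l < m" "l' < m" for l l'
    using f that by (simp add: l2_basis_def)
  show "pcoef p l \<in> dg_space (time_degree P i) (steps D i) (node D i)"
    "pcoef w l \<in> dg_space (time_degree P i) (steps D i) (node D i)" if "l < m" for l
    using pcoef_in(1)[OF _ that] assms by (auto simp: sub_time_space_def)
  show "AE x in \<Omega>. \<forall>s. p s x = (\<Sum>l<m. pcoef p l s * f l x)"
    using tensor_space_expansion[OF f pressure_space(2), of p "\<Psi>"] assms(1) by (simp add: pres_st_def pcoef_def)
  show "AE x in \<Omega>. \<forall>s. w s x = (\<Sum>l<m. pcoef w l s * f l x)"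
    using tensor_space_expansion[OF f pressure_space(2), of w "\<Psi>"] assms(2) by (simp add: pres_st_def pcoef_def)
qed

lemma trace_L2:
  assumes "v \<in> V" "A \<in> sets borel" "A \<subseteq> frontier (sub P i)"
  shows "normal_trace P D i v \<in> L2 (surface_on A)"
  using normal_trace_L2[OF card partitions(1) domain(1) velocity_space(4)[OF assms(1)] assms(2,3)] .

lemma iface_adjacent: "a \<in> adjacent \<Longrightarrow> iface P a \<subseteq> frontier (sub P i)"
  using iface_borel(2,3)[of P a] bdry_borel(2)[of P i] by auto

lemma trace_lincomb:
  fixes n' :: nat
  assumes "\<And>k. k < n' \<Longrightarrow> v k \<in> V"
  shows "normal_trace P D i (\<lambda>x. \<Sum>k<n'. c k *\<^sub>R v k x) = (\<lambda>x. \<Sum>k<n'. c k * normal_trace P D i (v k) x)"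
  using normal_trace_lincomb[OF partitions(1), of "{..<n'}" v c] velocity_space(4) assms by (auto simp: fun_eq_iff)

text \<open>The defect of the expansion belongs to the velocity space and vanishes almost everywhere, so its trace
  is zero.\<close>

lemma trace_expand:
  assumes v: "v \<in> V"
  shows "normal_trace P D i v = (\<lambda>x. \<Sum>j<n. l2_inner \<Omega> v (e j) * normal_trace P D i (e j) x)"
proof
  fix x
  \<comment> \<open>The defect as a single linear combination of \<open>Suc n\<close> elements of the velocity space.\<close>
  define v' where "v' k = (if k < n then e k else v)" for k
  define c where "c k = (if k < n then - l2_inner \<Omega> v (e k) else 1)" for k
  have v': "v' k \<in> V" if "k < Suc n" for k using basis_in(1) v by (simp add: v'_def)
  have "(\<lambda>x. \<Sum>k<Suc n. c k *\<^sub>R v' k x) \<in> V" using v' by (intro finite_dim_space_lincomb[OF velocity_space(1)]) auto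
  moreover have "AE x in \<Omega>. (\<Sum>k<Suc n. c k *\<^sub>R v' k x) = 0"
    using expand(1)[OF v] by eventually_elim (simp add: c_def v'_def sum_negf)
  ultimately have "normal_trace P D i (\<lambda>x. \<Sum>k<Suc n. c k *\<^sub>R v' k x) x = 0"
    by (intro normal_trace_AE_zero[OF partitions(1) domain(1)] velocity_space(4))
  then have "(\<Sum>k<Suc n. c k * normal_trace P D i (v' k) x) = 0"
    using trace_lincomb[of "Suc n" v' c] v' by simp
  then show "normal_trace P D i v x = (\<Sum>j<n. l2_inner \<Omega> v (e j) * normal_trace P D i (e j) x)"
    by (simp add: c_def v'_def sum_negf)
qed

definition mortar_L2 :: "(nat \<times> nat \<Rightarrow> real^'n \<Rightarrow> real) \<Rightarrow> bool" where
  "mortar_L2 \<mu> \<longleftrightarrow> (\<forall>a\<in>interfaces P. \<mu> a \<in> L2 (surface_on (iface P a)))"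

lemma mortar_space_facts:
  assumes "a \<in> interfaces P"
  shows "finite_dim_space (mortar_space D a)" "mortar_space D a \<subseteq> L2 (surface_on (iface P a))"
    "finite_dim_space (mortar_time_space D a)"
  using D assms by (auto simp: valid_discretization_def)

lemma mortar_slice: "\<mu> \<in> mortar_st P D \<Longrightarrow> a \<in> interfaces P \<Longrightarrow> \<mu> a t \<in> mortar_space D a"
  by (rule tensor_space_slice[OF mortar_space_facts(1)]) (auto simp: mortar_st_def)

lemma mortar_slice_L2: "\<mu> \<in> mortar_st P D \<Longrightarrow> mortar_L2 (\<lambda>a. \<mu> a t)"
  unfolding mortar_L2_def using mortar_slice mortar_space_facts(2) by blast

lemma flux_interfaces:
  assumes "v \<in> V" "mortar_L2 \<mu>"
  shows "flux_pairing P D i v \<mu> = (\<Sum>a\<in>adjacent. l2_inner (surface_on (iface P a)) (normal_trace P D i v) (\<mu> a))"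
  unfolding flux_pairing_def
  using mortar_on_L2(2)[OF _ bdry_borel(1) order_refl, of P \<mu> "normal_trace P D i v" i] assms trace_L2[OF assms(1) bdry_borel]
  by (simp add: mortar_L2_def)

lemma flux_expand:
  assumes "v \<in> V" "mortar_L2 \<mu>"
  shows "flux_pairing P D i v \<mu> = (\<Sum>j<n. l2_inner \<Omega> v (e j) * flux_pairing P D i (e j) \<mu>)"
proof -
  have L: "normal_trace P D i (e j) \<in> L2 (surface_on (bdry P i))" if "j < n" for j
    using trace_L2[OF basis_in(1)[OF that] bdry_borel] .
  have mL: "mortar_on P i \<mu> \<in> L2 (surface_on (bdry P i))"
    using assms(2) by (intro mortar_on_L2(1)[OF _ bdry_borel(1)]) (auto simp: mortar_L2_def)
  have "normal_trace P D i v = (\<lambda>x. \<Sum>j<n. l2_inner \<Omega> v (e j) *\<^sub>R normal_trace P D i (e j) x)"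
    using trace_expand[OF assms(1)] by simp
  then show ?thesis
    unfolding flux_pairing_def
    using l2_inner_lincomb_left[of "{..<n}" "\<lambda>j. normal_trace P D i (e j)", OF _ mL] L by simp
qed

lemma finite_adjacent: "finite adjacent"
  by (rule finite_subset[OF _ finite_interfaces[of P]]) auto

text \<open>Here the temporal mortar condition enters: pairings with \<open>\<mu>\<close> are temporal functions of the mortar space
  of an interface, hence of the space of the subdomain.\<close>

lemma load_in:
  assumes \<mu>: "\<mu> \<in> mortar_st P D" and j: "j < n"
  shows "load \<mu> j \<in> \<Psi>"
proof -
  let ?g = "\<lambda>a t. l2_inner (surface_on (iface P a)) (\<mu> a t) (normal_trace P D i (e j))"
  have "?g a \<in> \<Psi>" if a: "a \<in> adjacent" for a
  proof -
    have ai: "a \<in> interfaces P" using a by simp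
    have "?g a \<in> mortar_time_space D a"
      using \<mu> ai mortar_space_facts[OF ai] trace_L2[OF basis_in(1)[OF j] iface_borel(1) iface_adjacent[OF a]]
      by (intro tensor_space_coefficient[where V = "mortar_space D a"] lincomb_closed_finite_dim) (auto simp: mortar_st_def)
    then show ?thesis using time_cond[of a] a by blast
  qed
  then have "(\<lambda>t. \<Sum>a\<in>adjacent. 1 * ?g a t) \<in> \<Psi>"
    unfolding sub_time_space_def using finite_adjacent by (intro dg_space_lincomb) auto
  moreover have "load \<mu> j = (\<lambda>t. \<Sum>a\<in>adjacent. 1 * ?g a t)"
    unfolding load_def using flux_interfaces[OF basis_in(1)[OF j] mortar_slice_L2[OF \<mu>]]
    by (simp add: l2_inner_commute fun_eq_iff)
  ultimately show ?thesis by simp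
qed

lemma flux_time:
  assumes v: "v \<in> vel_st P D i" and \<mu>: "\<mu> \<in> mortar_st P D"
  shows "flux_pairing_st P D i v \<mu> = (\<Sum>j<n. l2_inner I (coef v j) (load \<mu> j))"
proof -
  have "flux_pairing P D i (v t) (\<lambda>a. \<mu> a t) = (\<Sum>j<n. coef v j t * load \<mu> j t)" for t
    using flux_expand[OF slice(1)[OF v] mortar_slice_L2[OF \<mu>]] by (simp add: coef_def load_def)
  then have "flux_pairing_st P D i v \<mu> = (LINT t|I. (\<Sum>j<n. coef v j t * load \<mu> j t))"
    by (simp add: flux_pairing_st_def time_form_def)
  also have "\<dots> = (\<Sum>j<n. LINT t|I. coef v j t * load \<mu> j t)"
    using coef_in(2)[OF v] load_in[OF \<mu>] time_space(2)
    by (intro Bochner_Integration.integral_sum L2_mult_integrable) auto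
  finally show ?thesis by (simp add: l2_inner_def)
qed

lemma a_matrix:
  shows "0 \<le> (\<Sum>j<n. \<Sum>k<n. a_form P i (e j) (e k) * (c j * c k))"
    "(\<Sum>j<n. \<Sum>k<n. a_form P i (e j) (e k) * (c j * c k)) = 0 \<Longrightarrow> \<forall>k<n. c k = 0"
proof -
  define w where "w = (\<lambda>x. \<Sum>j<n. c j *\<^sub>R e j x)"
  have eL: "e j \<in> L2 \<Omega>" if "j < n" for j using basis_in(1)[OF that] velocity_space(3) by blast
  have wL: "w \<in> L2 \<Omega>" unfolding w_def using eL by (intro L2_sum L2_scaleR) auto
  have eq: "a_form P i w w = (\<Sum>j<n. \<Sum>k<n. a_form P i (e j) (e k) * (c j * c k))"
    using eL wL by (intro a_form_lincomb[OF P i]) (auto simp: w_def)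
  show "0 \<le> (\<Sum>j<n. \<Sum>k<n. a_form P i (e j) (e k) * (c j * c k))"
    using a_form_self(1)[OF P i wL] eq by simp
  assume "(\<Sum>j<n. \<Sum>k<n. a_form P i (e j) (e k) * (c j * c k)) = 0"
  then have w0: "AE x in \<Omega>. w x = 0" using a_form_self(2)[OF P i wL] eq by simp
  have "c k = 0" if k: "k < n" for k
  proof -
    have "c k = l2_inner \<Omega> w (e k)" unfolding w_def using l2_basis_coefficient[OF e velocity_space(3) k] by simp
    also have "\<dots> = l2_inner \<Omega> (\<lambda>_. 0) (e k)"
      using wL eL[OF k] w0 by (intro l2_inner_cong_AE L2_measurable) auto
    finally show ?thesis by (simp add: l2_inner_def)
  qed
  then show "\<forall>k<n. c k = 0" by blast
qed

text \<open>The coefficient functions of \<open>u\<close> and \<open>p\<close> solve a saddle point problem in time.\<close>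

lemma solution_exists:
  assumes \<mu>: "\<mu> \<in> mortar_st P D"
  shows "\<exists>u p. is_subdomain_solution P D i \<mu> u p"
proof -
  let ?A = "\<lambda>j k. a_form P i (e j) (e k)" and ?B = "\<lambda>j l. b_form P i (e j) (f l)"
  have lL: "load \<mu> j \<in> L2 I" if "j < n" for j using load_in[OF \<mu> that] time_space(2) by blast
  have "\<exists>U Q. (\<forall>j<n. U j \<in> \<Psi>) \<and> (\<forall>l<m. Q l \<in> \<Psi>) \<and>
     (\<forall>V. (\<forall>j<n. V j \<in> \<Psi>) \<longrightarrow>
        (\<Sum>j<n. \<Sum>k<n. ?A j k * l2_inner I (U j) (V k)) + (\<Sum>j<n. \<Sum>l<m. ?B j l * l2_inner I (V j) (Q l))
          = - (\<Sum>j<n. l2_inner I (V j) (load \<mu> j))) \<and>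
     (\<forall>W. (\<forall>l<m. W l \<in> \<Psi>) \<longrightarrow>
        (\<Sum>l<m. scalar_dg_form (steps D i) (node D i) (Q l) (W l)) - (\<Sum>j<n. \<Sum>l<m. ?B j l * l2_inner I (U j) (W l)) = 0)"
    unfolding sub_time_space_def
    by (rule dg_saddle_point_solution_exists[OF partitions(2)]) (fact a_matrix, fact a_matrix, fact lL)
  then obtain U Q where U: "\<forall>j<n. U j \<in> \<Psi>" and Q: "\<forall>l<m. Q l \<in> \<Psi>"
    and eq1: "\<forall>V. (\<forall>j<n. V j \<in> \<Psi>) \<longrightarrow>
        (\<Sum>j<n. \<Sum>k<n. ?A j k * l2_inner I (U j) (V k)) + (\<Sum>j<n. \<Sum>l<m. ?B j l * l2_inner I (V j) (Q l))
          = - (\<Sum>j<n. l2_inner I (V j) (load \<mu> j))"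
    and eq2: "\<forall>W. (\<forall>l<m. W l \<in> \<Psi>) \<longrightarrow>
        (\<Sum>l<m. scalar_dg_form (steps D i) (node D i) (Q l) (W l)) - (\<Sum>j<n. \<Sum>l<m. ?B j l * l2_inner I (U j) (W l)) = 0"
    by (elim exE conjE) (rule that)
  define u where "u = (\<lambda>t x. \<Sum>j<n. U j t *\<^sub>R e j x)"
  define p where "p = (\<lambda>t x. \<Sum>l<m. Q l t *\<^sub>R f l x)"
  have u: "u \<in> vel_st P D i" "\<And>j. j < n \<Longrightarrow> coef u j = U j"
    unfolding u_def using synthesis[of U] U by auto
  have p: "p \<in> pres_st P D i" "\<And>l. l < m \<Longrightarrow> pcoef p l = Q l"
    unfolding p_def using psynthesis[of Q] Q by auto
  have "is_subdomain_solution P D i \<mu> u p"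
    unfolding is_subdomain_solution_def
  proof (intro conjI ballI u(1) p(1))
    fix v assume v: "v \<in> vel_st P D i"
    show "time_form (final_time P) (a_form P i) u v + time_form (final_time P) (b_form P i) v p
          = - flux_pairing_st P D i v \<mu>"
      using eq1[rule_format, of "coef v"] coef_in(1)[OF v] u(2) p(2)
      by (simp add: a_time[OF u(1) v] b_time[OF v p(1)] flux_time[OF v \<mu>])
  next
    fix w assume w: "w \<in> pres_st P D i"
    show "dg_time_form \<Omega> (steps D i) (node D i) (\<lambda>x. 0) p w - time_form (final_time P) (b_form P i) u w = 0"
      using eq2[rule_format, of "pcoef w"] pcoef_in(1)[OF w] u(2) p(2)
      by (simp add: dg_time[OF p(1) w] b_time[OF u(1) w])
  qed
  then show ?thesis by blast
qed

text \<open>The test functions are \<open>u\<close> in the first and \<open>p\<close> in the second equation.\<close>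

lemma solution_energy:
  assumes \<mu>: "\<mu> \<in> mortar_st P D" and sol: "is_subdomain_solution P D i \<mu> u p"
  shows "- flux_pairing_st P D i u \<mu> = time_form (final_time P) (a_form P i) u u
     + (\<Sum>l<m. scalar_dg_form (steps D i) (node D i) (pcoef p l) (pcoef p l))"
    and "0 \<le> time_form (final_time P) (a_form P i) u u"
    and "0 \<le> (\<Sum>l<m. scalar_dg_form (steps D i) (node D i) (pcoef p l) (pcoef p l))"
proof -
  have u: "u \<in> vel_st P D i" and p: "p \<in> pres_st P D i" using sol by (auto simp: is_subdomain_solution_def)
  have "time_form (final_time P) (a_form P i) u u + time_form (final_time P) (b_form P i) u p = - flux_pairing_st P D i u \<mu>"
    "dg_time_form \<Omega> (steps D i) (node D i) (\<lambda>x. 0) p p - time_form (final_time P) (b_form P i) u p = 0"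
    using sol u p by (auto simp: is_subdomain_solution_def)
  then show "- flux_pairing_st P D i u \<mu> = time_form (final_time P) (a_form P i) u u
     + (\<Sum>l<m. scalar_dg_form (steps D i) (node D i) (pcoef p l) (pcoef p l))"
    by (simp add: dg_time[OF p p])
  have "0 \<le> a_form P i (u t) (u t)" for t
    using slice(1)[OF u] velocity_space(3) by (intro a_form_self(1)[OF P i]) auto
  then show "0 \<le> time_form (final_time P) (a_form P i) u u"
    by (simp add: time_form_def)
  show "0 \<le> (\<Sum>l<m. scalar_dg_form (steps D i) (node D i) (pcoef p l) (pcoef p l))"
    using scalar_dg_form_nonneg[OF partitions(2)] pcoef_in(1)[OF p]
    by (intro sum_nonneg) (auto simp: sub_time_space_def)
qed

text \<open>Without energy, \<open>u = 0\<close> by ellipticity.  The second equation, tested in one component at a time, then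
  gives \<open>p = 0\<close>, and the left-hand side of the first equation vanishes for every test function.\<close>

lemma solution_zero_energy:
  assumes \<mu>: "\<mu> \<in> mortar_st P D" and sol: "is_subdomain_solution P D i \<mu> u p"
    and zero: "flux_pairing_st P D i u \<mu> = 0" and v: "v \<in> vel_st P D i"
  shows "flux_pairing_st P D i v \<mu> = 0"
proof -
  have u: "u \<in> vel_st P D i" and p: "p \<in> pres_st P D i" using sol by (auto simp: is_subdomain_solution_def)
  have a0: "(LINT t|I. a_form P i (u t) (u t)) = 0"
    using solution_energy[OF \<mu> sol] zero by (simp add: time_form_def)
  have uL: "u t \<in> L2 \<Omega>" for t using slice(1)[OF u] velocity_space(3) by blast
  have "integrable I (\<lambda>t. a_form P i (u t) (u t))"
    by (rule time_form_bilinear(2)[where s = "a_form P i" and A = "\<lambda>j k. a_form P i (e j) (e k)" and c = "coef u" and d = "coef u"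
          and n' = n and m' = n])
      (use u coef_in a_expand in auto)
  then have "AE t in I. a_form P i (u t) (u t) = 0"
    using a0 a_form_self(1)[OF P i uL] by (subst (asm) integral_nonneg_eq_0_iff_AE) auto
  then have u0: "AE t in I. coef u j t = 0" if j: "j < n" for j
  proof eventually_elim
    case (elim t)
    then have "AE x in \<Omega>. u t x = 0" using a_form_self(2)[OF P i uL] by blast
    then have "l2_inner \<Omega> (u t) (e j) = l2_inner \<Omega> (\<lambda>_. 0) (e j)"
      using uL basis_in(1)[OF j] velocity_space(3) by (intro l2_inner_cong_AE L2_measurable) auto
    then show ?case by (simp add: coef_def l2_inner_def)
  qed
  have cu: "l2_inner I (coef u j) h = 0" if "j < n" "h \<in> L2 I" for j h
  proof -
    have "l2_inner I (coef u j) h = l2_inner I (\<lambda>_. 0) h"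
      using coef_in(2)[OF u that(1)] that(2) u0[OF that(1)] by (intro l2_inner_cong_AE L2_measurable) auto
    then show ?thesis by (simp add: l2_inner_def)
  qed
  have p0: "AE t in I. pcoef p l t = 0" if l: "l < m" for l
  proof -
    have sd: "scalar_dg_form (steps D i) (node D i) (pcoef p l) w = 0" if w: "w \<in> \<Psi>" for w
    proof -
      \<comment> \<open>The test function \<open>w \<otimes> f l\<close> isolates the component \<open>l\<close>.\<close>
      define w' where "w' l' = (if l' = l then w else (\<lambda>_. 0))" for l'
      have z: "(\<lambda>_. 0) \<in> \<Psi>" unfolding sub_time_space_def by (rule dg_space_zero)
      have w': "w' l' \<in> \<Psi>" for l' using w z by (simp add: w'_def)
      define wt where "wt = (\<lambda>t x. \<Sum>l<m. w' l t *\<^sub>R f l x)"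
      have wt: "wt \<in> pres_st P D i" "\<And>l. l < m \<Longrightarrow> pcoef wt l = w' l"
        unfolding wt_def using psynthesis[of w'] w' by auto
      have "dg_time_form \<Omega> (steps D i) (node D i) (\<lambda>x. 0) p wt = time_form (final_time P) (b_form P i) u wt"
        using sol wt(1) by (auto simp: is_subdomain_solution_def)
      also have "\<dots> = 0"
        using cu pcoef_in(2)[OF wt(1)] by (simp add: b_time[OF u wt(1)])
      finally have "(\<Sum>l'<m. scalar_dg_form (steps D i) (node D i) (pcoef p l') (w' l')) = 0"
        by (simp add: dg_time[OF p wt(1)] wt(2))
      moreover have "scalar_dg_form (steps D i) (node D i) (pcoef p l') (\<lambda>_. 0) = 0" if "l' < m" for l'
        using scalar_dg_form_lincomb_right[OF partitions(2), of "{}" "\<lambda>_ _. 0" "time_degree P i" "\<lambda>_. 0" "\<lambda>_. 0" "pcoef p l'"]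
          pcoef_in(1)[OF p that] dg_space_zero by (simp add: sub_time_space_def)
      then have "scalar_dg_form (steps D i) (node D i) (pcoef p l') (w' l')
          = (if l' = l then scalar_dg_form (steps D i) (node D i) (pcoef p l) w else 0)" if "l' < m" for l'
        using that by (simp add: w'_def)
      ultimately show ?thesis using l by simp
    qed
    obtain r where r: "dg_polys (time_degree P i) (steps D i) (node D i) r (pcoef p l)"
      using pcoef_in(1)[OF p l] dg_space_polys unfolding sub_time_space_def by blast
    have "\<forall>k<steps D i. r k = 0"
      using scalar_dg_form_nondegenerate[OF partitions(2) r] sd by (simp add: sub_time_space_def)
    then have "pcoef p l t = 0" if "k < steps D i" "t \<in> {node D i k<..<node D i (Suc k)}" for k t
      using r that by (simp add: dg_polys_def)
    then show ?thesis using time_partition_AE_interval[OF partitions(2)] by (elim AE_mp) (auto intro!: AE_I2)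
  qed
  have cp: "l2_inner I h (pcoef p l) = 0" if "l < m" "h \<in> L2 I" for l h
  proof -
    have "l2_inner I h (pcoef p l) = l2_inner I h (\<lambda>_. 0)"
      using pcoef_in(2)[OF p that(1)] that(2) p0[OF that(1)] by (intro l2_inner_cong_AE L2_measurable) auto
    then show ?thesis by (simp add: l2_inner_def)
  qed
  have "- flux_pairing_st P D i v \<mu>
      = time_form (final_time P) (a_form P i) u v + time_form (final_time P) (b_form P i) v p"
    using sol v by (auto simp: is_subdomain_solution_def)
  also have "\<dots> = 0"
    using cu cp coef_in(2)[OF v] by (simp add: a_time[OF u v] b_time[OF v p])
  finally show ?thesis by simp
qed

text \<open>The test function \<open>\<Sum>j. load \<mu> j \<otimes> e j\<close>, admissible by \<open>load_in\<close>, turns the pairing into the sum of the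
  squared norms of the loads.\<close>

lemma flux_vanishes:
  assumes \<mu>: "\<mu> \<in> mortar_st P D" and zero: "\<And>v. v \<in> vel_st P D i \<Longrightarrow> flux_pairing_st P D i v \<mu> = 0"
  shows "AE t in I. \<forall>v\<in>V. flux_pairing P D i v (\<lambda>a. \<mu> a t) = 0"
proof -
  define v where "v = (\<lambda>t x. \<Sum>j<n. load \<mu> j t *\<^sub>R e j x)"
  have v: "v \<in> vel_st P D i" "\<And>j. j < n \<Longrightarrow> coef v j = load \<mu> j"
    unfolding v_def using synthesis[of "load \<mu>"] load_in[OF \<mu>] by auto
  have "(\<Sum>j<n. l2_inner I (load \<mu> j) (load \<mu> j)) = 0"
    using zero[OF v(1)] v(2) by (simp add: flux_time[OF v(1) \<mu>])
  then have "l2_inner I (load \<mu> j) (load \<mu> j) = 0" if "j < n" for j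
    using that by (subst (asm) sum_nonneg_eq_0_iff) (auto simp: l2_inner_self_nonneg)
  then have "AE t in I. load \<mu> j t = 0" if "j < n" for j
    using that load_in[OF \<mu> that] time_space(2) l2_inner_self_eq_0_iff[of "load \<mu> j" I] by blast
  then have "AE t in I. \<forall>j\<in>{..<n}. load \<mu> j t = 0" by (intro AE_finite_allI) auto
  then show ?thesis
  proof eventually_elim
    case (elim t)
    then show ?case using flux_expand[OF _ mortar_slice_L2[OF \<mu>]] by (simp add: load_def)
  qed
qed

text \<open>The zero function is a projection of \<open>\<mu>\<close>.  Whichever projection is chosen, it is a normal trace and
  orthogonal to all normal traces, so it has norm zero.\<close>

lemma trace_proj_vanishes:
  assumes \<mu>: "mortar_L2 \<mu>" and zero: "\<And>v. v \<in> V \<Longrightarrow> flux_pairing P D i v \<mu> = 0"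
    and A: "A \<in> sets borel" "A \<subseteq> frontier (sub P i)"
  shows "l2_norm (surface_on A) (trace_proj P D i (mortar_on P i \<mu>)) = 0"
proof -
  let ?F = "surface_on (frontier (sub P i))" and ?g = "trace_proj P D i (mortar_on P i \<mu>)"
  have Fb: "frontier (sub P i) \<in> sets borel" by (intro borel_closed) simp
  have tL: "normal_trace P D i v \<in> L2 ?F" if "v \<in> V" for v using trace_L2[OF that Fb] by simp
  have mL: "mortar_on P i \<mu> \<in> L2 ?F"
    using \<mu> bdry_borel(2) by (intro mortar_on_L2(1)[OF _ Fb]) (auto simp: mortar_L2_def)
  have orth: "l2_inner ?F (mortar_on P i \<mu>) (normal_trace P D i v) = 0" if v: "v \<in> V" for v
  proof -
    have "l2_inner ?F (normal_trace P D i v) (mortar_on P i \<mu>)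
        = (\<Sum>a\<in>adjacent. l2_inner (surface_on (iface P a)) (normal_trace P D i v) (\<mu> a))"
      using \<mu> by (intro mortar_on_L2(2) Fb bdry_borel(2) tL[OF v]) (auto simp: mortar_L2_def)
    then show ?thesis
      using zero[OF v] flux_interfaces[OF v \<mu>] by (simp add: l2_inner_commute[of ?F "mortar_on P i \<mu>"])
  qed
  have "normal_trace P D i (\<lambda>x. 0) = (\<lambda>x. 0)" using trace_lincomb[of 0] by simp
  then have "(\<lambda>x. 0) \<in> normal_trace P D i ` V"
    using finite_dim_space_zero[OF velocity_space(1)] by (metis image_eqI)
  then have "\<exists>g. g \<in> normal_trace P D i ` V \<and>
      (\<forall>v\<in>V. l2_inner ?F (\<lambda>x. mortar_on P i \<mu> x - g x) (normal_trace P D i v) = 0)"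
    using orth by (intro exI[of _ "\<lambda>x. 0"]) simp
  then have "?g \<in> normal_trace P D i ` V \<and>
      (\<forall>v\<in>V. l2_inner ?F (\<lambda>x. mortar_on P i \<mu> x - ?g x) (normal_trace P D i v) = 0)"
    unfolding trace_proj_def by (rule someI_ex)
  then obtain v where v: "v \<in> V" "?g = normal_trace P D i v"
    and g: "l2_inner ?F (\<lambda>x. mortar_on P i \<mu> x - ?g x) (normal_trace P D i v) = 0" by blast
  have gL: "?g \<in> L2 ?F" using tL[OF v(1)] v(2) by simp
  have "l2_inner ?F (\<lambda>x. mortar_on P i \<mu> x + (-1) *\<^sub>R ?g x) ?g = - l2_inner ?F ?g ?g"
    using l2_inner_add_left[OF mL L2_scaleR[OF gL, of "-1"] gL] orth[OF v(1)]
    by (simp only: l2_inner_scaleR_left v(2))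
  then have "l2_inner ?F ?g ?g = 0" using g v(2) by simp
  then have g0: "AE x in ?F. ?g x = 0" using l2_inner_self_eq_0_iff[OF gL] by simp
  have gA: "?g \<in> L2 (surface_on A)" using trace_L2[OF v(1) A] v(2) by simp
  have "l2_inner (surface_on A) ?g ?g = l2_inner ?F ?g (\<lambda>x. indicator A x * ?g x)"
    using surface_on_indicator(2)[OF A(1) Fb A(2)] by simp
  also have "\<dots> = 0"
    unfolding l2_inner_def using g0 by (intro integral_eq_zero_AE) (auto elim: eventually_mono)
  finally show ?thesis by (simp add: l2_norm_def)
qed

lemma trace_coefficient_in:
  assumes v: "v \<in> vel_st P D i" and a: "a \<in> adjacent" and h: "h \<in> L2 (surface_on (iface P a))"
  shows "(\<lambda>t. l2_inner (surface_on (iface P a)) h (normal_trace P D i (v t))) \<in> \<Psi>"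
proof (rule tensor_space_functional[OF time_space(1), where V = "V" and F = "\<lambda>v. l2_inner (surface_on (iface P a)) h (normal_trace P D i v)"])
  show "v \<in> tensor_space V \<Psi>" using v by (simp add: vel_st_def)
  fix n' :: nat and c :: "nat \<Rightarrow> real" and w :: "nat \<Rightarrow> real^'n \<Rightarrow> real^'n"
  assume w: "\<And>k. k < n' \<Longrightarrow> w k \<in> V"
  have "normal_trace P D i (w k) \<in> L2 (surface_on (iface P a))" if "k < n'" for k
    using trace_L2[OF w[OF that] iface_borel(1) iface_adjacent[OF a]] .
  then show "l2_inner (surface_on (iface P a)) h (normal_trace P D i (\<lambda>x. \<Sum>k<n'. c k *\<^sub>R w k x))
      = (\<Sum>k<n'. c k * l2_inner (surface_on (iface P a)) h (normal_trace P D i (w k)))"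
    using trace_lincomb[of n' w c] w l2_inner_lincomb_right[of "{..<n'}" "\<lambda>k. normal_trace P D i (w k)" "surface_on (iface P a)" h c] h by simp
qed

text \<open>The form in which the pairing is matched with the inner product of the mortar space.\<close>

lemma flux_time_interfaces:
  assumes v: "v \<in> vel_st P D i" and \<mu>: "\<mu> \<in> mortar_st P D"
    and b: "\<And>a. a \<in> interfaces P \<Longrightarrow> l2_basis (surface_on (iface P a)) (mortar_space D a) (nb a) (b a)"
  shows "flux_pairing_st P D i v \<mu> = (\<Sum>a\<in>adjacent. \<Sum>k<nb a.
     l2_inner I (\<lambda>t. l2_inner (surface_on (iface P a)) (\<mu> a t) (b a k))
       (\<lambda>t. l2_inner (surface_on (iface P a)) (b a k) (normal_trace P D i (v t))))"
proof -
  let ?M = "\<lambda>a k t. l2_inner (surface_on (iface P a)) (\<mu> a t) (b a k)"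
  let ?G = "\<lambda>a k t. l2_inner (surface_on (iface P a)) (b a k) (normal_trace P D i (v t))"
  have bL: "b a k \<in> L2 (surface_on (iface P a))" if "a \<in> interfaces P" "k < nb a" for a k
    using b[OF that(1)] that mortar_space_facts(2)[OF that(1)] by (auto simp: l2_basis_def)
  have "flux_pairing P D i (v t) (\<lambda>a. \<mu> a t) = (\<Sum>a\<in>adjacent. \<Sum>k<nb a. ?M a k t * ?G a k t)" for t
    unfolding flux_interfaces[OF slice(1)[OF v] mortar_slice_L2[OF \<mu>]]
  proof (rule sum.cong[OF refl])
    fix a assume a: "a \<in> adjacent"
    then have ai: "a \<in> interfaces P" by simp
    show "l2_inner (surface_on (iface P a)) (normal_trace P D i (v t)) (\<mu> a t) = (\<Sum>k<nb a. ?M a k t * ?G a k t)"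
      using l2_inner_expansion[OF b[OF ai] mortar_space_facts(2)[OF ai] mortar_slice[OF \<mu> ai]
          trace_L2[OF slice(1)[OF v] iface_borel(1) iface_adjacent[OF a]]]
      by (simp add: l2_inner_commute[of _ "normal_trace P D i (v t)" "\<mu> a t"])
  qed
  then have "flux_pairing_st P D i v \<mu> = (LINT t|I. (\<Sum>a\<in>adjacent. \<Sum>k<nb a. ?M a k t * ?G a k t))"
    by (simp add: flux_pairing_st_def time_form_def)
  have int: "integrable I (\<lambda>t. ?M a k t * ?G a k t)" if a: "a \<in> adjacent" and k: "k < nb a" for a k
  proof (rule L2_mult_integrable)
    have ai: "a \<in> interfaces P" using a by simp
    have "?M a k \<in> mortar_time_space D a"
      using \<mu> ai mortar_space_facts[OF ai] bL[OF ai k]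
      by (intro tensor_space_coefficient[where V = "mortar_space D a"] lincomb_closed_finite_dim) (auto simp: mortar_st_def)
    then show "?M a k \<in> L2 I" using time_cond[of a] a time_space(2) by blast
    show "?G a k \<in> L2 I" using trace_coefficient_in[OF v a bL[OF ai k]] time_space(2) by blast
  qed
  have "flux_pairing_st P D i v \<mu> = (LINT t|I. (\<Sum>a\<in>adjacent. \<Sum>k<nb a. ?M a k t * ?G a k t))" by fact
  also have "\<dots> = (\<Sum>a\<in>adjacent. LINT t|I. (\<Sum>k<nb a. ?M a k t * ?G a k t))"
    using int by (intro Bochner_Integration.integral_sum Bochner_Integration.integrable_sum) auto
  also have "\<dots> = (\<Sum>a\<in>adjacent. \<Sum>k<nb a. LINT t|I. ?M a k t * ?G a k t)"
    using int by (intro sum.cong refl Bochner_Integration.integral_sum) auto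
  finally show ?thesis by (simp add: l2_inner_def)
qed

end

section \<open>The Steklov-Poincare operator\<close>

lemma subdomain_discretization_exists:
  fixes P :: "'n::finite problem"
  assumes card: "CARD('n) \<ge> 2" and P: "valid_problem P" and D: "valid_discretization P D" and i: "i < num_sub P"
    and time_cond: "\<And>a. a \<in> interfaces P \<Longrightarrow>
        mortar_time_space D a \<subseteq> sub_time_space P D (fst a) \<inter> sub_time_space P D (snd a)"
  shows "\<exists>n e m f. subdomain_discretization P D i n e m f"
proof -
  have mixed: "mixed_pair (sub P i) (mesh D i) (vel_space D i) (pres_space D i)"
    using D i by (simp add: valid_discretization_def)
  have "vel_space D i \<subseteq> L2 (lebesgue_on (sub P i))"
    using mixed Hdiv_weak_div(2) by (auto simp: mixed_pair_def)
  then obtain n e where e: "l2_basis (lebesgue_on (sub P i)) (vel_space D i) n e"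
    using l2_basis_finite_dim_exists mixed unfolding mixed_pair_def by blast
  obtain m f where f: "l2_basis (lebesgue_on (sub P i)) (pres_space D i) m f"
    using l2_basis_finite_dim_exists mixed unfolding mixed_pair_def by blast
  have "subdomain_discretization P D i n e m f"
    using card P D i e f time_cond by unfold_locales auto
  then show ?thesis by blast
qed

text \<open>The right-hand side is the \<open>L\<^sup>2\<close> pairing of \<open>\<mu>\<close> on each interface with minus the sum of the normal
  traces from its two sides.  The projection of this function onto the mortar space represents it; \<open>c\<close>
  collects its coefficient functions in time.\<close>

lemma steklov_poincare_image_exists:
  fixes P :: "'n::finite problem"
  assumes card: "CARD('n) \<ge> 2" and P: "valid_problem P" and D: "valid_discretization P D"
    and time_cond: "\<And>a. a \<in> interfaces P \<Longrightarrow>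
        mortar_time_space D a \<subseteq> sub_time_space P D (fst a) \<inter> sub_time_space P D (snd a)"
    and u: "\<And>i. i < num_sub P \<Longrightarrow> u i \<in> vel_st P D i"
  shows "\<exists>\<sigma>. \<sigma> \<in> mortar_st P D \<and> (\<forall>\<mu>\<in>mortar_st P D.
           mortar_inner_st P \<sigma> \<mu> = - (\<Sum>i<num_sub P. flux_pairing_st P D i (u i) \<mu>))"
proof -
  let ?I = "lebesgue_on {0<..<final_time P}" and ?E = "interfaces P"
  let ?s = "\<lambda>a. surface_on (iface P a)"
  have fd: "finite_dim_space (mortar_space D a)" "mortar_space D a \<subseteq> L2 (?s a)"
    "finite_dim_space (mortar_time_space D a)" if "a \<in> ?E" for a
    using D that by (auto simp: valid_discretization_def)
  have sub_L2: "sub_time_space P D i \<subseteq> L2 ?I" if "i < num_sub P" for i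
    unfolding sub_time_space_def using D that by (intro dg_space_L2) (simp add: valid_discretization_def)
  have tL2: "mortar_time_space D a \<subseteq> L2 ?I" if "a \<in> ?E" for a
    using time_cond[OF that] sub_L2[OF interfaces_less(1)[OF that]] by blast
  have "\<forall>a\<in>?E. \<exists>n e. l2_basis (?s a) (mortar_space D a) n e"
    using l2_basis_finite_dim_exists[OF fd(1,2)] by blast
  then obtain nb b where b: "\<And>a. a \<in> ?E \<Longrightarrow> l2_basis (?s a) (mortar_space D a) (nb a) (b a)" by metis
  have "\<forall>a\<in>?E. \<exists>n e. l2_basis ?I (mortar_time_space D a) n e"
    using l2_basis_finite_dim_exists[OF fd(3) tL2] by blast
  then obtain R \<theta> where \<theta>: "\<And>a. a \<in> ?E \<Longrightarrow> l2_basis ?I (mortar_time_space D a) (R a) (\<theta> a)" by metis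
  have bD: "b a k \<in> mortar_space D a" if "a \<in> ?E" "k < nb a" for a k
    using b[OF that(1)] that(2) by (simp add: l2_basis_def)
  have \<theta>D: "\<theta> a r \<in> mortar_time_space D a" if "a \<in> ?E" "r < R a" for a r
    using \<theta>[OF that(1)] that(2) by (simp add: l2_basis_def)
  define N where "N a = {i \<in> {..<num_sub P}. i = fst a \<or> i = snd a}" for a :: "nat \<times> nat"
  define G where "G i a k = (\<lambda>t. l2_inner (?s a) (b a k) (normal_trace P D i (u i t)))" for i a k
  have GL: "G i a k \<in> L2 ?I" if a: "a \<in> ?E" "i \<in> N a" and k: "k < nb a" for i a k
  proof -
    have iN: "i < num_sub P" "i = fst a \<or> i = snd a" using a(2) by (auto simp: N_def)
    obtain n e m f where "subdomain_discretization P D i n e m f"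
      using subdomain_discretization_exists[OF card P D iN(1) time_cond] by blast
    then interpret subdomain_discretization P D i n e m f .
    have "G i a k \<in> sub_time_space P D i"
      unfolding G_def using a(1) iN bD[OF a(1) k] fd(2)[OF a(1)] by (intro trace_coefficient_in u) auto
    then show ?thesis using sub_L2[OF iN(1)] by blast
  qed
  define s where "s a r k = - (\<Sum>i\<in>N a. l2_inner ?I (\<theta> a r) (G i a k))" for a r k
  define c where "c a k = (\<lambda>t. \<Sum>r<R a. s a r k * \<theta> a r t)" for a k
  define \<sigma> where "\<sigma> a = (\<lambda>t x. \<Sum>k<nb a. c a k t *\<^sub>R b a k x)" for a
  have cD: "c a k \<in> mortar_time_space D a" if "a \<in> ?E" for a k
    using lincomb_closed_finite_dim[OF fd(3)[OF that]] \<theta>D[OF that] by (simp add: lincomb_closed_def c_def)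
  have \<sigma>: "\<sigma> \<in> mortar_st P D"
    unfolding mortar_st_def
  proof (rule CollectI, rule ballI)
    fix a assume a: "a \<in> ?E"
    show "\<sigma> a \<in> tensor_space (mortar_space D a) (mortar_time_space D a)"
      unfolding \<sigma>_def by (rule tensor_space_intro) (use cD[OF a] bD[OF a] in auto)
  qed
  have "mortar_inner_st P \<sigma> \<mu> = - (\<Sum>i<num_sub P. flux_pairing_st P D i (u i) \<mu>)"
    if \<mu>: "\<mu> \<in> mortar_st P D" for \<mu>
  proof -
    define M where "M a k = (\<lambda>t. l2_inner (?s a) (\<mu> a t) (b a k))" for a k
    have MD: "M a k \<in> mortar_time_space D a" if "a \<in> ?E" "k < nb a" for a k
      unfolding M_def using \<mu> that fd[OF that(1)] bD[OF that]
      by (intro tensor_space_coefficient[where V = "mortar_space D a"] lincomb_closed_finite_dim) (auto simp: mortar_st_def)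
    have M_L2: "M a k \<in> L2 ?I" if "a \<in> ?E" "k < nb a" for a k using MD[OF that] tL2[OF that(1)] by blast
    have inner: "mortar_inner P (\<lambda>a. \<sigma> a t) (\<lambda>a. \<mu> a t) = (\<Sum>a\<in>?E. \<Sum>k<nb a. M a k t * c a k t)" for t
      unfolding mortar_inner_def
    proof (rule sum.cong[OF refl])
      fix a assume a: "a \<in> ?E"
      have \<mu>a: "\<mu> a t \<in> mortar_space D a" using \<mu> a by (intro tensor_space_slice[OF fd(1)[OF a]]) (auto simp: mortar_st_def)
      have \<sigma>a: "\<sigma> a t \<in> mortar_space D a" using \<sigma> a by (intro tensor_space_slice[OF fd(1)[OF a]]) (auto simp: mortar_st_def)
      have "l2_inner (?s a) (b a k) (\<sigma> a t) = c a k t" if "k < nb a" for k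
        unfolding \<sigma>_def using l2_basis_coefficient[OF b[OF a] fd(2)[OF a] that]
        by (simp add: l2_inner_commute[of _ "b a k"])
      then show "l2_inner (?s a) (\<sigma> a t) (\<mu> a t) = (\<Sum>k<nb a. M a k t * c a k t)"
        using l2_inner_expansion[OF b[OF a] fd(2)[OF a] \<mu>a, of "\<sigma> a t"] \<sigma>a fd(2)[OF a]
        by (auto simp: M_def l2_inner_commute[of _ "\<sigma> a t" "\<mu> a t"])
    qed
    have int: "integrable ?I (\<lambda>t. M a k t * c a k t)" if "a \<in> ?E" "k < nb a" for a k
      using L2_mult_integrable[OF M_L2[OF that]] cD[OF that(1)] tL2[OF that(1)] by blast
    have "mortar_inner_st P \<sigma> \<mu> = (LINT t|?I. (\<Sum>a\<in>?E. \<Sum>k<nb a. M a k t * c a k t))"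
      by (simp add: mortar_inner_st_def time_form_def inner)
    also have "\<dots> = (\<Sum>a\<in>?E. LINT t|?I. (\<Sum>k<nb a. M a k t * c a k t))"
      using int by (intro Bochner_Integration.integral_sum Bochner_Integration.integrable_sum) auto
    also have "\<dots> = (\<Sum>a\<in>?E. \<Sum>k<nb a. l2_inner ?I (M a k) (c a k))"
      unfolding l2_inner_def inner_real_def
      using int by (intro sum.cong refl Bochner_Integration.integral_sum) auto
    also have "\<dots> = (\<Sum>a\<in>?E. \<Sum>k<nb a. - (\<Sum>i\<in>N a. l2_inner ?I (M a k) (G i a k)))"
    proof (intro sum.cong refl)
      fix a k assume a: "a \<in> ?E" and "k \<in> {..<nb a}"
      then have k: "k < nb a" by simp
      have \<theta>L: "\<theta> a r \<in> L2 ?I" if "r < R a" for r using \<theta>D[OF a that] tL2[OF a] by blast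
      have "l2_inner ?I (M a k) (c a k) = (\<Sum>r<R a. s a r k * l2_inner ?I (M a k) (\<theta> a r))"
        unfolding c_def using l2_inner_lincomb_right[of "{..<R a}" "\<theta> a" ?I "M a k" "\<lambda>r. s a r k"] \<theta>L M_L2[OF a k] by simp
      also have "\<dots> = - (\<Sum>r<R a. \<Sum>i\<in>N a. l2_inner ?I (M a k) (\<theta> a r) * l2_inner ?I (\<theta> a r) (G i a k))"
        by (simp add: s_def sum_distrib_left sum_distrib_right sum_negf mult.commute)
      also have "\<dots> = - (\<Sum>i\<in>N a. \<Sum>r<R a. l2_inner ?I (M a k) (\<theta> a r) * l2_inner ?I (\<theta> a r) (G i a k))"
        by (subst sum.swap) simp
      also have "\<dots> = - (\<Sum>i\<in>N a. l2_inner ?I (M a k) (G i a k))"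
        using l2_inner_expansion[OF \<theta>[OF a] tL2[OF a] MD[OF a k] GL[OF a _ k]] by simp
      finally show "l2_inner ?I (M a k) (c a k) = - (\<Sum>i\<in>N a. l2_inner ?I (M a k) (G i a k))" .
    qed
    also have "\<dots> = - (\<Sum>a\<in>?E. \<Sum>i\<in>N a. \<Sum>k<nb a. l2_inner ?I (M a k) (G i a k))"
      unfolding sum_negf by (rule arg_cong[of _ _ uminus], rule sum.cong[OF refl], rule sum.swap)
    also have "\<dots> = - (\<Sum>i<num_sub P. \<Sum>a\<in>{a \<in> ?E. i = fst a \<or> i = snd a}. \<Sum>k<nb a. l2_inner ?I (M a k) (G i a k))"
      unfolding N_def using sum.swap_restrict[OF finite_interfaces[of P] finite_lessThan[of "num_sub P"],
        of "\<lambda>a i. \<Sum>k<nb a. l2_inner ?I (M a k) (G i a k)" "\<lambda>a i. i = fst a \<or> i = snd a"] by simp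
    also have "\<dots> = - (\<Sum>i<num_sub P. flux_pairing_st P D i (u i) \<mu>)"
    proof -
      have "flux_pairing_st P D i (u i) \<mu>
          = (\<Sum>a\<in>{a \<in> ?E. i = fst a \<or> i = snd a}. \<Sum>k<nb a. l2_inner ?I (M a k) (G i a k))" if i: "i < num_sub P" for i
      proof -
        obtain n e m f where "subdomain_discretization P D i n e m f"
          using subdomain_discretization_exists[OF card P D i time_cond] by blast
        then interpret subdomain_discretization P D i n e m f .
        show ?thesis unfolding M_def G_def using flux_time_interfaces[OF u[OF i] \<mu> b] .
      qed
      then show ?thesis by simp
    qed
    finally show ?thesis .
  qed
  with \<sigma> show ?thesis by blast
qed

theorem lemma7p1:
  fixes P :: "'n::finite problem" and \<D> :: "'n discretization set"
  assumes dim: "CARD('n) = 2 \<or> CARD('n) = 3"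
    and problem: "valid_problem P"
    and discr: "\<forall>D\<in>\<D>. valid_discretization P D"
    and shape: "shape_regular P \<D>"
    and inf_sup: "inf_sup_stable P \<D>"
    and mortar_space_cond:
      "\<exists>C>0. \<forall>D\<in>\<D>. \<forall>\<mu>\<in>mortar_sum P D. \<forall>(i, j)\<in>interfaces P.
         l2_norm (surface_on (iface P (i, j))) (\<mu> (i, j))
           \<le> C * (l2_norm (surface_on (iface P (i, j))) (trace_proj P D i (mortar_on P i \<mu>))
                + l2_norm (surface_on (iface P (i, j))) (trace_proj P D j (mortar_on P j \<mu>)))"
    and mortar_time_cond:
      "\<forall>D\<in>\<D>. \<forall>(i, j)\<in>interfaces P.
         mortar_time_space D (i, j) \<subseteq> sub_time_space P D i \<inter> sub_time_space P D j"
  shows "\<forall>D\<in>\<D>. \<forall>\<mu>\<in>mortar_st P D.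
           \<not> mortar_zero P \<mu> \<longrightarrow> 0 < mortar_inner_st P (steklov_poincare P D \<mu>) \<mu>"
proof (intro ballI impI)
  fix D \<mu> assume D\<D>: "D \<in> \<D>" and \<mu>: "\<mu> \<in> mortar_st P D" and nonzero: "\<not> mortar_zero P \<mu>"
  let ?I = "lebesgue_on {0<..<final_time P}" and ?u = "star_velocity P D \<mu>"
  have card: "CARD('n) \<ge> 2" using dim by auto
  have D: "valid_discretization P D" using discr D\<D> by blast
  have time_cond: "mortar_time_space D a \<subseteq> sub_time_space P D (fst a) \<inter> sub_time_space P D (snd a)"
    if "a \<in> interfaces P" for a
    using mortar_time_cond D\<D> that by fastforce
  have sub: "\<exists>n e m f. subdomain_discretization P D i n e m f" if "i < num_sub P" for i
    using subdomain_discretization_exists[OF card problem D that time_cond] .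
  have sol: "\<exists>p. is_subdomain_solution P D i \<mu> (?u i) p" if i: "i < num_sub P" for i
  proof -
    obtain n e m f where "subdomain_discretization P D i n e m f" using sub[OF i] by blast
    then interpret subdomain_discretization P D i n e m f .
    show ?thesis unfolding star_velocity_def by (rule someI_ex[OF solution_exists[OF \<mu>]])
  qed
  have u: "?u i \<in> vel_st P D i" if "i < num_sub P" for i
    using sol[OF that] by (auto simp: is_subdomain_solution_def)
  have "\<forall>\<mu>'\<in>mortar_st P D. mortar_inner_st P (steklov_poincare P D \<mu>) \<mu>'
      = - (\<Sum>i<num_sub P. flux_pairing_st P D i (?u i) \<mu>')"
    unfolding steklov_poincare_def
    using someI_ex[OF steklov_poincare_image_exists[OF card problem D time_cond u]] by blast
  then have S: "mortar_inner_st P (steklov_poincare P D \<mu>) \<mu> = (\<Sum>i<num_sub P. - flux_pairing_st P D i (?u i) \<mu>)"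
    using \<mu> by (simp add: sum_negf)
  have nonneg: "0 \<le> - flux_pairing_st P D i (?u i) \<mu>" if i: "i < num_sub P" for i
  proof -
    obtain n e m f where "subdomain_discretization P D i n e m f" using sub[OF i] by blast
    then interpret subdomain_discretization P D i n e m f .
    obtain p where "is_subdomain_solution P D i \<mu> (?u i) p" using sol[OF i] by blast
    from solution_energy[OF \<mu> this] show ?thesis by linarith
  qed
  show "0 < mortar_inner_st P (steklov_poincare P D \<mu>) \<mu>"
  proof (rule ccontr)
    assume "\<not> 0 < mortar_inner_st P (steklov_poincare P D \<mu>) \<mu>"
    moreover have "0 \<le> (\<Sum>i<num_sub P. - flux_pairing_st P D i (?u i) \<mu>)"
      using nonneg by (intro sum_nonneg) auto
    ultimately have "(\<Sum>i<num_sub P. - flux_pairing_st P D i (?u i) \<mu>) = 0" using S by linarith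
    then have zero: "flux_pairing_st P D i (?u i) \<mu> = 0" if "i < num_sub P" for i
      using nonneg that by (subst (asm) sum_nonneg_eq_0_iff) auto
    have flux: "AE t in ?I. \<forall>v\<in>vel_space D i. flux_pairing P D i v (\<lambda>a. \<mu> a t) = 0" if i: "i < num_sub P" for i
    proof -
      obtain n e m f where "subdomain_discretization P D i n e m f" using sub[OF i] by blast
      then interpret subdomain_discretization P D i n e m f .
      obtain p where p: "is_subdomain_solution P D i \<mu> (?u i) p" using sol[OF i] by blast
      show ?thesis using flux_vanishes[OF \<mu> solution_zero_energy[OF \<mu> p zero[OF i]]] .
    qed
    have "mortar_zero P \<mu>"
      unfolding mortar_zero_def
    proof
      fix a assume a: "a \<in> interfaces P"
      define i j where "i = fst a" and "j = snd a"
      have ij: "i < num_sub P" "j < num_sub P" "a = (i, j)" using interfaces_less[OF a] by (auto simp: i_def j_def)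
      obtain C where C: "\<And>\<nu>. \<nu> \<in> mortar_sum P D \<Longrightarrow> l2_norm (surface_on (iface P a)) (\<nu> a)
           \<le> C * (l2_norm (surface_on (iface P a)) (trace_proj P D i (mortar_on P i \<nu>))
                + l2_norm (surface_on (iface P a)) (trace_proj P D j (mortar_on P j \<nu>)))"
        using mortar_space_cond D\<D> a unfolding ij(3) by fastforce
      have proj: "l2_norm (surface_on (iface P a)) (trace_proj P D k (mortar_on P k (\<lambda>a. \<mu> a t))) = 0"
        if k: "k < num_sub P" "k = fst a \<or> k = snd a"
          and f0: "\<forall>v\<in>vel_space D k. flux_pairing P D k v (\<lambda>a. \<mu> a t) = 0" for k t
      proof -
        obtain n e m f where "subdomain_discretization P D k n e m f" using sub[OF k(1)] by blast
        then interpret subdomain_discretization P D k n e m f .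
        show ?thesis
          using f0 a k(2) by (intro trace_proj_vanishes mortar_slice_L2[OF \<mu>] iface_borel(1) iface_adjacent) auto
      qed
      have fd: "finite_dim_space (mortar_space D a')" "mortar_space D a' \<subseteq> L2 (surface_on (iface P a'))"
        if "a' \<in> interfaces P" for a'
        using D that by (auto simp: valid_discretization_def)
      have slice: "\<mu> a' t \<in> mortar_space D a'" if "a' \<in> interfaces P" for a' t
        using \<mu> that by (intro tensor_space_slice[OF fd(1)[OF that]]) (auto simp: mortar_st_def)
      show "AE t in ?I. AE x in surface_on (iface P a). \<mu> a t x = 0"
        using flux[OF ij(1)] flux[OF ij(2)]
      proof eventually_elim
        case (elim t)
        have "(\<lambda>a. \<mu> a t) \<in> mortar_sum P D" using slice by (simp add: mortar_sum_def)
        from C[OF this] have "l2_norm (surface_on (iface P a)) (\<mu> a t) \<le> 0"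
          using proj[OF ij(1) _ elim(1)] proj[OF ij(2) _ elim(2)] by (simp add: i_def j_def)
        then have "l2_inner (surface_on (iface P a)) (\<mu> a t) (\<mu> a t) = 0"
          using l2_inner_self_nonneg[of "surface_on (iface P a)" "\<mu> a t"] by (simp add: l2_norm_def)
        moreover have "\<mu> a t \<in> L2 (surface_on (iface P a))" using slice[OF a] fd(2)[OF a] by blast
        ultimately show ?case using l2_inner_self_eq_0_iff by blast
      qed
    qed
    with nonzero show False by blast
  qed
qed

end
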